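(* Let $V_D$ be a bounded, nonnegative, nonincreasing potential on the half line $[0,\infty)$ such that, for some $\delta_V>0$, $$V_D'(r)\le-\delta_V(1+r)^{-1}V_D(r)\le 0\quad\text{for all } r\ge 0$$ (in the sense of measures if $V_D$ is not everywhere differentiable), and let $P_D:=-\partial_r^2+V_D(r)$ with Dirichlet boundary condition at $0$. For all $\delta>0$, $\theta\in[0,1]$, and $z\in\mathbb C\setminus[0,\infty)$, we have $$\|(1+r)^{-\frac{1+\delta}{2}}(P_D-z)^{-1}(1+r)^{-\frac{1+\delta}{2}}\|\le\frac{1+\sqrt2}{\sqrt{|z|}}\left(\frac1\delta+\frac1{\delta_V}\right),$$ $$\|(1+r)^{-\frac{1+\delta}{2}-\theta}(P_D-z)^{-1}(1+r)^{-\frac{1+\delta}{2}-(1-\theta)}\|\le(1+\sqrt2)\left(\frac1\delta+\frac1{\delta_V}\right),$$ and $$\|V_D(r)^{\frac\theta2}(1+r)^{-\frac{1+(1-\theta)\delta}{2}}(P_D-z)^{-1}V_D(r)^{\frac{1-\theta}{2}}(1+r)^{-\frac{1+\theta\delta}{2}}\|\le\frac{2\sqrt2}{\delta_V}\sqrt{1+\frac{\delta_V}{\delta}},$$ where the norms are $L^2(\mathbb R_+)\to L^2(\mathbb R_+)$.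
   Context: $\mathbb R_+=(0,\infty)$. $P_D$ is regarded as a self-adjoint operator on $L^2(\mathbb R_+)$ with domain $\{u\in H^2(\mathbb R_+)\mid u(0)=0\}$. The zeroth power $V_D(r)^0$ (occurring when $\theta=0$ or $\theta=1$) means $1$. *)

theory Defs
  imports "HOL-Analysis.Analysis"
begin

abbreviation halfline :: "real measure" where
  "halfline \<equiv> lebesgue_on {0<..}"

section \<open>Potentials\<close>

text \<open>
  The measure \<open>-dV\<close> on \<open>[0,\<infinity>)\<close> of a nonincreasing \<open>V\<close>. The library's \<open>interval_measure\<close> needs a
  nondecreasing right-continuous function on the whole line, so \<open>V\<close> is replaced by its right limits
  on \<open>[0,\<infinity>)\<close> and continued by the constant \<open>V 0\<close> to the left of \<open>0\<close>.
\<close>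

definition neg_deriv_measure :: "(real \<Rightarrow> real) \<Rightarrow> real measure" where
  "neg_deriv_measure V = interval_measure (\<lambda>x. - (if x < 0 then V 0 else Lim (at_right x) V))"

lemma emeasure_neg_deriv_measure_Ioc:
  fixes V :: "real \<Rightarrow> real"
  assumes V: "antimono_on {0..} V" "0 \<le> a" "a \<le> b"
  shows "emeasure (neg_deriv_measure V) {a<..b} = ennreal (Lim (at_right a) V - Lim (at_right b) V)"
proof -
  have lim: "(V \<longlongrightarrow> Lim (at_right x) V) (at_right x)" if x: "x \<ge> 0" for x
  proof -
    have bdd: "bdd_above (V ` {x<..})" "V ` {x<..} \<noteq> {}"
      using V(1) x by (auto simp: monotone_on_def bdd_above_def intro!: exI[of _ "V x"])
    have "(V \<longlongrightarrow> (SUP y\<in>{x<..}. V y)) (at_right x)"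
    proof (rule order_tendstoI)
      fix l assume "l < (SUP y\<in>{x<..}. V y)"
      then obtain y where y: "y > x" "l < V y" using less_cSUP_iff[OF _ bdd(1)] by auto
      show "\<forall>\<^sub>F t in at_right x. l < V t"
        unfolding eventually_at_right_field
        using y V(1) x by (auto simp: monotone_on_def intro!: exI[of _ y] less_le_trans[OF y(2)])
    next
      fix l assume l: "(SUP y\<in>{x<..}. V y) < l"
      have "V t < l" if "t > x" for t using cSUP_upper[OF _ bdd(1), of t] l that by fastforce
      thus "\<forall>\<^sub>F t in at_right x. V t < l"
        unfolding eventually_at_right_field by (auto intro!: exI[of _ "x+1"])
    qed
    thus ?thesis using tendsto_Lim by (metis trivial_limit_at_right_real)
  qed
  let ?G = "\<lambda>x. if x < 0 then V 0 else Lim (at_right x) V"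
  have up: "?G x \<le> V x" if "x \<ge> 0" for x
  proof -
    have "\<forall>\<^sub>F t in at_right x. V t \<le> V x" unfolding eventually_at_right_field
      using V(1) that by (auto simp: monotone_on_def intro!: exI[of _ "x+1"])
    from tendsto_upperbound[OF lim[OF that] this] that show ?thesis by simp
  qed
  have lo: "?G x \<ge> V y" if "x < y" "x \<ge> 0" for x y
  proof -
    have "\<forall>\<^sub>F t in at_right x. V t \<ge> V y" unfolding eventually_at_right_field
      using V(1) that by (auto simp: monotone_on_def intro!: exI[of _ y])
    from tendsto_lowerbound[OF lim this] that show ?thesis by simp
  qed
  have mono: "?G y \<le> ?G x" if xy: "x \<le> y" for x y
  proof -
    consider "x = y" | "x < y" "x \<ge> 0" | "x < 0" "y < 0" | "x < 0" "y \<ge> 0" using xy by linarith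
    thus ?thesis
    proof cases
      case 2 then show ?thesis using lo[of x y] up[of y] by linarith
    next
      case 4 then have "V y \<le> V 0" using V(1) by (auto simp: monotone_on_def)
      then show ?thesis using 4 up[of y] by auto
    qed auto
  qed
  have rc: "continuous (at_right x) ?G" for x
  proof (cases "x < 0")
    case True
    then have "\<forall>\<^sub>F t in at_right x. ?G t = V 0" unfolding eventually_at_right_field
      by (auto intro!: exI[of _ 0])
    then show ?thesis using True unfolding continuous_within by (simp add: tendsto_eventually)
  next
    case False
    have "(?G \<longlongrightarrow> Lim (at_right x) V) (at_right x)"
    proof (rule tendsto_sandwich)
      show "\<forall>\<^sub>F t in at_right x. ?G t \<le> Lim (at_right x) V"
        using mono[of x] False unfolding eventually_at_right_field by (auto intro!: exI[of _ "x+1"])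
      show "\<forall>\<^sub>F t in at_right x. V (2*t - x) \<le> ?G t"
        unfolding eventually_at_right_field using lo False
        by (intro exI[of _ "x+1"]) (auto)
      have "filterlim (\<lambda>t. 2*t-x) (at_right x) (at_right x)"
        unfolding filterlim_at by (auto intro!: tendsto_eq_intros simp: eventually_at_right_field intro: exI[of _ "x+1"])
      then show "((\<lambda>t. V (2*t-x)) \<longlongrightarrow> Lim (at_right x) V) (at_right x)"
        using filterlim_compose[OF lim, of x "\<lambda>t. 2*t-x"] False by auto
    qed auto
    then show ?thesis using False unfolding continuous_within by simp
  qed
  show ?thesis unfolding neg_deriv_measure_def
    by (subst emeasure_interval_measure_Ioc) (use V(2,3) in \<open>auto simp: mono intro!: continuous_minus rc\<close>)
qed

text \<open>
  \<open>V' \<le> -c (1+r)\<^sup>-\<^sup>1 V\<close> on \<open>[0,\<infinity>)\<close> in the sense of measures, that is, \<open>c (1+r)\<^sup>-\<^sup>1 V dr \<le> -dV\<close>. If \<open>V\<close> is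
  differentiable everywhere, it is absolutely continuous (being monotone), \<open>-dV = -V' dr\<close>, and this
  is the pointwise inequality.
\<close>

definition log_decay :: "real \<Rightarrow> (real \<Rightarrow> real) \<Rightarrow> bool" where
  "log_decay c V \<longleftrightarrow>
     (\<forall>A\<in>sets borel. A \<subseteq> {0..} \<longrightarrow>
        (\<integral>\<^sup>+r\<in>A. ennreal (c * inverse (1 + r) * V r) \<partial>lborel) \<le> emeasure (neg_deriv_measure V) A)"

definition admissible_potential :: "real \<Rightarrow> (real \<Rightarrow> real) \<Rightarrow> bool" where
  "admissible_potential \<delta>\<^sub>V V \<longleftrightarrow>
     bounded (V ` {0..}) \<and> (\<forall>r\<ge>0. 0 \<le> V r) \<and> antimono_on {0..} V \<and> log_decay \<delta>\<^sub>V V"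

section \<open>Square-integrable functions and operator norms\<close>

text \<open>
  Elements of \<open>L\<^sup>2(\<real>\<^sub>+)\<close> are handled through representatives \<open>real \<Rightarrow> complex\<close>; only their values on
  \<open>(0,\<infinity>)\<close>, up to null sets, matter.
\<close>

definition L2 :: "(real \<Rightarrow> complex) set" where
  "L2 = {f. f \<in> borel_measurable halfline \<and> integrable halfline (\<lambda>r. (cmod (f r))\<^sup>2)}"

definition L2_norm :: "(real \<Rightarrow> complex) \<Rightarrow> ennreal" where
  "L2_norm f =
     (if f \<in> L2 then ennreal (sqrt (LINT r|halfline. (cmod (f r))\<^sup>2)) else \<infinity>)"

text \<open>
  The value is \<open>\<infinity>\<close> unless the operator maps \<open>L2\<close> to \<open>L2\<close> boundedly, so a finite bound includes
  boundedness.
\<close>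

definition op_norm :: "((real \<Rightarrow> complex) \<Rightarrow> (real \<Rightarrow> complex)) \<Rightarrow> ennreal" where
  "op_norm T = (SUP f\<in>{f. L2_norm f \<le> 1}. L2_norm (T f))"

definition mult_op :: "(real \<Rightarrow> real) \<Rightarrow> (real \<Rightarrow> complex) \<Rightarrow> (real \<Rightarrow> complex)" where
  "mult_op w f = (\<lambda>r. of_real (w r) * f r)"

section \<open>The Dirichlet operator and its resolvent\<close>

definition test_function :: "(real \<Rightarrow> real) \<Rightarrow> bool" where
  "test_function \<phi> \<longleftrightarrow>
     (\<forall>k x. (deriv ^^ k) \<phi> differentiable (at x)) \<and>
     compact (closure {x. \<phi> x \<noteq> 0}) \<and> closure {x. \<phi> x \<noteq> 0} \<subseteq> {0<..}"

definition locally_integrable :: "(real \<Rightarrow> complex) \<Rightarrow> bool" where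
  "locally_integrable u \<longleftrightarrow> (\<forall>K. compact K \<and> K \<subseteq> {0<..} \<longrightarrow> set_integrable lebesgue K u)"

definition is_weak_deriv :: "(real \<Rightarrow> complex) \<Rightarrow> (real \<Rightarrow> complex) \<Rightarrow> bool" where
  "is_weak_deriv u v \<longleftrightarrow> locally_integrable u \<and> locally_integrable v \<and>
     (\<forall>\<phi>. test_function \<phi> \<longrightarrow>
        (LINT r|halfline. u r * of_real (deriv \<phi> r)) = - (LINT r|halfline. v r * of_real (\<phi> r)))"

definition weak_deriv :: "(real \<Rightarrow> complex) \<Rightarrow> (real \<Rightarrow> complex)" where
  "weak_deriv u = (SOME v. is_weak_deriv u v)"

definition H2 :: "(real \<Rightarrow> complex) set" where
  "H2 = {u \<in> L2. \<exists>v\<in>L2. \<exists>w\<in>L2. is_weak_deriv u v \<and> is_weak_deriv v w}"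

text \<open>The condition \<open>u(0) = 0\<close> refers to the continuous representative of \<open>u\<close>.\<close>

definition zero_trace :: "(real \<Rightarrow> complex) \<Rightarrow> bool" where
  "zero_trace u \<longleftrightarrow>
     (\<exists>u'. continuous_on {0..} u' \<and> (AE r in halfline. u' r = u r) \<and> u' 0 = 0)"

definition dom_PD :: "(real \<Rightarrow> complex) set" where
  "dom_PD = {u \<in> H2. zero_trace u}"

definition PD :: "(real \<Rightarrow> real) \<Rightarrow> (real \<Rightarrow> complex) \<Rightarrow> (real \<Rightarrow> complex)" where
  "PD V u = (\<lambda>r. - weak_deriv (weak_deriv u) r + of_real (V r) * u r)"

text \<open>
  \<open>(P\<^sub>D - z)\<^sup>-\<^sup>1 f\<close>. Solutions are unique up to null sets for \<open>z\<close> in the resolvent set. Where there is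
  no solution the value is unspecified, so a norm bound involves the solvability of the equation.
\<close>

definition resolvent ::
    "(real \<Rightarrow> real) \<Rightarrow> complex \<Rightarrow> (real \<Rightarrow> complex) \<Rightarrow> (real \<Rightarrow> complex)" where
  "resolvent V z f =
     (SOME u. u \<in> dom_PD \<and> (AE r in halfline. PD V u r - z * u r = f r))"

section \<open>Weights\<close>

definition wt :: "real \<Rightarrow> real \<Rightarrow> real" where
  "wt a r = (1 + r) powr a"

text \<open>\<open>V(r)\<^sup>0 = 1\<close> also where \<open>V(r) = 0\<close>, whereas \<open>0 powr 0 = 0\<close> in the library.\<close>

definition pot_power :: "(real \<Rightarrow> real) \<Rightarrow> real \<Rightarrow> real \<Rightarrow> real" where
  "pot_power V a r = (if a = 0 then 1 else V r powr a)"

end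

theory Submission
  imports Defs "HOL-Real_Asymp.Real_Asymp"
begin

text \<open>
  Write \<open>z = k\<^sup>2\<close> with \<open>Im k > 0\<close>, let \<open>-u'' + (V - z) u = f\<close>, \<open>u(0) = 0\<close>, and put
  \<open>E = |u'|\<^sup>2 + |k|\<^sup>2 |u|\<^sup>2\<close>. The equation tested with \<open>u\<close> gives
  \<open>Im k \<integral>E \<le> |k| \<integral>|f||u|\<close> for every \<open>z\<close> off the half line. For a multiplier
  \<open>w = 1/\<delta> + K - (1+r)\<^sup>-\<^sup>\<delta>/\<delta>\<close>, integrating \<open>(w (E - V|u|\<^sup>2))'\<close> and using \<open>-V' \<ge> \<delta>\<^sub>V (1+r)\<^sup>-\<^sup>1 V\<close>
  then yields, with \<open>M = 1/\<delta> + K\<close>,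
  \<open>\<integral>(1+r)\<^sup>-\<^sup>1\<^sup>-\<^sup>\<delta> E + (\<delta>\<^sub>V K - 1) \<integral>(1+r)\<^sup>-\<^sup>1 V|u|\<^sup>2 \<le> 2M \<integral>|f| (|u'| + |k||u|)\<close>.
  Completing squares, \<open>K = 1/\<delta>\<^sub>V\<close> gives the first bound and, by a Hardy inequality, the second one for
  \<open>\<theta> = 1\<close>; the optimal \<open>K = 1/\<delta> + 2/\<delta>\<^sub>V\<close> gives the third one for \<open>\<theta> = 1\<close>. The resolvent is symmetric for
  the bilinear pairing, so \<open>\<theta> = 0\<close> is the transpose, and intermediate \<open>\<theta>\<close> follow by interpolation: the
  best constant \<open>N(\<theta>)\<close> satisfies \<open>N(\<theta>)\<^sup>2 \<le> N(0) N(2\<theta>)\<close> and \<open>N(\<theta>) = N(1-\<theta>)\<close>.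
\<close>

section \<open>Calculus of absolutely continuous functions\<close>

text \<open>The obstacle is that \<open>V\<close> is only monotone, so the energy including the
  potential has no derivative. Only \<open>w * E\<close> is differentiated, with
  \<open>V * u\<close> counted as source, and the remaining integral of \<open>V\<close> is bounded
  below by a mean value argument for monotone functions. Taking |k|^2 rather than Re z in
  \<open>E\<close> keeps \<open>E\<close> definite for every z; the price is an error of size Im k
  times \<open>E\<close>, which is exactly what the tested equation controls. Since
  \<open>resolvent\<close> is a choice among solutions, a norm bound also needs solvability. The
  free equation factors into two first order ones; the potential is then added in finitely many
  equal portions, whose admissible size depends on z alone because the a priori bound is the same
  for all nonnegative potentials. Weak derivatives are replaced by integrals, so every integration
  by parts takes place on a bounded interval, and boundary terms at infinity disappear along a
  sequence only. The interpolation inequality becomes an estimate because the best constant over all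
  \<theta> is finite beforehand, by boundedness of the resolvent and of the weights.\<close>

text \<open>\<open>F\<close> is locally absolutely continuous on \<open>[0,\<infinity>)\<close> with almost everywhere derivative \<open>f\<close>.\<close>

definition AC :: "(real \<Rightarrow> complex) \<Rightarrow> (real \<Rightarrow> complex) \<Rightarrow> bool" where
  "AC F f \<longleftrightarrow> (\<forall>r\<ge>0. f absolutely_integrable_on {0..r} \<and> (f has_integral (F r - F 0)) {0..r})"

lemma AC_I:
  assumes "\<And>r. r \<ge> 0 \<Longrightarrow> f absolutely_integrable_on {0..r}"
    and "\<And>r. r \<ge> 0 \<Longrightarrow> F r = F 0 + integral {0..r} f"
  shows "AC F f"
  unfolding AC_def
proof (intro allI impI conjI)
  fix r :: real assume r: "r \<ge> 0"
  show f: "f absolutely_integrable_on {0..r}" by (rule assms(1)[OF r])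
  show "(f has_integral (F r - F 0)) {0..r}"
    using f assms(2)[OF r] by (simp add: has_integral_iff absolutely_integrable_on_def)
qed

lemma AC_absolutely_integrable: "AC F f \<Longrightarrow> f absolutely_integrable_on {0..r}"
  unfolding AC_def by (cases "r \<ge> 0") auto

lemma AC_eq: "AC F f \<Longrightarrow> r \<ge> 0 \<Longrightarrow> F r = F 0 + integral {0..r} f"
  unfolding AC_def by (metis has_integral_iff eq_diff_eq add.commute)

lemma AC_has_integral: "AC F f \<Longrightarrow> r \<ge> 0 \<Longrightarrow> (f has_integral (F r - F 0)) {0..r}"
  unfolding AC_def by auto

lemma AC_continuous: assumes "AC F f" shows "continuous_on {0..} F"
proof -
  have "continuous_on {0..R} F" for R
  proof (cases "R \<ge> 0")
    case True
    have "continuous_on {0..R} (\<lambda>r. F 0 + integral {0..r} f)"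
      using AC_absolutely_integrable[OF assms]
      by (intro continuous_intros indefinite_integral_continuous_1) (auto simp: absolutely_integrable_on_def)
    then show ?thesis
      by (rule continuous_on_eq) (rule AC_eq[OF assms, symmetric], simp)
  qed auto
  then show ?thesis
    unfolding continuous_on_eq_continuous_within
  proof (intro ballI)
    fix x :: real assume a: "\<And>R. \<forall>x\<in>{0..R}. continuous (at x within {0..R}) F" and x: "x \<in> {0..}"
    have "at x within {0..} = at x within {0..x+1}"
      by (rule at_within_nhd[of _ "{..<x+1}"]) auto
    then show "continuous (at x within {0..}) F" using a[of "x+1"] x
      by (auto simp: continuous_within)
  qed
qed

lemma AC_C1:
  assumes "\<And>x. x \<ge> 0 \<Longrightarrow> (F has_vector_derivative f x) (at x within {0..})" "continuous_on {0..} f"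
  shows "AC F f"
  unfolding AC_def
proof (intro allI impI conjI)
  fix r :: real assume r: "r \<ge> 0"
  show "f absolutely_integrable_on {0..r}"
    by (intro absolutely_integrable_continuous_real continuous_on_subset[OF assms(2)]) auto
  show "(f has_integral F r - F 0) {0..r}"
    by (rule fundamental_theorem_of_calculus[OF r])
      (rule has_vector_derivative_within_subset[OF assms(1)]; auto)
qed

lemma AC_C1_real:
  assumes "\<And>x. x \<ge> 0 \<Longrightarrow> (F has_real_derivative f x) (at x within {0..})" "continuous_on {0..} f"
  shows "AC (\<lambda>x. of_real (F x)) (\<lambda>x. of_real (f x))"
  by (rule AC_C1) (use assms in \<open>auto intro!: continuous_on_of_real has_vector_derivative_of_real
    simp: has_real_derivative_iff_has_vector_derivative\<close>)

lemma AC_cong: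
  assumes "AC F f" "\<And>x. x \<ge> 0 \<Longrightarrow> F x = G x" "\<And>x. x \<ge> 0 \<Longrightarrow> f x = g x"
  shows "AC G g"
  unfolding AC_def
proof (intro allI impI conjI)
  fix r :: real assume r: "r \<ge> 0"
  show "g absolutely_integrable_on {0..r}"
    by (rule absolutely_integrable_spike[OF AC_absolutely_integrable[OF assms(1)], of "{}"])
      (use assms(3) in auto)
  show "(g has_integral G r - G 0) {0..r}"
    using has_integral_cong[of "{0..r}" f g "G r - G 0"] AC_has_integral[OF assms(1) r] assms(2,3) r by simp
qed

lemma AC_add: "AC F f \<Longrightarrow> AC G g \<Longrightarrow> AC (\<lambda>x. F x + G x) (\<lambda>x. f x + g x)"
  unfolding AC_def
proof (intro allI impI conjI)
  fix r :: real assume *: "\<forall>r\<ge>0. f absolutely_integrable_on {0..r} \<and> (f has_integral F r - F 0) {0..r}"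
    "\<forall>r\<ge>0. g absolutely_integrable_on {0..r} \<and> (g has_integral G r - G 0) {0..r}" "r \<ge> 0"
  show "(\<lambda>x. f x + g x) absolutely_integrable_on {0..r}"
    using * by (intro set_integral_add) auto
  show "((\<lambda>x. f x + g x) has_integral F r + G r - (F 0 + G 0)) {0..r}"
    using has_integral_add[of f "F r - F 0" "{0..r}" g "G r - G 0"] * by (simp add: algebra_simps)
qed

lemma AC_linear:
  assumes "bounded_linear h" "AC F f"
  shows "AC (\<lambda>x. h (F x)) (\<lambda>x. h (f x))"
  unfolding AC_def
proof (intro allI impI conjI)
  fix r :: real assume r: "r \<ge> 0"
  show "(\<lambda>x. h (f x)) absolutely_integrable_on {0..r}"
    using absolutely_integrable_linear[OF AC_absolutely_integrable[OF assms(2)] assms(1)] by (simp add: o_def)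
  show "((\<lambda>x. h (f x)) has_integral h (F r) - h (F 0)) {0..r}"
    using has_integral_linear[OF AC_has_integral[OF assms(2) r] assms(1)]
    by (simp add: o_def linear_diff[OF bounded_linear.linear[OF assms(1)]])
qed

lemma AC_cmult: "AC F f \<Longrightarrow> AC (\<lambda>x. c * F x) (\<lambda>x. c * f x)"
  by (rule AC_linear[OF bounded_linear_mult_right])

lemma AC_cnj: "AC F f \<Longrightarrow> AC (\<lambda>x. cnj (F x)) (\<lambda>x. cnj (f x))"
  by (rule AC_linear[OF bounded_linear_cnj])

lemma AC_diff: "AC F f \<Longrightarrow> AC G g \<Longrightarrow> AC (\<lambda>x. F x - G x) (\<lambda>x. f x - g x)"
  using AC_add[of F f "\<lambda>x. (-1) * G x" "\<lambda>x. (-1) * g x"] AC_cmult[of G g "-1"] by simp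

lemma AC_const: "AC (\<lambda>x. c) (\<lambda>x. 0)"
  by (simp add: AC_def)

lemma absolutely_integrable_continuous_mult:
  fixes f G :: "real \<Rightarrow> complex"
  assumes "f absolutely_integrable_on {0..r}" "continuous_on {0..r} G"
  shows "(\<lambda>x. G x * f x) absolutely_integrable_on {0..r}"
proof (rule absolutely_integrable_bounded_measurable_product[of "(*)" G, OF _ _ _ _ assms(1)])
  show "G \<in> borel_measurable (lebesgue_on {0..r})"
    by (rule continuous_imp_measurable_on_sets_lebesgue[OF assms(2)]) auto
  show "bounded (G ` {0..r})"
    using assms(2) compact_continuous_image compact_imp_bounded by blast
qed (auto simp: bilinear_times)

lemma integrable_if_le:
  fixes h :: "real \<Rightarrow> complex"
  assumes "integrable M h" and [measurable]: "(\<lambda>x. x) \<in> borel_measurable M"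
  shows "integrable M (\<lambda>t. if t \<le> x then h t else 0)"
proof (rule Bochner_Integration.integrable_bound[OF assms(1)])
  have [measurable]: "h \<in> borel_measurable M" using assms(1) by simp
  show "(\<lambda>t. if t \<le> x then h t else 0) \<in> borel_measurable M" by measurable
qed auto

text \<open>The diagonal cuts the square [0,r] x [0,r] into two triangles; Fubini for
  \<open>f x * g t\<close> on each of them gives one summand. This is integration by parts for
  functions that have a derivative only almost everywhere.\<close>

lemma Fubini_triangle:
  fixes f g :: "real \<Rightarrow> complex"
  assumes f: "f absolutely_integrable_on {0..r}" and g: "g absolutely_integrable_on {0..r}"
  shows "integral {0..r} (\<lambda>x. f x * integral {0..x} g) + integral {0..r} (\<lambda>x. g x * integral {0..x} f)
    = integral {0..r} f * integral {0..r} g"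
proof -
  define M where "M = lebesgue_on {0..r}"
  have "finite_measure M" unfolding M_def by (rule finite_measure_lebesgue_on) auto
  then interpret finite_measure M .
  interpret P: pair_sigma_finite M M ..
  have fi: "integrable M f" "integrable M g"
    unfolding M_def using f g by (auto intro: absolutely_integrable_imp_integrable)
  have [measurable]: "f \<in> borel_measurable M" "g \<in> borel_measurable M" using fi by auto
  have idM[measurable]: "(\<lambda>x. x) \<in> borel_measurable M" unfolding M_def
    using id_borel_measurable_lebesgue_on[of "{0..r}"] unfolding id_def .
  have sub: "integral {0..x} h = (LINT t|M. (if t \<le> x then h t else 0))"
    if "h absolutely_integrable_on {0..r}" "x \<in> {0..r}" for h :: "real \<Rightarrow> complex" and x
  proof -
    have "integral {0..x} h = integral {0..r} (\<lambda>t. if t \<in> {0..x} then h t else 0)"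
      using that by (subst integral_restrict_Int) (auto intro!: arg_cong[of _ _ "\<lambda>S. integral S h"])
    also have "\<dots> = integral {0..r} (\<lambda>t. if t \<le> x then h t else 0)"
      by (rule integral_cong) auto
    also have "\<dots> = (LINT t|M. (if t \<le> x then h t else 0))"
      unfolding M_def
    proof (rule lebesgue_integral_eq_integral[symmetric])
      have "integrable (lebesgue_on {0..r}) h" using that(1) by (auto intro: absolutely_integrable_imp_integrable)
      then show "integrable (lebesgue_on {0..r}) (\<lambda>t. if t \<le> x then h t else 0)"
        unfolding M_def[symmetric] by (rule integrable_if_le[OF _ idM])
    qed auto
    finally show ?thesis .
  qed
  have prod: "integrable (M \<Otimes>\<^sub>M M) (\<lambda>(x,t). f x * g t)"
    by (rule P.Fubini_integrable) (use fi in \<open>auto simp: norm_mult\<close>)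
  have i1: "integrable (M \<Otimes>\<^sub>M M) (\<lambda>(x,t). if t \<le> x then f x * g t else 0)"
    using prod by (rule Bochner_Integration.integrable_bound) (auto simp: split_beta')
  have i2: "integrable (M \<Otimes>\<^sub>M M) (\<lambda>(x,t). if x \<le> t then f x * g t else 0)"
    using prod by (rule Bochner_Integration.integrable_bound) (auto simp: split_beta')
  have conv: "integral {0..r} h = (LINT x|M. h x)" if "h absolutely_integrable_on {0..r}" for h :: "real \<Rightarrow> complex"
    unfolding M_def by (rule lebesgue_integral_eq_integral[symmetric])
      (use that in \<open>auto intro: absolutely_integrable_imp_integrable\<close>)
  have e1: "integral {0..r} (\<lambda>x. f x * integral {0..x} g) = (LINT x|M. f x * (LINT t|M. (if t \<le> x then g t else 0)))"
  proof (subst conv)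
    show "(\<lambda>x. f x * integral {0..x} g) absolutely_integrable_on {0..r}"
      using absolutely_integrable_continuous_mult[OF f indefinite_integral_continuous_1[of g 0 r]] g
      by (auto simp: mult.commute absolutely_integrable_on_def)
    show "(LINT x|M. f x * integral {0..x} g) = (LINT x|M. f x * (LINT t|M. (if t \<le> x then g t else 0)))"
      by (rule Bochner_Integration.integral_cong) (auto simp: M_def sub[OF g, unfolded M_def])
  qed
  have e2: "integral {0..r} (\<lambda>x. g x * integral {0..x} f) = (LINT x|M. g x * (LINT t|M. (if t \<le> x then f t else 0)))"
  proof (subst conv)
    show "(\<lambda>x. g x * integral {0..x} f) absolutely_integrable_on {0..r}"
      using absolutely_integrable_continuous_mult[OF g indefinite_integral_continuous_1[of f 0 r]] f
      by (auto simp: mult.commute absolutely_integrable_on_def)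
    show "(LINT x|M. g x * integral {0..x} f) = (LINT x|M. g x * (LINT t|M. (if t \<le> x then f t else 0)))"
      by (rule Bochner_Integration.integral_cong) (auto simp: M_def sub[OF f, unfolded M_def])
  qed
  have "(LINT x|M. g x * (LINT t|M. (if t \<le> x then f t else 0)))
      = (LINT x|M. (LINT t|M. (if t \<le> x then f t * g x else 0)))"
    by (subst integral_mult_right_zero[symmetric]) (intro Bochner_Integration.integral_cong refl, auto)
  \<comment> \<open>Swapping the order turns the second iterated integral into one over the opposite
    triangle, with the outer variable in \<open>f\<close> for both summands.\<close>
  also have "\<dots> = (LINT t|M. (LINT x|M. (if t \<le> x then f t * g x else 0)))"
    by (rule P.Fubini_integral) (use i2 in \<open>auto\<close>)
  finally have e2': "integral {0..r} (\<lambda>x. g x * integral {0..x} f) = (LINT x|M. (LINT t|M. (if x \<le> t then f x * g t else 0)))"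
    using e2 by simp
  have e1': "integral {0..r} (\<lambda>x. f x * integral {0..x} g) = (LINT x|M. (LINT t|M. (if t \<le> x then f x * g t else 0)))"
    unfolding e1
    by (subst integral_mult_right_zero[symmetric]) (intro Bochner_Integration.integral_cong refl, auto)
  \<comment> \<open>Both triangles contain the diagonal; it meets each vertical line in one point,
    so the overlap does not count.\<close>
  have ae: "AE t in M. t \<noteq> x" for x
  proof -
    have "AE t in lebesgue. t \<noteq> x"
      by (rule AE_I[of _ _ "{x}"]) auto
    then show ?thesis unfolding M_def by (subst AE_restrict_space_iff) auto
  qed
  have "(LINT x|M. (LINT t|M. (if t \<le> x then f x * g t else 0))) + (LINT x|M. (LINT t|M. (if x \<le> t then f x * g t else 0)))
     = (LINT x|M. (LINT t|M. (if t \<le> x then f x * g t else 0)) + (LINT t|M. (if x \<le> t then f x * g t else 0)))"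
    using P.integrable_fst'[OF i1] P.integrable_fst'[OF i2] by (subst Bochner_Integration.integral_add) auto
  also have "\<dots> = (LINT x|M. f x * (LINT t|M. g t))"
  proof (rule Bochner_Integration.integral_cong[OF refl])
    fix x
    have j1: "integrable M (\<lambda>t. if t \<le> x then f x * g t else 0)" "integrable M (\<lambda>t. if x \<le> t then f x * g t else 0)"
      by (rule Bochner_Integration.integrable_bound[OF integrable_mult_right[OF fi(2), of "f x"]]; auto)+
    have "(LINT t|M. (if t \<le> x then f x * g t else 0)) + (LINT t|M. (if x \<le> t then f x * g t else 0))
      = (LINT t|M. (if t \<le> x then f x * g t else 0) + (if x \<le> t then f x * g t else 0))"
      using j1 by simp
    also have "\<dots> = (LINT t|M. f x * g t)"
    proof (rule integral_cong_AE)
      show "AE t in M. (if t \<le> x then f x * g t else 0) + (if x \<le> t then f x * g t else 0) = f x * g t"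
        using ae[of x] by (rule eventually_mono) auto
    qed auto
    finally show "(LINT t|M. (if t \<le> x then f x * g t else 0)) + (LINT t|M. (if x \<le> t then f x * g t else 0)) = f x * (LINT t|M. g t)"
      by simp
  qed
  also have "\<dots> = integral {0..r} f * integral {0..r} g"
    using conv[OF f] conv[OF g] by simp
  finally show ?thesis using e1' e2' by simp
qed

text \<open>With \<open>F\<close> and \<open>G\<close> written as initial value plus integral, the
  product of the two integrals is \<open>Fubini_triangle\<close> and the other terms are
  linear.\<close>

lemma AC_mult:
  assumes F: "AC F f" and G: "AC G g"
  shows "AC (\<lambda>x. F x * G x) (\<lambda>x. f x * G x + F x * g x)"
proof (rule AC_I)
  fix r :: real assume r: "r \<ge> 0"
  have f: "f absolutely_integrable_on {0..r}" and g: "g absolutely_integrable_on {0..r}"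
    using AC_absolutely_integrable F G by auto
  have cF: "continuous_on {0..r} F" and cG: "continuous_on {0..r} G"
    by (auto intro!: continuous_on_subset[OF AC_continuous[OF F]] continuous_on_subset[OF AC_continuous[OF G]])
  have a1: "(\<lambda>x. f x * G x) absolutely_integrable_on {0..r}"
    using absolutely_integrable_continuous_mult[OF f cG] by (simp add: mult.commute)
  have a2: "(\<lambda>x. F x * g x) absolutely_integrable_on {0..r}"
    using absolutely_integrable_continuous_mult[OF g cF] by simp
  show "(\<lambda>x. f x * G x + F x * g x) absolutely_integrable_on {0..r}"
    using a1 a2 by (rule set_integral_add)
  have cf: "continuous_on {0..r} (\<lambda>x. integral {0..x} f)" and cg: "continuous_on {0..r} (\<lambda>x. integral {0..x} g)"
    using f g by (auto intro!: indefinite_integral_continuous_1 simp: absolutely_integrable_on_def)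
  have b1: "(\<lambda>x. f x * integral {0..x} g) integrable_on {0..r}"
    using absolutely_integrable_continuous_mult[OF f cg] by (simp add: mult.commute absolutely_integrable_on_def)
  have b2: "(\<lambda>x. g x * integral {0..x} f) integrable_on {0..r}"
    using absolutely_integrable_continuous_mult[OF g cf] by (simp add: mult.commute absolutely_integrable_on_def)
  have b3: "f integrable_on {0..r}" "g integrable_on {0..r}" using f g by (auto simp: absolutely_integrable_on_def)
  have "integral {0..r} (\<lambda>x. f x * G x + F x * g x) = integral {0..r} (\<lambda>x.
     (f x * integral {0..x} g + g x * integral {0..x} f) + (f x * G 0 + F 0 * g x))"
  proof (rule integral_cong)
    fix x assume "x \<in> {0..r}"
    then have "x \<ge> 0" by simp
    then show "f x * G x + F x * g x = (f x * integral {0..x} g + g x * integral {0..x} f) + (f x * G 0 + F 0 * g x)"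
      unfolding AC_eq[OF F \<open>x \<ge> 0\<close>] AC_eq[OF G \<open>x \<ge> 0\<close>] by (simp add: algebra_simps)
  qed
  also have "\<dots> = integral {0..r} (\<lambda>x. f x * integral {0..x} g + g x * integral {0..x} f)
     + integral {0..r} (\<lambda>x. f x * G 0 + F 0 * g x)"
    using b1 b2 b3
    by (intro Henstock_Kurzweil_Integration.integral_add integrable_add integrable_on_mult_right integrable_on_mult_left)
  also have "integral {0..r} (\<lambda>x. f x * integral {0..x} g + g x * integral {0..x} f) = integral {0..r} f * integral {0..r} g"
    using b1 b2 Fubini_triangle[OF f g] by (subst Henstock_Kurzweil_Integration.integral_add) auto
  also have "integral {0..r} (\<lambda>x. f x * G 0 + F 0 * g x) = integral {0..r} f * G 0 + F 0 * integral {0..r} g"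
    using b3 by (subst Henstock_Kurzweil_Integration.integral_add)
      (simp_all add: integrable_on_mult_right integrable_on_mult_left)
  finally have E: "integral {0..r} (\<lambda>x. f x * G x + F x * g x) = integral {0..r} f * integral {0..r} g
    + (integral {0..r} f * G 0 + F 0 * integral {0..r} g)" .
  have "F r = F 0 + integral {0..r} f" "G r = G 0 + integral {0..r} g"
    using AC_eq[OF F r] AC_eq[OF G r] by auto
  then show "F r * G r = F 0 * G 0 + integral {0..r} (\<lambda>x. f x * G x + F x * g x)"
    unfolding E by (simp only: ring_distribs ac_simps)
qed

section \<open>The space of square-integrable functions\<close>

text \<open>A real-valued form of \<open>L2_norm\<close>, so that ordered field arithmetic applies.
  Outside \<open>L2\<close> it is no norm: the integral of a non-integrable function is 0 by
  convention.\<close>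

definition nrm :: "(real \<Rightarrow> complex) \<Rightarrow> real" where
  "nrm f = sqrt (LINT r|halfline. (cmod (f r))\<^sup>2)"

lemma L2_measurable: "f \<in> L2 \<Longrightarrow> f \<in> borel_measurable halfline"
  and L2_integrable: "f \<in> L2 \<Longrightarrow> integrable halfline (\<lambda>r. (cmod (f r))\<^sup>2)"
  by (auto simp: L2_def)

lemma nrm_nonneg [simp]: "nrm f \<ge> 0"
  by (simp add: nrm_def)

lemma nrm_sq: "(nrm f)\<^sup>2 = (LINT r|halfline. (cmod (f r))\<^sup>2)"
  by (simp add: nrm_def)

lemma L2_I_bound:
  assumes "f \<in> borel_measurable halfline" "integrable halfline g" "\<And>r. r > 0 \<Longrightarrow> (cmod (f r))\<^sup>2 \<le> g r"
  shows "f \<in> L2"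
  unfolding L2_def mem_Collect_eq
proof (intro conjI)
  show "integrable halfline (\<lambda>r. (cmod (f r))\<^sup>2)"
  proof (rule Bochner_Integration.integrable_bound[OF assms(2)])
    have "AE r in halfline. r > 0" by (rule AE_I2) simp
    then show "AE r in halfline. norm ((cmod (f r))\<^sup>2) \<le> norm (g r)"
      by (rule eventually_mono) (use assms(3) in force)
  qed (use assms(1) in measurable)
qed fact

lemma sq_add_le: "(cmod (a + b))\<^sup>2 \<le> 2 * (cmod a)\<^sup>2 + 2 * (cmod b)\<^sup>2"
proof -
  have "(cmod (a + b))\<^sup>2 \<le> (cmod a + cmod b)\<^sup>2"
    by (intro power_mono norm_triangle_ineq) auto
  also have "\<dots> \<le> 2 * (cmod a)\<^sup>2 + 2 * (cmod b)\<^sup>2"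
    using sum_squares_bound[of "cmod a" "cmod b"] by (simp add: power2_sum)
  finally show ?thesis .
qed

lemma L2_add: assumes "f \<in> L2" "g \<in> L2" shows "(\<lambda>r. f r + g r) \<in> L2"
  by (rule L2_I_bound[of _ "\<lambda>r. 2 * (cmod (f r))\<^sup>2 + 2 * (cmod (g r))\<^sup>2"])
    (use L2_measurable[OF assms(1)] L2_measurable[OF assms(2)] L2_integrable[OF assms(1)] L2_integrable[OF assms(2)]
      in \<open>auto simp: sq_add_le\<close>)

lemma L2_bounded_mult:
  assumes "f \<in> L2" "c \<in> borel_measurable halfline" "\<And>r. r > 0 \<Longrightarrow> cmod (c r) \<le> B"
  shows "(\<lambda>r. c r * f r) \<in> L2"
proof (rule L2_I_bound[of _ "\<lambda>r. B\<^sup>2 * (cmod (f r))\<^sup>2"])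
  show "(\<lambda>r. c r * f r) \<in> borel_measurable halfline"
    using assms(2) L2_measurable[OF assms(1)] by measurable
  show "integrable halfline (\<lambda>r. B\<^sup>2 * (cmod (f r))\<^sup>2)" using L2_integrable[OF assms(1)] by simp
  fix r :: real assume "r > 0"
  then have "(cmod (c r))\<^sup>2 \<le> B\<^sup>2" using assms(3) by (intro power_mono) auto
  then show "(cmod (c r * f r))\<^sup>2 \<le> B\<^sup>2 * (cmod (f r))\<^sup>2"
    by (simp add: norm_mult power_mult_distrib mult_right_mono)
qed

lemma L2_cmult: "f \<in> L2 \<Longrightarrow> (\<lambda>r. c * f r) \<in> L2"
  by (rule L2_bounded_mult[of _ _ "cmod c"]) auto

lemma L2_diff: "f \<in> L2 \<Longrightarrow> g \<in> L2 \<Longrightarrow> (\<lambda>r. f r - g r) \<in> L2"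
  using L2_add[of f "\<lambda>r. (-1) * g r"] L2_cmult[of g "-1"] by simp

lemma L2_cnj: "f \<in> L2 \<Longrightarrow> (\<lambda>r. cnj (f r)) \<in> L2"
proof -
  assume f: "f \<in> L2"
  have "cnj \<in> borel_measurable borel" by (intro borel_measurable_continuous_onI continuous_intros)
  then show ?thesis using f measurable_compose[OF L2_measurable[OF f], of cnj]
    by (auto simp: L2_def)
qed

lemma L2_zero [simp]: "(\<lambda>r. 0) \<in> L2"
  by (simp add: L2_def)

text \<open>Lebesgue measure is complete, which is used after extension by 0 to the whole line. The
  resolvent is determined up to null sets only, so measurability has to survive such
  changes.\<close>

lemma halfline_measurable_AE:
  fixes f g :: "real \<Rightarrow> 'a::euclidean_space"
  assumes "f \<in> borel_measurable halfline" "AE r in halfline. g r = f r"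
  shows "g \<in> borel_measurable halfline"
proof -
  have "(\<lambda>r. if r \<in> {0<..} then f r else 0) \<in> borel_measurable lebesgue"
    using assms(1) by (subst borel_measurable_if) auto
  moreover have "AE r in lebesgue. (if r \<in> {0<..} then f r else 0) = (if r \<in> {0<..} then g r else 0)"
    using assms(2) by (subst (asm) AE_restrict_space_iff) (auto elim!: eventually_mono)
  ultimately have "(\<lambda>r. if r \<in> {0<..} then g r else 0) \<in> borel_measurable lebesgue"
    by (rule borel_measurable_AE)
  then show ?thesis by (subst (asm) borel_measurable_if) auto
qed

lemma L2_AE_cong:
  assumes "f \<in> L2" "AE r in halfline. g r = f r"
  shows "g \<in> L2" "nrm g = nrm f"
proof -
  have g: "g \<in> borel_measurable halfline"
    by (rule halfline_measurable_AE[OF L2_measurable[OF assms(1)] assms(2)])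
  show "g \<in> L2" unfolding L2_def mem_Collect_eq
  proof (intro conjI g)
    show "integrable halfline (\<lambda>r. (cmod (g r))\<^sup>2)"
      by (rule integrable_cong_AE_imp[OF L2_integrable[OF assms(1)]])
        (use g assms(2) in \<open>auto elim!: eventually_mono\<close>)
  qed
  show "nrm g = nrm f" unfolding nrm_def
    by (intro arg_cong[of _ _ sqrt] integral_cong_AE) (use g L2_measurable[OF assms(1)] assms(2) in \<open>auto elim!: eventually_mono\<close>)
qed

lemma L2_prod_integrable:
  assumes "f \<in> L2" "g \<in> L2"
  shows "integrable halfline (\<lambda>r. f r * g r)" "integrable halfline (\<lambda>r. cmod (f r) * cmod (g r))"
proof -
  have *: "cmod a * cmod b \<le> (cmod a)\<^sup>2 + (cmod b)\<^sup>2" for a b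
  proof -
    have "0 \<le> cmod a * cmod b" by simp
    with sum_squares_bound[of "cmod a" "cmod b"] show ?thesis by linarith
  qed
  have [measurable]: "f \<in> borel_measurable halfline" "g \<in> borel_measurable halfline"
    using assms L2_measurable by auto
  have i: "integrable halfline (\<lambda>r. (cmod (f r))\<^sup>2 + (cmod (g r))\<^sup>2)"
    using assms L2_integrable by auto
  show "integrable halfline (\<lambda>r. f r * g r)" "integrable halfline (\<lambda>r. cmod (f r) * cmod (g r))"
    by (rule Bochner_Integration.integrable_bound[OF i]; force simp: norm_mult *)+
qed

text \<open>Integrating 2ab \<le> a^2 + b^2 with the first factor scaled by \<open>t\<close> gives
  an inequality quadratic in \<open>t\<close>; the cases differ in the best choice of
  \<open>t\<close>.\<close>

lemma Cauchy_Schwarz_L2: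
  assumes "f \<in> L2" "g \<in> L2"
  shows "(LINT r|halfline. cmod (f r) * cmod (g r)) \<le> nrm f * nrm g"
proof -
  define I where "I = (LINT r|halfline. cmod (f r) * cmod (g r))"
  have q: "2 * t * I \<le> t\<^sup>2 * (nrm f)\<^sup>2 + (nrm g)\<^sup>2" for t
  proof -
    have "2 * t * I = (LINT r|halfline. 2 * t * (cmod (f r) * cmod (g r)))"
      unfolding I_def by simp
    also have "\<dots> \<le> (LINT r|halfline. t\<^sup>2 * (cmod (f r))\<^sup>2 + (cmod (g r))\<^sup>2)"
    proof (rule integral_mono)
      show "2 * t * (cmod (f r) * cmod (g r)) \<le> t\<^sup>2 * (cmod (f r))\<^sup>2 + (cmod (g r))\<^sup>2" for r
        using sum_squares_bound[of "t * cmod (f r)" "cmod (g r)"] by (simp add: power_mult_distrib mult.assoc)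
    qed (use L2_prod_integrable[OF assms] assms L2_integrable in auto)
    also have "\<dots> = t\<^sup>2 * (nrm f)\<^sup>2 + (nrm g)\<^sup>2"
      unfolding nrm_sq using assms L2_integrable by simp
    finally show ?thesis .
  qed
  have I0: "I \<ge> 0" unfolding I_def by (intro integral_nonneg_AE) auto
  have "I \<le> nrm f * nrm g"
  proof (cases "nrm f = 0")
    case True
    have "2 * t * I \<le> (nrm g)\<^sup>2" for t using q[of t] True by simp
    \<comment> \<open>If \<open>I\<close> were nonzero, this \<open>t\<close> would make the left
      side exceed the right one by 1.\<close>
    from this[of "((nrm g)\<^sup>2 + 1) / (2 * I)"] have "I \<noteq> 0 \<Longrightarrow> (nrm g)\<^sup>2 + 1 \<le> (nrm g)\<^sup>2" by simp
    then show ?thesis using True by auto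
  next
    case False
    then have f0: "nrm f > 0" using nrm_nonneg[of f] by linarith
    have "2 * (nrm g / nrm f) * I \<le> 2 * (nrm g)\<^sup>2"
      using q[of "nrm g / nrm f"] f0 by (simp add: power_divide)
    then have "nrm g * I \<le> nrm g * (nrm f * nrm g)" using f0 by (simp add: field_simps power2_eq_square)
    then have "nrm g > 0 \<Longrightarrow> ?thesis" by simp
    moreover have ?thesis if "nrm g = 0"
    proof -
      have "2 * t * I \<le> t\<^sup>2 * (nrm f)\<^sup>2" for t using q[of t] that by simp
      from this[of "I / (nrm f)\<^sup>2"] have "2 * I\<^sup>2 \<le> I\<^sup>2" using f0 by (simp add: field_simps power2_eq_square)
      then show ?thesis using that by simp
    qed
    ultimately show ?thesis using nrm_nonneg[of g] by linarith
  qed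
  then show ?thesis unfolding I_def .
qed

lemma Cauchy_Schwarz_L2_norm:
  assumes "f \<in> L2" "g \<in> L2"
  shows "cmod (LINT r|halfline. f r * g r) \<le> nrm f * nrm g"
  using integral_norm_bound[of halfline "\<lambda>r. f r * g r"] Cauchy_Schwarz_L2[OF assms]
  by (simp add: norm_mult)

lemma nrm_triangle:
  assumes "f \<in> L2" "g \<in> L2"
  shows "nrm (\<lambda>r. f r + g r) \<le> nrm f + nrm g"
proof (rule power2_le_imp_le)
  have "(nrm (\<lambda>r. f r + g r))\<^sup>2 \<le> (LINT r|halfline. (cmod (f r))\<^sup>2 + 2 * (cmod (f r) * cmod (g r)) + (cmod (g r))\<^sup>2)"
    unfolding nrm_sq
  proof (rule integral_mono)
    show "(cmod (f r + g r))\<^sup>2 \<le> (cmod (f r))\<^sup>2 + 2 * (cmod (f r) * cmod (g r)) + (cmod (g r))\<^sup>2" for r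
      using power_mono[OF norm_triangle_ineq[of "f r" "g r"], of 2] by (simp add: power2_sum)
  qed (use L2_prod_integrable[OF assms] assms L2_integrable L2_add[OF assms] in auto)
  also have "\<dots> = (nrm f)\<^sup>2 + 2 * (LINT r|halfline. cmod (f r) * cmod (g r)) + (nrm g)\<^sup>2"
    unfolding nrm_sq using L2_prod_integrable[OF assms] assms L2_integrable by simp
  also have "\<dots> \<le> (nrm f + nrm g)\<^sup>2"
    using Cauchy_Schwarz_L2[OF assms] by (simp add: power2_sum)
  finally show "(nrm (\<lambda>r. f r + g r))\<^sup>2 \<le> (nrm f + nrm g)\<^sup>2" .
qed auto

lemma nrm_mono:
  assumes "f \<in> L2" "g \<in> L2" "\<And>r. r > 0 \<Longrightarrow> cmod (f r) \<le> cmod (g r)"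
  shows "nrm f \<le> nrm g"
  unfolding nrm_def
  by (intro real_sqrt_le_mono integral_mono_AE)
    (use assms L2_integrable in \<open>auto intro!: AE_I2 power_mono\<close>)

lemma nrm_bounded_mult:
  assumes "f \<in> L2" "c \<in> borel_measurable halfline" "\<And>r. r > 0 \<Longrightarrow> cmod (c r) \<le> B" "B \<ge> 0"
  shows "nrm (\<lambda>r. c r * f r) \<le> B * nrm f"
proof -
  have "nrm (\<lambda>r. c r * f r) \<le> nrm (\<lambda>r. of_real B * f r)"
    by (rule nrm_mono) (use assms in \<open>auto intro!: L2_bounded_mult L2_cmult mult_right_mono simp: norm_mult\<close>)
  also have "\<dots> = B * nrm f"
    using assms(4) by (simp add: nrm_def norm_mult power_mult_distrib real_sqrt_mult)
  finally show ?thesis .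
qed

lemma nrm_cmult: "nrm (\<lambda>r. c * f r) = cmod c * nrm f"
  by (simp add: nrm_def norm_mult power_mult_distrib real_sqrt_mult)

lemma nrm_cnj [simp]: "nrm (\<lambda>r. cnj (f r)) = nrm f"
  by (simp add: nrm_def)

section \<open>Integrals over the half line and over bounded intervals\<close>

lemma halfline_ident_measurable [measurable]: "(\<lambda>x. x) \<in> borel_measurable halfline"
  using id_borel_measurable_lebesgue_on[of "{0<..}"] unfolding id_def .

lemma halfline_integrable_imp_abs:
  fixes f :: "real \<Rightarrow> 'a::euclidean_space"
  assumes "integrable halfline f"
  shows "f absolutely_integrable_on {0..R}"
proof -
  have "f absolutely_integrable_on {0<..}"
    using assms by (simp add: integrable_restrict_space set_integrable_def)
  then have "f absolutely_integrable_on {0<..R}"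
    by (rule set_integrable_subset) auto
  then show ?thesis
    by (rule absolutely_integrable_spike_set)
      (rule negligible_subset[of "{0}"]; auto)+
qed

lemma halfline_integral_Icc:
  fixes f :: "real \<Rightarrow> 'a::euclidean_space"
  assumes "integrable halfline f"
  shows "integral {0..R} f = (LINT r|halfline. indicator {..R} r *\<^sub>R f r)"
    "integrable halfline (\<lambda>r. indicator {..R} r *\<^sub>R f r)"
proof -
  have [measurable]: "(\<lambda>r. indicat_real {..R} r) \<in> borel_measurable halfline"
    using measurable_compose[OF halfline_ident_measurable borel_measurable_indicator[of "{..R}"]] by simp
  have [measurable]: "f \<in> borel_measurable halfline" using assms by simp
  have m: "(\<lambda>r. indicat_real {..R} r *\<^sub>R f r) \<in> borel_measurable halfline" by measurable
  show i: "integrable halfline (\<lambda>r. indicator {..R} r *\<^sub>R f r)"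
    by (rule Bochner_Integration.integrable_bound[OF assms m]) (auto simp: indicator_def)
  have "(LINT r|halfline. indicator {..R} r *\<^sub>R f r) = integral {0<..} (\<lambda>r. indicator {..R} r *\<^sub>R f r)"
    by (rule lebesgue_integral_eq_integral[OF i]) auto
  also have "\<dots> = integral {0<..} (\<lambda>r. if r \<in> {..R} then f r else 0)"
    by (rule Henstock_Kurzweil_Integration.integral_cong) (auto simp: indicator_def)
  also have "\<dots> = integral ({..R} \<inter> {0<..}) f" by (rule integral_restrict_Int)
  also have "\<dots> = integral {0..R} f"
    by (rule integral_spike_set) (rule negligible_subset[of "{0}"]; auto)+
  finally show "integral {0..R} f = (LINT r|halfline. indicator {..R} r *\<^sub>R f r)" by simp
qed

lemma halfline_integral_tendsto:
  fixes f :: "real \<Rightarrow> 'a::euclidean_space"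
  assumes "integrable halfline f"
  shows "((\<lambda>R. integral {0..R} f) \<longlongrightarrow> (LINT r|halfline. f r)) at_top"
proof -
  have [measurable]: "f \<in> borel_measurable halfline" using assms by simp
  have "((\<lambda>R. LINT r|halfline. indicator {..R} r *\<^sub>R f r) \<longlongrightarrow> (LINT r|halfline. f r)) at_top"
  proof (rule integral_dominated_convergence_at_top[of _ _ _ "\<lambda>r. norm (f r)"])
    show "AE x in halfline. ((\<lambda>i. indicat_real {..i} x *\<^sub>R f x) \<longlongrightarrow> f x) at_top"
    proof (rule AE_I2, rule tendsto_eventually)
      fix x :: real
      show "\<forall>\<^sub>F i in at_top. indicat_real {..i} x *\<^sub>R f x = f x"
        using eventually_ge_at_top[of x] by (rule eventually_mono) auto
    qed
    show "(\<lambda>x. indicat_real {..i} x *\<^sub>R f x) \<in> borel_measurable halfline" for i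
      using halfline_integral_Icc(2)[OF assms, of i] by simp
  qed (use assms in \<open>auto simp: indicator_def intro!: always_eventually\<close>)
  then show ?thesis by (simp add: halfline_integral_Icc[OF assms])
qed

lemma halfline_integral_Icc_le:
  fixes f :: "real \<Rightarrow> real"
  assumes "integrable halfline f" "\<And>r. r > 0 \<Longrightarrow> f r \<ge> 0"
  shows "integral {0..R} f \<le> (LINT r|halfline. f r)"
  unfolding halfline_integral_Icc(1)[OF assms(1)]
  by (rule integral_mono_AE) (use assms halfline_integral_Icc(2)[OF assms(1)] in \<open>auto intro!: AE_I2 simp: indicator_def\<close>)

lemma not_integrable_halfline_const:
  assumes "c > 0" shows "\<not> integrable halfline (\<lambda>r. if r > N then c else (0::real))"
proof
  assume i: "integrable halfline (\<lambda>r. if r > N then c else (0::real))"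
  define I where "I = (LINT r|halfline. (if r > N then c else 0))"
  define N' where "N' = max N 0"
  have "c * d \<le> I" if d: "d > 0" for d
  proof -
    have "integral {0..N'+d} (\<lambda>r. if r > N then c else 0) \<ge> integral {N'..N'+d} (\<lambda>r. if r > N then c else 0)"
      using halfline_integrable_imp_abs[OF i, of "N'+d"] \<open>c > 0\<close>
      by (intro integral_subset_le) (auto simp: N'_def absolutely_integrable_on_def intro: integrable_on_subinterval)
    moreover have "integral {N'..N'+d} (\<lambda>r. if r > N then c else 0) = integral {N'..N'+d} (\<lambda>r. c)"
      by (rule integral_spike[of "{N'}"]) (auto simp: N'_def)
    moreover have "integral {0..N'+d} (\<lambda>r. if r > N then c else 0) \<le> I"
      unfolding I_def by (rule halfline_integral_Icc_le[OF i]) (use \<open>c > 0\<close> in auto)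
    ultimately show ?thesis using d by (simp add: mult.commute)
  qed
  from this[of "(\<bar>I\<bar> + 1) / c"] show False using \<open>c > 0\<close> by auto
qed

text \<open>If \<open>G\<close> stayed above \<epsilon> beyond \<open>N\<close>, it would dominate a
  function of infinite integral.\<close>

lemma integrable_small_value:
  assumes "integrable halfline G" "\<epsilon> > 0"
  shows "\<exists>R>N. G R < (\<epsilon>::real)"
proof (rule ccontr)
  assume "\<not> ?thesis"
  then have *: "\<And>R. R > N \<Longrightarrow> G R \<ge> \<epsilon>" by force
  have "integrable halfline (\<lambda>r. if r > N then \<epsilon> else 0)"
  proof (rule Bochner_Integration.integrable_bound[OF assms(1)])
    show "AE r in halfline. norm (if r > N then \<epsilon> else 0) \<le> norm (G r)"
      by (rule AE_I2) (use * \<open>\<epsilon> > 0\<close> in \<open>auto intro: order_trans[OF _ abs_ge_self]\<close>)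
    show "(\<lambda>r. if N < r then \<epsilon> else 0) \<in> borel_measurable halfline" by measurable
  qed
  then show False using not_integrable_halfline_const[OF \<open>\<epsilon> > 0\<close>] by blast
qed

text \<open>Boundary terms at \<open>R\<close> need not tend to 0: being dominated by an integrable
  function, they are small for some arbitrarily large \<open>R\<close>, while the truncated
  integrals on the left converge. This spares every pointwise decay estimate for \<open>u\<close>
  and \<open>p\<close> at infinity.\<close>

lemma halfline_integral_le:
  assumes H: "integrable halfline H" and G: "integrable halfline G" and C: "C \<ge> (0::real)"
    and *: "\<And>R. R > 0 \<Longrightarrow> integral {0..R} H \<le> A + C * G R"
  shows "(LINT r|halfline. H r) \<le> (A::real)"
proof (rule field_le_epsilon)
  fix e :: real assume e: "e > 0"
  have "\<forall>\<^sub>F R in at_top. integral {0..R} H > (LINT r|halfline. H r) - e/2"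
    by (rule order_tendstoD(1)[OF halfline_integral_tendsto[OF H]]) (use e in auto)
  then obtain N where N: "\<And>R. R \<ge> N \<Longrightarrow> integral {0..R} H > (LINT r|halfline. H r) - e/2"
    unfolding eventually_at_top_linorder by auto
  obtain R where R: "R > max N 0" "G R < e / (2 * (C + 1))"
    using integrable_small_value[OF G, of "e / (2 * (C + 1))" "max N 0"] e C by auto
  have "C * G R \<le> C * (e / (2 * (C + 1)))" using R C by (intro mult_left_mono) auto
  also have "\<dots> \<le> e/2" using C e by (simp add: field_simps)
  finally show "(LINT r|halfline. H r) \<le> A + e" using N[of R] *[of R] R by linarith
qed

lemma continuous_halfline_measurable:
  fixes g :: "real \<Rightarrow> 'a::euclidean_space"
  assumes "continuous_on {0..} g" shows "g \<in> borel_measurable halfline"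
  by (rule continuous_imp_measurable_on_sets_lebesgue) (auto intro: continuous_on_subset[OF assms])

text \<open>Monotone convergence along the truncations to (0,n]: bounds uniform in \<open>R\<close>
  produce integrability itself, which is how continuous solutions are shown to lie in
  \<open>L2\<close>.\<close>

lemma halfline_integrable_bounded:
  fixes g :: "real \<Rightarrow> real"
  assumes "continuous_on {0..} g" "\<And>r. r \<ge> 0 \<Longrightarrow> g r \<ge> 0" "\<And>R. R > 0 \<Longrightarrow> integral {0..R} g \<le> C"
  shows "integrable halfline g" "(LINT r|halfline. g r) \<le> C"
proof -
  have meas: "g \<in> borel_measurable halfline" by (rule continuous_halfline_measurable[OF assms(1)])
  have c: "continuous_on {0..real n} g" for n by (rule continuous_on_subset[OF assms(1)]) auto
  have int: "(\<lambda>r. if r \<in> {0<..real n} then g r else 0) absolutely_integrable_on {0<..}" for n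
  proof -
    have "g absolutely_integrable_on {0<..real n}"
      using absolutely_integrable_continuous_real[OF c, of n] by (rule set_integrable_subset) auto
    then have "(\<lambda>r. if r \<in> {0<..real n} then g r else 0) absolutely_integrable_on UNIV"
      unfolding absolutely_integrable_restrict_UNIV .
    then show ?thesis by (rule set_integrable_subset) auto
  qed
  let ?f = "\<lambda>n::nat. \<lambda>r. if r \<in> {0<..real n} then g r else 0"
  have int': "integrable halfline (?f n)" for n
    using int[of n] by (rule absolutely_integrable_imp_integrable) auto
  have val: "(LINT r|halfline. ?f n r) = integral {0..real n} g" for n
  proof -
    have "(LINT r|halfline. ?f n r) = integral {0<..} (?f n)"
      by (rule lebesgue_integral_eq_integral[OF int']) auto
    also have "\<dots> = integral ({0<..real n} \<inter> {0<..}) g" by (rule integral_restrict_Int)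
    also have "\<dots> = integral {0..real n} g"
      by (rule integral_spike_set) (rule negligible_subset[of "{0}"]; auto)+
    finally show ?thesis .
  qed
  have "integral {0..1} g \<ge> 0"
    by (rule integral_nonneg) (use c[of 1] assms(2) in \<open>auto intro: integrable_continuous_real\<close>)
  then have C0: "C \<ge> 0" using assms(3)[of 1] by simp
  have le: "(LINT r|halfline. ?f n r) \<le> C" for n
    unfolding val using assms(3)[of "real n"] C0 by (cases "n = 0") auto
  have mono: "incseq (\<lambda>n. LINT r|halfline. ?f n r)"
    by (intro incseq_SucI integral_mono_AE int' AE_I2) (use assms(2) in auto)
  obtain L where L: "(\<lambda>n. LINT r|halfline. ?f n r) \<longlonglongrightarrow> L" "L \<le> C"
  proof -
    obtain L where L: "(\<lambda>n. LINT r|halfline. ?f n r) \<longlonglongrightarrow> L"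
      using incseq_convergent[OF mono, of C] le by blast
    moreover have "L \<le> C" by (rule LIMSEQ_le_const2[OF L]) (use le in blast)
    ultimately show ?thesis by (rule that)
  qed
  have a1: "AE x in halfline. mono (\<lambda>n. ?f n x)"
    by (rule AE_I2) (use assms(2) in \<open>auto simp: mono_def\<close>)
  have a2: "AE x in halfline. (\<lambda>n. ?f n x) \<longlonglongrightarrow> g x"
  proof (rule AE_I2, rule tendsto_eventually)
    fix x :: real assume "x \<in> space halfline"
    then have "x > 0" by simp
    have "\<forall>\<^sub>F n in sequentially. real n \<ge> x"
      using filterlim_real_sequentially unfolding filterlim_at_top by blast
    then show "\<forall>\<^sub>F n in sequentially. ?f n x = g x"
      by (rule eventually_mono) (use \<open>x > 0\<close> in auto)
  qed
  show "integrable halfline g"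
    by (rule integrable_monotone_convergence[OF int' a1 a2 L(1) meas])
  show "(LINT r|halfline. g r) \<le> C"
    using integral_monotone_convergence[OF int' a1 a2 L(1) meas] L(2) by simp
qed

lemma L2_I_continuous:
  assumes "continuous_on {0..} g" "\<And>R. R > 0 \<Longrightarrow> integral {0..R} (\<lambda>r. (cmod (g r))\<^sup>2) \<le> C"
  shows "g \<in> L2" "(nrm g)\<^sup>2 \<le> C"
proof -
  have *: "continuous_on {0..} (\<lambda>r. (cmod (g r))\<^sup>2)" by (intro continuous_intros assms)
  show "g \<in> L2" "(nrm g)\<^sup>2 \<le> C"
    using halfline_integrable_bounded[OF * _ assms(2)] continuous_halfline_measurable[OF assms(1)]
    unfolding L2_def nrm_sq by auto
qed

text \<open>On a bounded interval |f| \<le> 1 + |f|^2 has an integrable right side, so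
  square-integrable functions can be integrated from the boundary point 0.\<close>

lemma L2_absolutely_integrable:
  assumes "f \<in> L2" shows "f absolutely_integrable_on {0..R}"
proof -
  have m: "f \<in> borel_measurable (lebesgue_on {0<..R})"
    by (rule measurable_restrict_mono[OF L2_measurable[OF assms]]) auto
  have "f absolutely_integrable_on {0<..R}"
  proof (rule measurable_bounded_by_integrable_imp_absolutely_integrable[OF m])
    have "(\<lambda>r. (cmod (f r))\<^sup>2) integrable_on {0..R}"
      using halfline_integrable_imp_abs[OF L2_integrable[OF assms]] by (simp add: absolutely_integrable_on_def)
    then have "(\<lambda>r. 1 + (cmod (f r))\<^sup>2) integrable_on {0..R}" by (intro integrable_add) auto
    then show "(\<lambda>r. 1 + (cmod (f r))\<^sup>2) integrable_on {0<..R}"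
      by (rule integrable_spike_set) (rule negligible_subset[of "{0}"]; auto)+
    show "norm (f x) \<le> 1 + (cmod (f x))\<^sup>2" for x
      using sum_squares_bound[of 1 "cmod (f x)"] zero_le_power2[of "cmod (f x)"]
      unfolding power_one mult_1_right by linarith
  qed auto
  then show ?thesis
    by (rule absolutely_integrable_spike_set) (rule negligible_subset[of "{0}"]; auto)+
qed

section \<open>Solutions of the resolvent equation\<close>

text \<open>\<open>u\<close> is the continuous representative of a solution of \<open>-u'' + (q - z) u = f\<close>, \<open>u(0) = 0\<close>, and \<open>p = u'\<close>.\<close>

definition solves ::
    "(real \<Rightarrow> real) \<Rightarrow> complex \<Rightarrow> (real \<Rightarrow> complex) \<Rightarrow> (real \<Rightarrow> complex) \<Rightarrow> (real \<Rightarrow> complex) \<Rightarrow> bool" where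
  "solves q z f u p \<longleftrightarrow> u \<in> L2 \<and> p \<in> L2 \<and> u 0 = 0 \<and> AC u p \<and>
     AC p (\<lambda>r. (of_real (q r) - z) * u r - f r)"

lemma solvesD:
  assumes "solves q z f u p"
  shows "u \<in> L2" "p \<in> L2" "u 0 = 0" "AC u p" "AC p (\<lambda>r. (of_real (q r) - z) * u r - f r)"
  using assms by (auto simp: solves_def)

text \<open>Real part of the form identity \<open>\<integral>|p|\<^sup>2 + (q - k\<^sup>2)|u|\<^sup>2 = \<integral>f cnj u\<close> multiplied by \<open>\<i> cnj k\<close>;
  this rotation makes every term on the left nonnegative.\<close>

lemma resolvent_identity:
  assumes s: "solves q (k\<^sup>2) f u p" and f: "f \<in> L2" and q: "\<And>r. r \<ge> 0 \<Longrightarrow> q r \<ge> 0" and k: "Im k > 0"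
  shows "Im k * (LINT r|halfline. (cmod (p r))\<^sup>2 + (cmod k)\<^sup>2 * (cmod (u r))\<^sup>2)
    \<le> cmod k * (LINT r|halfline. cmod (f r) * cmod (u r))"
proof -
  note sD = solvesD[OF s]
  define H where "H = (\<lambda>r. Im k * ((cmod (p r))\<^sup>2 + (cmod k)\<^sup>2 * (cmod (u r))\<^sup>2) - cmod k * (cmod (f r) * cmod (u r)))"
  have i1: "integrable halfline (\<lambda>r. (cmod (p r))\<^sup>2 + (cmod k)\<^sup>2 * (cmod (u r))\<^sup>2)"
    using sD L2_integrable by auto
  have i2: "integrable halfline (\<lambda>r. cmod (f r) * cmod (u r))"
    using L2_prod_integrable[OF f sD(1)] by auto
  have iH: "integrable halfline H" unfolding H_def using i1 i2 by auto
  have "(LINT r|halfline. H r) \<le> 0"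
  proof (rule halfline_integral_le[OF iH, of "\<lambda>r. (cmod (p r))\<^sup>2 + (cmod (u r))\<^sup>2" "cmod k"])
    show "integrable halfline (\<lambda>r. (cmod (p r))\<^sup>2 + (cmod (u r))\<^sup>2)" using sD L2_integrable by auto
    fix R :: real assume R: "R > 0"
    \<comment> \<open>Derivative of \<open>p r * cnj (u r)\<close>, by the equation for
      \<open>p\<close>; at 0 this product vanishes by the Dirichlet condition.\<close>
    define G where "G = (\<lambda>r. ((of_real (q r) - k\<^sup>2) * u r - f r) * cnj (u r) + p r * cnj (p r))"
    have "AC (\<lambda>r. p r * cnj (u r)) G"
      unfolding G_def by (rule AC_mult[OF sD(5) AC_cnj[OF sD(4)]])
    then have "(G has_integral (p R * cnj (u R))) {0..R}"
      using AC_has_integral[of _ G R] R sD(3) by fastforce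
    from has_integral_linear[OF this bounded_linear_compose[OF bounded_linear_Re bounded_linear_mult_right[of "\<i> * cnj k"]]]
    have G: "((\<lambda>r. Re (\<i> * cnj k * G r)) has_integral Re (\<i> * cnj k * (p R * cnj (u R)))) {0..R}"
      by (simp add: o_def)
    have le: "H r \<le> Re (\<i> * cnj k * G r)" if "r \<ge> 0" for r
    proof -
      \<comment> \<open>The number \<open>\<i> * cnj k\<close> has real part Im k, and its product
        with -k^2 has real part |k|^2 Im k.\<close>
      have "Re (\<i> * cnj k * G r) = Im k * ((cmod (p r))\<^sup>2 + (cmod k)\<^sup>2 * (cmod (u r))\<^sup>2) + Im k * q r * (cmod (u r))\<^sup>2
          - Re (\<i> * cnj k * (f r * cnj (u r)))"
        unfolding G_def cmod_power2 by (simp add: power2_eq_square algebra_simps)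
      moreover have "Re (\<i> * cnj k * (f r * cnj (u r))) \<le> cmod k * (cmod (f r) * cmod (u r))"
        using complex_Re_le_cmod[of "\<i> * cnj k * (f r * cnj (u r))"] by (simp add: norm_mult)
      moreover have "Im k * q r * (cmod (u r))\<^sup>2 \<ge> 0" using q[OF that] k by simp
      ultimately show ?thesis unfolding H_def by linarith
    qed
    have "integral {0..R} H \<le> Re (\<i> * cnj k * (p R * cnj (u R)))"
      by (rule has_integral_le[OF integrable_integral G])
        (use halfline_integrable_imp_abs[OF iH] le in \<open>auto simp: absolutely_integrable_on_def\<close>)
    also have "\<dots> \<le> cmod k * (cmod (p R) * cmod (u R))"
      using complex_Re_le_cmod[of "\<i> * cnj k * (p R * cnj (u R))"] by (simp add: norm_mult)
    also have "\<dots> \<le> cmod k * ((cmod (p R))\<^sup>2 + (cmod (u R))\<^sup>2)"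
    proof (rule mult_left_mono)
      have "0 \<le> cmod (p R) * cmod (u R)" by simp
      with sum_squares_bound[of "cmod (p R)" "cmod (u R)"]
      show "cmod (p R) * cmod (u R) \<le> (cmod (p R))\<^sup>2 + (cmod (u R))\<^sup>2" by linarith
    qed auto
    finally show "integral {0..R} H \<le> 0 + cmod k * ((cmod (p R))\<^sup>2 + (cmod (u R))\<^sup>2)" by simp
  qed auto
  then show ?thesis unfolding H_def using i1 i2 by simp
qed

text \<open>Cauchy-Schwarz in the rotated form identity. The constants blow up as
  \<open>Im k\<close> tends to 0, so these bounds serve only to provide a bounded operator and a
  step size for the perturbation argument.\<close>

lemma solves_apriori:
  assumes s: "solves q (k\<^sup>2) f u p" and f: "f \<in> L2" and q: "\<And>r. r \<ge> 0 \<Longrightarrow> q r \<ge> 0" and k: "Im k > 0"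
  shows "nrm u \<le> nrm f / (Im k * cmod k)" "nrm p \<le> nrm f / Im k"
proof -
  note sD = solvesD[OF s]
  have k0: "cmod k > 0" using k by auto
  have "Im k * ((nrm p)\<^sup>2 + (cmod k)\<^sup>2 * (nrm u)\<^sup>2) = Im k * (LINT r|halfline. (cmod (p r))\<^sup>2 + (cmod k)\<^sup>2 * (cmod (u r))\<^sup>2)"
    unfolding nrm_sq using sD L2_integrable by simp
  also have "\<dots> \<le> cmod k * (LINT r|halfline. cmod (f r) * cmod (u r))"
    by (rule resolvent_identity[OF assms])
  also have "\<dots> \<le> cmod k * (nrm f * nrm u)"
    by (intro mult_left_mono Cauchy_Schwarz_L2 f sD) auto
  finally have *: "Im k * ((nrm p)\<^sup>2 + (cmod k)\<^sup>2 * (nrm u)\<^sup>2) \<le> cmod k * (nrm f * nrm u)" .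
  have "Im k * ((cmod k)\<^sup>2 * (nrm u)\<^sup>2) \<le> Im k * ((nrm p)\<^sup>2 + (cmod k)\<^sup>2 * (nrm u)\<^sup>2)"
    using k by (intro mult_left_mono) auto
  with * have "Im k * ((cmod k)\<^sup>2 * (nrm u)\<^sup>2) \<le> cmod k * (nrm f * nrm u)" by linarith
  then have "(cmod k * nrm u) * (Im k * cmod k * nrm u) \<le> (cmod k * nrm u) * nrm f"
    by (simp add: power2_eq_square algebra_simps)
  moreover have "cmod k * nrm u > 0 \<or> nrm u = 0"
    using k0 nrm_nonneg[of u] by (metis antisym_conv2 mult_pos_pos)
  ultimately have "Im k * cmod k * nrm u \<le> nrm f \<or> nrm u = 0"
    by (metis mult_le_cancel_left_pos)
  then show u: "nrm u \<le> nrm f / (Im k * cmod k)"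
    using k k0 by (auto simp: field_simps)
  have "Im k * (nrm p)\<^sup>2 \<le> Im k * ((nrm p)\<^sup>2 + (cmod k)\<^sup>2 * (nrm u)\<^sup>2)"
    using k by (intro mult_left_mono) auto
  also have "\<dots> \<le> cmod k * (nrm f * (nrm f / (Im k * cmod k)))"
    by (rule order_trans[OF *]) (intro mult_left_mono u, auto)
  finally have "(nrm p)\<^sup>2 \<le> (nrm f / Im k)\<^sup>2" using k k0 by (simp add: field_simps power2_eq_square)
  then show "nrm p \<le> nrm f / Im k" by (rule power2_le_imp_le) (use k in auto)
qed

text \<open>The Wronskian \<open>p r * v r - u r * s' r\<close> has derivative
  \<open>u r * g r - f r * v r\<close>, vanishes at 0 and is dominated by an integrable function.
  The pairing is bilinear because both equations contain the same \<open>z\<close>, not its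
  conjugate.\<close>

lemma solves_symmetric:
  assumes s: "solves q z f u p" and t: "solves q z g v s'" and f: "f \<in> L2" and g: "g \<in> L2"
  shows "(LINT r|halfline. u r * g r) = (LINT r|halfline. f r * v r)"
proof -
  note sD = solvesD[OF s] and tD = solvesD[OF t]
  define D where "D = (LINT r|halfline. u r * g r - f r * v r)"
  have i: "integrable halfline (\<lambda>r. u r * g r)" "integrable halfline (\<lambda>r. f r * v r)"
    using L2_prod_integrable sD tD f g by auto
  then have i': "integrable halfline (\<lambda>r. u r * g r - f r * v r)" by auto
  \<comment> \<open>Multiplication by \<open>cnj D\<close> makes a one-sided real estimate
    sufficient: the integral of \<open>H\<close> is |D|^2.\<close>
  define H where "H = (\<lambda>r. Re (cnj D * (u r * g r - f r * v r)))"
  have bl: "bounded_linear (\<lambda>x. Re (cnj D * x))"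
    by (rule bounded_linear_compose[OF bounded_linear_Re bounded_linear_mult_right])
  have iH: "integrable halfline H"
    unfolding H_def by (rule integrable_bounded_linear[OF bl i'])
  have "(LINT r|halfline. H r) \<le> 0"
  proof (rule halfline_integral_le[OF iH, of "\<lambda>r. ((cmod (p r))\<^sup>2 + (cmod (v r))\<^sup>2) + ((cmod (u r))\<^sup>2 + (cmod (s' r))\<^sup>2)" "cmod D"])
    show "integrable halfline (\<lambda>r. ((cmod (p r))\<^sup>2 + (cmod (v r))\<^sup>2) + ((cmod (u r))\<^sup>2 + (cmod (s' r))\<^sup>2))"
      using sD tD L2_integrable by auto
    fix R :: real assume R: "R > 0"
    have "AC (\<lambda>r. p r * v r - u r * s' r) (\<lambda>r. (((of_real (q r) - z) * u r - f r) * v r + p r * s' r)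
       - (p r * s' r + u r * ((of_real (q r) - z) * v r - g r)))"
      by (intro AC_diff AC_mult sD tD)
    then have "AC (\<lambda>r. p r * v r - u r * s' r) (\<lambda>r. u r * g r - f r * v r)"
      by (rule AC_cong) (auto simp: algebra_simps)
    then have "((\<lambda>r. u r * g r - f r * v r) has_integral (p R * v R - u R * s' R)) {0..R}"
      using AC_has_integral[of _ "\<lambda>r. u r * g r - f r * v r" R] R sD(3) tD(3) by fastforce
    from has_integral_linear[OF this bl]
    have "integral {0..R} H = Re (cnj D * (p R * v R - u R * s' R))"
      unfolding H_def o_def by (rule integral_unique)
    also have "\<dots> \<le> cmod D * (cmod (p R * v R - u R * s' R))"
      using complex_Re_le_cmod[of "cnj D * (p R * v R - u R * s' R)"] by (simp add: norm_mult)
    also have "\<dots> \<le> cmod D * (((cmod (p R))\<^sup>2 + (cmod (v R))\<^sup>2) + ((cmod (u R))\<^sup>2 + (cmod (s' R))\<^sup>2))"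
    proof (rule mult_left_mono)
      have "cmod (p R * v R - u R * s' R) \<le> cmod (p R) * cmod (v R) + cmod (u R) * cmod (s' R)"
        by (rule order_trans[OF norm_triangle_ineq4]) (simp add: norm_mult)
      moreover have "0 \<le> cmod (p R) * cmod (v R)" "0 \<le> cmod (u R) * cmod (s' R)" by auto
      ultimately
      show "cmod (p R * v R - u R * s' R) \<le> ((cmod (p R))\<^sup>2 + (cmod (v R))\<^sup>2) + ((cmod (u R))\<^sup>2 + (cmod (s' R))\<^sup>2)"
        using sum_squares_bound[of "cmod (p R)" "cmod (v R)"] sum_squares_bound[of "cmod (u R)" "cmod (s' R)"] by linarith
    qed auto
    finally show "integral {0..R} H \<le> 0 + cmod D * (((cmod (p R))\<^sup>2 + (cmod (v R))\<^sup>2) + ((cmod (u R))\<^sup>2 + (cmod (s' R))\<^sup>2))" by simp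
  qed auto
  moreover have "(LINT r|halfline. H r) = Re (cnj D * D)"
    unfolding H_def D_def[symmetric] using integral_bounded_linear[OF bl i'] D_def by simp
  ultimately have "(cmod D)\<^sup>2 \<le> 0"
    unfolding cmod_power2 by (simp add: power2_eq_square)
  then have "D = 0" by simp
  then show ?thesis unfolding D_def using i by simp
qed

section \<open>From the measure inequality to monotonicity of the weighted potential\<close>

lemma antimono_right_limit:
  fixes V :: "real \<Rightarrow> real"
  assumes V: "antimono_on {0..} V" and x: "x \<ge> 0"
  shows "(V \<longlongrightarrow> Lim (at_right x) V) (at_right x)"
proof -
  have bdd: "bdd_above (V ` {x<..})" "V ` {x<..} \<noteq> {}"
    using V x by (auto simp: monotone_on_def bdd_above_def intro!: exI[of _ "V x"])
  have "(V \<longlongrightarrow> (SUP y\<in>{x<..}. V y)) (at_right x)"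
  proof (rule order_tendstoI)
    fix l assume "l < (SUP y\<in>{x<..}. V y)"
    then obtain y where y: "y > x" "l < V y" using less_cSUP_iff[OF _ bdd(1)] by auto
    show "\<forall>\<^sub>F t in at_right x. l < V t"
      unfolding eventually_at_right_field
      using y V x by (auto simp: monotone_on_def intro!: exI[of _ y] less_le_trans[OF y(2)])
  next
    fix l assume l: "(SUP y\<in>{x<..}. V y) < l"
    have "V t < l" if "t > x" for t using cSUP_upper[OF _ bdd(1), of t] l that by fastforce
    thus "\<forall>\<^sub>F t in at_right x. V t < l"
      unfolding eventually_at_right_field by (auto intro!: exI[of _ "x+1"])
  qed
  thus ?thesis using tendsto_Lim by (metis trivial_limit_at_right_real)
qed

lemma antimono_right_limit_bounds:
  fixes V :: "real \<Rightarrow> real"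
  assumes V: "antimono_on {0..} V" and x: "x \<ge> 0"
  shows "Lim (at_right x) V \<le> V x" "y > x \<Longrightarrow> V y \<le> Lim (at_right x) V"
proof -
  have "\<forall>\<^sub>F t in at_right x. V t \<le> V x" unfolding eventually_at_right_field
    using V x by (auto simp: monotone_on_def intro!: exI[of _ "x+1"])
  from tendsto_upperbound[OF antimono_right_limit[OF V x] this] show "Lim (at_right x) V \<le> V x" by simp
  assume y: "y > x"
  have "\<forall>\<^sub>F t in at_right x. V t \<ge> V y" unfolding eventually_at_right_field
    using V x y by (auto simp: monotone_on_def intro!: exI[of _ y])
  from tendsto_lowerbound[OF antimono_right_limit[OF V x] this] show "V y \<le> Lim (at_right x) V" by simp
qed

text \<open>The measure inequality on (a,b], with the integrand replaced by a lower bound at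
  \<open>b\<close>. Right limits occur because the measure of a half-open interval is a difference
  of right limits.\<close>

lemma log_decay_step:
  fixes V :: "real \<Rightarrow> real"
  assumes V: "antimono_on {0..} V" "\<And>r. r \<ge> 0 \<Longrightarrow> V r \<ge> 0" "log_decay c V" "c > 0" and ab: "0 \<le> a" "a < b"
  shows "Lim (at_right b) V * (1 + c * ((b - a) / (1 + b))) \<le> Lim (at_right a) V"
proof -
  let ?G = "\<lambda>x. Lim (at_right x) V"
  have Gb: "?G b \<ge> 0"
    using antimono_right_limit_bounds(2)[OF V(1), of b "b+1"] V(2)[of "b+1"] ab by auto
  have GG: "?G b \<le> ?G a"
    using antimono_right_limit_bounds[OF V(1), of b] antimono_right_limit_bounds(2)[OF V(1), of a b] ab by auto
  have "ennreal (c * inverse (1 + b) * ?G b * (b - a)) = (\<integral>\<^sup>+r\<in>{a<..b}. ennreal (c * inverse (1 + b) * ?G b) \<partial>lborel)"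
    using ab Gb V(4) by (simp add: nn_integral_cmult_indicator ennreal_mult)
  also have "\<dots> \<le> (\<integral>\<^sup>+r\<in>{a<..b}. ennreal (c * inverse (1 + r) * V r) \<partial>lborel)"
  proof (rule nn_integral_mono)
    fix r
    show "ennreal (c * inverse (1 + b) * ?G b) * indicator {a<..b} r \<le> ennreal (c * inverse (1 + r) * V r) * indicator {a<..b} r"
    proof (cases "r \<in> {a<..b}")
      case True
      have "?G b \<le> V b" using antimono_right_limit_bounds(1)[OF V(1), of b] ab by auto
      also have "\<dots> \<le> V r" using V(1) True ab by (auto simp: monotone_on_def)
      finally have "c * inverse (1 + b) * ?G b \<le> c * inverse (1 + r) * V r"
        using True ab Gb V(4) by (intro mult_mono le_imp_inverse_le) auto
      then show ?thesis using True by (simp add: ennreal_leI)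
    qed auto
  qed
  also have "\<dots> \<le> emeasure (neg_deriv_measure V) {a<..b}"
    using V(3)[unfolded log_decay_def, rule_format, of "{a<..b}"] ab by (simp add: subset_eq)
  also have "\<dots> = ennreal (?G a - ?G b)"
    by (rule emeasure_neg_deriv_measure_Ioc) (use V ab in auto)
  finally have "c * inverse (1 + b) * ?G b * (b - a) \<le> ?G a - ?G b"
    using GG by (subst (asm) ennreal_le_iff) auto
  then show ?thesis by (simp add: algebra_simps divide_inverse)
qed

text \<open>Iterating \<open>log_decay_step\<close> along a geometric partition of \<open>[1+a, 1+b]\<close> compounds to the power.\<close>

lemma log_decay_antimono_right:
  fixes V :: "real \<Rightarrow> real"
  assumes V: "antimono_on {0..} V" "\<And>r. r \<ge> 0 \<Longrightarrow> V r \<ge> 0" "log_decay c V" "c > 0" and ab: "0 \<le> a" "a < b"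
  shows "Lim (at_right b) V * (1 + b) powr c \<le> Lim (at_right a) V * (1 + a) powr c"
proof -
  let ?G = "\<lambda>x. Lim (at_right x) V"
  define L where "L = ln ((1 + b) / (1 + a))"
  have L0: "L > 0" unfolding L_def using ab by simp
  have Gb: "?G b \<ge> 0"
    using antimono_right_limit_bounds(2)[OF V(1), of b "b+1"] V(2)[of "b+1"] ab by auto
  have iter: "?G b * (1 + c * (1 - exp (- (L / n)))) ^ n \<le> ?G a" if n: "n > 0" for n :: nat
  proof -
    define e where "e = exp (L / n)"
    have e: "e > 1" "exp (- (L / n)) = 1 / e" unfolding e_def using L0 n by (auto simp: exp_minus field_simps)
    \<comment> \<open>Geometric nodes make the step divided by \<open>1 + x (Suc i)\<close> the same
      for every \<open>i\<close>, so each step gains the same factor.\<close>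
    define x where "x = (\<lambda>i::nat. (1 + a) * e ^ i - 1)"
    have x0: "x i \<ge> 0" for i
    proof -
      have "1 * 1 \<le> (1 + a) * e ^ i" using ab e by (intro mult_mono one_le_power) auto
      then show ?thesis unfolding x_def by linarith
    qed
    have "?G (x i) * (1 + c * (1 - exp (- (L / n)))) ^ i \<le> ?G a" for i
    proof (induction i)
      case 0 then show ?case by (simp add: x_def)
    next
      case (Suc i)
      have pos: "1 - exp (- (L / n)) \<ge> 0" using L0 n by simp
      have lt: "x i < x (Suc i)" unfolding x_def using ab e by simp
      have "(1 + a) * e ^ i \<noteq> 0" using ab e by simp
      then have eq: "(x (Suc i) - x i) / (1 + x (Suc i)) = 1 - exp (- (L / n))"
        unfolding x_def e(2) using e(1) by (simp add: divide_simps) (simp add: algebra_simps)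
      have "?G (x (Suc i)) * (1 + c * (1 - exp (- (L / n)))) \<le> ?G (x i)"
        using log_decay_step[OF V x0[of i] lt] unfolding eq .
      then have "?G (x (Suc i)) * (1 + c * (1 - exp (- (L / n)))) * (1 + c * (1 - exp (- (L / n)))) ^ i
         \<le> ?G (x i) * (1 + c * (1 - exp (- (L / n)))) ^ i"
        using V(4) pos by (intro mult_right_mono) auto
      then show ?case using Suc by (simp add: mult.assoc)
    qed
    from this[of n] have "?G (x n) * (1 + c * (1 - exp (- (L / n)))) ^ n \<le> ?G a" .
    moreover have "x n = b"
    proof -
      have "e ^ n = exp L" unfolding e_def using n by (simp add: exp_of_nat_mult[symmetric])
      then show ?thesis unfolding x_def L_def using ab by simp
    qed
    ultimately show ?thesis by simp
  qed
  \<comment> \<open>To first order the base is 1 + c L / n, so the compound factor tends to exp (c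
    L), which is the power \<open>c\<close> of (1+b)/(1+a).\<close>
  have lim: "(\<lambda>n. (1 + c * (1 - exp (- (L / real n)))) ^ n) \<longlonglongrightarrow> exp (c * L)"
  proof -
    have "(\<lambda>n. exp (real n * ln (1 + c * (1 - exp (- (L / real n)))))) \<longlonglongrightarrow> exp (c * L)"
      using L0 \<open>c > 0\<close> by real_asymp
    moreover have "exp (real n * ln (1 + c * (1 - exp (- (L / real n))))) = (1 + c * (1 - exp (- (L / real n)))) ^ n" for n
    proof -
      have "1 + c * (1 - exp (- (L / real n))) > 0"
        using \<open>c > 0\<close> L0 by (intro add_pos_nonneg mult_nonneg_nonneg) auto
      then show ?thesis by (simp add: exp_of_nat_mult)
    qed
    ultimately show ?thesis by simp
  qed
  have "?G b * exp (c * L) \<le> ?G a"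
    by (rule LIMSEQ_le_const2[OF tendsto_mult_left[OF lim]]) (use iter in \<open>auto intro!: exI[of _ 1]\<close>)
  moreover have "exp (c * L) = (1 + b) powr c / (1 + a) powr c"
    unfolding L_def using ab by (simp add: powr_def exp_diff[symmetric] ln_div right_diff_distrib)
  ultimately have "?G b * ((1 + b) powr c / (1 + a) powr c) * (1 + a) powr c \<le> ?G a * (1 + a) powr c"
    by (intro mult_right_mono) auto
  then show ?thesis using ab by simp
qed

text \<open>The measure inequality is used only through its consequence that \<open>(1+r)\<^sup>c V(r)\<close> is nonincreasing.\<close>

lemma log_decay_antimono:
  fixes V :: "real \<Rightarrow> real"
  assumes V: "antimono_on {0..} V" "\<And>r. r \<ge> 0 \<Longrightarrow> V r \<ge> 0" "log_decay c V" "c > 0" and ab: "0 \<le> a" "a \<le> b"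
  shows "V b * (1 + b) powr c \<le> V a * (1 + a) powr c"
proof (cases "a = b")
  case False
  then have ab: "0 \<le> a" "a < b" using ab by auto
  let ?G = "\<lambda>x. Lim (at_right x) V"
  \<comment> \<open>An intermediate point is needed: \<open>V b\<close> may lie above its right
    limit at \<open>b\<close>, but not above the right limit at any \<open>y < b\<close>.\<close>
  have "V b * (1 + y) powr c \<le> V a * (1 + a) powr c" if y: "a < y" "y < b" for y
  proof -
    have "V b * (1 + y) powr c \<le> ?G y * (1 + y) powr c"
      using antimono_right_limit_bounds(2)[OF V(1), of y b] y ab by (intro mult_right_mono) auto
    also have "\<dots> \<le> ?G a * (1 + a) powr c"
      by (rule log_decay_antimono_right[OF V]) (use y ab in auto)
    also have "\<dots> \<le> V a * (1 + a) powr c"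
      using antimono_right_limit_bounds(1)[OF V(1), of a] ab by (intro mult_right_mono) auto
    finally show ?thesis .
  qed
  then have ev: "\<forall>\<^sub>F y in at_left b. V b * (1 + y) powr c \<le> V a * (1 + a) powr c"
    unfolding eventually_at_left_field using ab by (intro exI[of _ a]) auto
  have "((\<lambda>y. V b * (1 + y) powr c) \<longlongrightarrow> V b * (1 + b) powr c) (at_left b)"
    using ab by (intro tendsto_intros) auto
  from tendsto_upperbound[OF this ev] show ?thesis by simp
qed auto

section \<open>The weighted energy estimate\<close>

lemma antimono_measurable:
  fixes V :: "real \<Rightarrow> real"
  assumes "antimono_on {0..} V"
  shows "V \<in> borel_measurable halfline" "V \<in> borel_measurable (lebesgue_on {0..R})"
proof -
  \<comment> \<open>Constant continuation to the left of 0 makes the negative of \<open>V\<close>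
    monotone on the whole line.\<close>
  have "mono (\<lambda>x. - V (max 0 x))"
    using assms by (auto simp: mono_def monotone_on_def)
  then have "(\<lambda>x. - V (max 0 x)) \<in> borel_measurable borel" by (rule borel_measurable_mono)
  then have "(\<lambda>x. - (- V (max 0 x))) \<in> borel_measurable borel" by (rule borel_measurable_uminus)
  then have m: "(\<lambda>x. V (max 0 x)) \<in> borel_measurable lebesgue" by (simp add: measurable_completion)
  have *: "(\<lambda>x. V (max 0 x)) \<in> borel_measurable (lebesgue_on S)" for S
    by (rule measurable_restrict_space1[OF m])
  show "V \<in> borel_measurable halfline" "V \<in> borel_measurable (lebesgue_on {0..R})"
    by (rule measurable_cong[THEN iffD1, OF _ *]; simp add: max_def)+
qed

lemma halfline_integrable_bounded_mult:
  fixes c g :: "real \<Rightarrow> real"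
  assumes "integrable halfline g" "c \<in> borel_measurable halfline" "\<And>r. r > 0 \<Longrightarrow> \<bar>c r\<bar> \<le> B"
  shows "integrable halfline (\<lambda>r. c r * g r)"
proof -
  have [measurable]: "c \<in> borel_measurable halfline" "g \<in> borel_measurable halfline" using assms by auto
  show ?thesis
  proof (rule Bochner_Integration.integrable_bound[of _ "\<lambda>r. B * g r"])
    show "AE r in halfline. norm (c r * g r) \<le> norm (B * g r)"
    proof (rule AE_I2)
      fix r :: real assume "r \<in> space halfline"
      then have "\<bar>c r\<bar> \<le> \<bar>B\<bar>" using assms(3)[of r] by auto
      then show "norm (c r * g r) \<le> norm (B * g r)" by (simp add: abs_mult mult_right_mono)
    qed
  qed (use assms in auto)
qed

lemma one_plus_powr_continuous [continuous_intros]: "continuous_on {0..} (\<lambda>r::real. (1 + r) powr a)"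
  by (intro continuous_intros) auto

lemma AC_powr: "AC (\<lambda>r. of_real ((1 + r) powr a)) (\<lambda>r. of_real (a * (1 + r) powr (a - 1)))"
proof (rule AC_C1_real)
  fix x :: real assume "x \<ge> 0"
  then show "((\<lambda>r. (1 + r) powr a) has_real_derivative a * (1 + x) powr (a - 1)) (at x within {0..})"
    by (auto intro!: derivative_eq_intros)
qed (intro continuous_intros)

lemma AC_real_has_integral:
  assumes "AC (\<lambda>r. of_real (\<Phi> r)) (\<lambda>r. of_real (\<phi> r))" "R \<ge> 0"
  shows "(\<phi> has_integral (\<Phi> R - \<Phi> 0)) {0..R}" "\<phi> absolutely_integrable_on {0..R}"
  using has_integral_linear[OF AC_has_integral[OF assms] bounded_linear_Re]
    absolutely_integrable_linear[OF AC_absolutely_integrable[OF assms(1)] bounded_linear_Re, of R]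
  by (auto simp: o_def)

text \<open>This is \<open>\<integral>V d\<Phi> = -\<integral>\<Phi> dV + V(R) \<Phi>(R)\<close> followed by the decay of \<open>V\<close>; the second mean value theorem,
  applied to the nonincreasing \<open>(1+r)\<^sup>c V\<close>, avoids the Stieltjes integral.\<close>

lemma antimono_weighted_integral:
  fixes V :: "real \<Rightarrow> real"
  assumes V: "antimono_on {0..} V" "\<And>r. r \<ge> 0 \<Longrightarrow> V r \<ge> 0" "\<And>r. r \<ge> 0 \<Longrightarrow> V r \<le> B"
    and m: "\<And>a b. 0 \<le> a \<Longrightarrow> a \<le> b \<Longrightarrow> V b * (1 + b) powr c \<le> V a * (1 + a) powr c"
    and \<Phi>: "AC (\<lambda>r. of_real (\<Phi> r)) (\<lambda>r. of_real (\<phi> r))" "\<Phi> 0 = 0" "\<And>r. r \<ge> 0 \<Longrightarrow> \<Phi> r \<ge> 0"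
    and R: "R \<ge> 0"
  shows "(\<lambda>r. V r * \<phi> r) integrable_on {0..R}" "(\<lambda>r. V r * \<Phi> r / (1 + r)) integrable_on {0..R}"
    "c * integral {0..R} (\<lambda>r. V r * \<Phi> r / (1 + r)) \<le> integral {0..R} (\<lambda>r. V r * \<phi> r)"
proof -
  have bV: "bounded (V ` {0..R})"
    unfolding bounded_iff using V(2,3) by (intro exI[of _ B]) auto
  have c\<Phi>: "continuous_on {0..} (\<lambda>r. Re (of_real (\<Phi> r)))"
    by (intro continuous_intros AC_continuous[OF \<Phi>(1)])
  have i1: "(\<lambda>r. V r * \<phi> r) absolutely_integrable_on {0..R}"
    by (rule absolutely_integrable_bounded_measurable_product_real[OF antimono_measurable(2)[OF V(1)]])
      (use bV AC_real_has_integral[OF \<Phi>(1) R] in auto)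
  have i2: "(\<lambda>r. V r * (\<Phi> r / (1 + r))) absolutely_integrable_on {0..R}"
  proof (rule absolutely_integrable_bounded_measurable_product_real[OF antimono_measurable(2)[OF V(1)]])
    have "continuous_on {0..R} (\<lambda>r. \<Phi> r / (1 + r))"
      using c\<Phi> by (intro continuous_intros) (auto intro: continuous_on_subset)
    then show "(\<lambda>r. \<Phi> r / (1 + r)) absolutely_integrable_on {0..R}"
      by (rule absolutely_integrable_continuous_real)
  qed (use bV in auto)
  show j1: "(\<lambda>r. V r * \<phi> r) integrable_on {0..R}" and j2: "(\<lambda>r. V r * \<Phi> r / (1 + r)) integrable_on {0..R}"
    using i1 i2 by (auto simp: absolutely_integrable_on_def)
  \<comment> \<open>The power is moved from one factor to the other:
    \<open>(1 + r) powr c * \<psi> r\<close> equals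
    \<open>\<phi> r - c * \<Phi> r / (1 + r)\<close>. The claim becomes that \<open>\<psi>\<close>
    has a nonnegative integral against the nonincreasing weight
    \<open>V r * (1 + r) powr c\<close>.\<close>
  define \<Psi> where "\<Psi> = (\<lambda>r. (1 + r) powr (-c) * \<Phi> r)"
  define \<psi> where "\<psi> = (\<lambda>r. (-c) * (1 + r) powr (-c - 1) * \<Phi> r + (1 + r) powr (-c) * \<phi> r)"
  have AC\<Psi>: "AC (\<lambda>r. of_real (\<Psi> r)) (\<lambda>r. of_real (\<psi> r))"
    using AC_mult[OF AC_powr[of "-c"] \<Phi>(1)] by (rule AC_cong) (auto simp: \<Psi>_def \<psi>_def)
  have \<psi>int: "\<psi> integrable_on {0..x}" "integral {0..x} \<psi> = \<Psi> x" if "x \<ge> 0" for x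
    using AC_real_has_integral[OF AC\<Psi> that] \<Phi>(2) by (auto simp: has_integral_iff \<Psi>_def)
  have mono: "- (V x * (1 + x) powr c) \<le> - (V y * (1 + y) powr c)" if "0 \<le> x" "x \<le> y" "y \<le> R" for x y
    using m[OF that(1,2)] by simp
  \<comment> \<open>The minus sign makes the weight nondecreasing, as the mean value theorem
    requires.\<close>
  obtain t where t: "t \<in> {0..R}"
    "integral {0..R} (\<lambda>x. - (V x * (1 + x) powr c) * \<psi> x) = - (V 0 * (1 + 0) powr c) * integral {0..t} \<psi> + - (V R * (1 + R) powr c) * integral {t..R} \<psi>"
    by (rule second_mean_value_theorem[OF \<psi>int(1)[OF R] R, of "\<lambda>x. - (V x * (1 + x) powr c)"]) (use mono in blast)+
  have "integral {t..R} \<psi> = \<Psi> R - \<Psi> t"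
    using Henstock_Kurzweil_Integration.integral_combine[OF _ _ \<psi>int(1)[OF R], of t] \<psi>int(2)[of t] \<psi>int(2)[of R] t R by simp
  moreover have "\<Psi> t \<ge> 0" "\<Psi> R \<ge> 0" unfolding \<Psi>_def using \<Phi>(3) t R by auto
  moreover have "V R * (1 + R) powr c \<ge> 0" "V R * (1 + R) powr c \<le> V 0 * (1 + 0) powr c" using V(2) R m[of 0 R] by auto
  moreover define a b where "a = V 0 * (1 + 0) powr c" and "b = V R * (1 + R) powr c"
  ultimately have "- a * \<Psi> t - b * (\<Psi> R - \<Psi> t) \<le> 0"
  proof -
    assume *: "integral {t..R} \<psi> = \<Psi> R - \<Psi> t" "\<Psi> t \<ge> 0" "\<Psi> R \<ge> 0" "V R * (1 + R) powr c \<ge> 0"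
     "V R * (1 + R) powr c \<le> V 0 * (1 + 0) powr c" "a = V 0 * (1 + 0) powr c" "b = V R * (1 + R) powr c"
    \<comment> \<open>Since \<open>a \<ge> b \<ge> 0\<close>, the expression is minus the sum of
      these two nonnegative numbers.\<close>
    have "(a - b) * \<Psi> t \<ge> 0" "b * \<Psi> R \<ge> 0" using * by (auto intro!: mult_nonneg_nonneg)
    then show ?thesis by (simp add: algebra_simps)
  qed
  then have le: "integral {0..R} (\<lambda>x. - (V x * (1 + x) powr c) * \<psi> x) \<le> 0"
    using t \<psi>int(2)[of t] \<open>integral {t..R} \<psi> = \<Psi> R - \<Psi> t\<close> unfolding a_def b_def by simp
  have "integral {0..R} (\<lambda>x. - (V x * (1 + x) powr c) * \<psi> x) = integral {0..R} (\<lambda>r. c * (V r * \<Phi> r / (1 + r)) - V r * \<phi> r)"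
  proof (rule Henstock_Kurzweil_Integration.integral_cong)
    fix x assume x: "x \<in> {0..R}"
    then have "(1 + x) powr c * (1 + x) powr (-c) = 1" "(1 + x) powr c * (1 + x) powr (-c - 1) = 1 / (1 + x)"
      by (simp_all add: powr_add[symmetric] powr_minus_divide)
    then have e: "V x * ((1 + x) powr c * (1 + x) powr (-c)) * \<phi> x = V x * \<phi> x"
      "c * V x * ((1 + x) powr c * (1 + x) powr (-c - 1)) * \<Phi> x = c * (V x * \<Phi> x / (1 + x))" by auto
    show "- (V x * (1 + x) powr c) * \<psi> x = c * (V x * \<Phi> x / (1 + x)) - V x * \<phi> x"
      unfolding \<psi>_def e[symmetric] by (simp add: algebra_simps)
  qed
  also have "\<dots> = c * integral {0..R} (\<lambda>r. V r * \<Phi> r / (1 + r)) - integral {0..R} (\<lambda>r. V r * \<phi> r)"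
    by (subst Henstock_Kurzweil_Integration.integral_diff[OF integrable_on_mult_right[OF j2] j1])
      (simp only: Henstock_Kurzweil_Integration.integral_mult_right)
  finally show "c * integral {0..R} (\<lambda>r. V r * \<Phi> r / (1 + r)) \<le> integral {0..R} (\<lambda>r. V r * \<phi> r)"
    using le by linarith
qed

lemma Re_complex_of_real_mult: "Re (of_real a * x) = a * Re x"
  by simp

lemma Re_energy_derivative:
  "Re (of_real a * (p * cnj p + of_real b * (u * cnj u)) + of_real w * ((h * cnj p + p * cnj h) + of_real b * (p * cnj u + u * cnj p)))
     = a * ((cmod p)\<^sup>2 + b * (cmod u)\<^sup>2) + w * (2 * Re (h * cnj p) + 2 * b * Re (u * cnj p))"
  unfolding cmod_power2 by (simp add: power2_eq_square algebra_simps)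

text \<open>The derivative of \<open>w * E\<close> splits into \<open>w' * E\<close>, a potential
  part, a source part and a part with |k|^2 - k^2. The potential part is
  \<open>V * (\<phi> - w' * U)\<close> with \<open>\<phi>\<close> the derivative of
  \<open>w * U\<close>, so \<open>antimono_weighted_integral\<close> applies although
  \<open>V\<close> has no derivative. The last part is at most \<open>2 * M * Im k * E\<close> in
  modulus and is removed at the end by \<open>resolvent_identity\<close>.\<close>

lemma weighted_energy_estimate:
  fixes V :: "real \<Rightarrow> real"
  assumes V: "antimono_on {0..} V" "\<And>r. r \<ge> 0 \<Longrightarrow> V r \<ge> 0" "\<And>r. r \<ge> 0 \<Longrightarrow> V r \<le> B"
    and m: "\<And>a b. 0 \<le> a \<Longrightarrow> a \<le> b \<Longrightarrow> V b * (1 + b) powr c \<le> V a * (1 + a) powr c"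
    and c: "c > 0" "c * K \<ge> 1" and \<delta>: "\<delta> > 0" and k: "Im k > 0"
    and s: "solves V (k\<^sup>2) f u p" and f: "f \<in> L2"
  defines "M \<equiv> 1 / \<delta> + K"
  shows "(LINT r|halfline. (1 + r) powr (- 1 - \<delta>) * ((cmod (p r))\<^sup>2 + (cmod k)\<^sup>2 * (cmod (u r))\<^sup>2))
      + (c * K - 1) * (LINT r|halfline. V r * inverse (1 + r) * (cmod (u r))\<^sup>2)
    \<le> 2 * M * ((LINT r|halfline. cmod (f r) * cmod (p r)) + cmod k * (LINT r|halfline. cmod (f r) * cmod (u r)))"
proof -
  note sD = solvesD[OF s]
  have K: "K > 0" using c by (metis less_le_trans zero_less_mult_pos zero_less_one)
  have M0: "M > 0" unfolding M_def using K \<delta> by (intro add_pos_pos) auto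
  have d1: "- \<delta> - 1 = - 1 - \<delta>" by simp
  define w where "w = (\<lambda>r. M - (1 + r) powr (- \<delta>) / \<delta>)"
  define w' where "w' = (\<lambda>r. (1 + r) powr (- 1 - \<delta>))"
  define E where "E = (\<lambda>r. (cmod (p r))\<^sup>2 + (cmod k)\<^sup>2 * (cmod (u r))\<^sup>2)"
  define U where "U = (\<lambda>r. (cmod (u r))\<^sup>2)"
  have p1: "(1 + r) powr (- \<delta>) \<le> 1" "(1 + r) powr (- \<delta>) \<ge> 0" if "r \<ge> 0" for r
    using that \<delta> powr_mono[of "-\<delta>" 0 "1 + r"] by auto
  have w: "w r \<ge> K" "w r \<le> M" if "r \<ge> 0" for r
    using p1[OF that] \<delta> unfolding w_def M_def by (auto simp: field_simps)
  have wabs: "\<bar>w r\<bar> \<le> M" if "r > 0" for r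
    using w[of r] K that by auto
  have w'b: "\<bar>w' r\<bar> \<le> 1" "w' r \<ge> 0" if "r \<ge> 0" for r
    using that \<delta> powr_mono[of "-1-\<delta>" 0 "1 + r"] unfolding w'_def by auto
  have ACw: "AC (\<lambda>r. of_real (w r)) (\<lambda>r. of_real (w' r))"
    using AC_diff[OF AC_const[of "of_real M"] AC_cmult[OF AC_powr[of "-\<delta>"], of "of_real (1/\<delta>)"]]
    by (rule AC_cong) (use \<delta> in \<open>auto simp: w_def w'_def d1\<close>)
  have wm: "w \<in> borel_measurable halfline" "w' \<in> borel_measurable halfline"
    unfolding w_def w'_def by (intro continuous_halfline_measurable continuous_intros; use \<delta> in auto)+
  have iU: "integrable halfline U" "integrable halfline E" unfolding U_def E_def using sD L2_integrable by auto
  have iq: "integrable halfline (\<lambda>r. cmod (f r) * cmod (p r))" "integrable halfline (\<lambda>r. cmod (f r) * cmod (u r))"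
    using L2_prod_integrable[OF f sD(2)] L2_prod_integrable[OF f sD(1)] by auto
  have Vm: "V \<in> borel_measurable halfline" by (rule antimono_measurable[OF V(1)])
  have inv: "(\<lambda>r. inverse (1 + r)) \<in> borel_measurable halfline"
    by (intro continuous_halfline_measurable continuous_intros) auto
  have iw'E: "integrable halfline (\<lambda>r. w' r * E r)"
    by (rule halfline_integrable_bounded_mult[OF iU(2) wm(2), of 1]) (use w'b in auto)
  have iw'U: "integrable halfline (\<lambda>r. w' r * U r)"
    by (rule halfline_integrable_bounded_mult[OF iU(1) wm(2), of 1]) (use w'b in auto)
  have iVw'U: "integrable halfline (\<lambda>r. V r * (w' r * U r))"
    by (rule halfline_integrable_bounded_mult[OF iw'U Vm, of B]) (use V in auto)
  have iu1: "integrable halfline (\<lambda>r. inverse (1 + r) * U r)"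
    by (rule halfline_integrable_bounded_mult[OF iU(1) inv, of 1]) (auto simp: field_simps)
  have iVu: "integrable halfline (\<lambda>r. V r * (inverse (1 + r) * U r))"
    by (rule halfline_integrable_bounded_mult[OF iu1 Vm, of B]) (use V in auto)
  have iwVu: "integrable halfline (\<lambda>r. w r * (V r * (inverse (1 + r) * U r)))"
    by (rule halfline_integrable_bounded_mult[OF iVu wm(1), of M]) (rule wabs)
  \<comment> \<open>What the lower bound for the derivative of \<open>w * E\<close> leaves once
    \<open>V * \<phi>\<close> is split off.\<close>
  define J where "J = (\<lambda>r. w' r * E r - V r * (w' r * U r) - 2 * M * (cmod (f r) * cmod (p r)) - 2 * M * Im k * E r)"
  have iJ: "integrable halfline J" unfolding J_def using iw'E iVw'U iq iU by auto
  define H where "H = (\<lambda>r. J r + c * (w r * (V r * (inverse (1 + r) * U r))))"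
  have iH: "integrable halfline H" unfolding H_def using iJ iwVu by auto
  define \<Phi> where "\<Phi> = (\<lambda>r. w r * U r)"
  define \<phi> where "\<phi> = (\<lambda>r. w' r * U r + 2 * w r * Re (u r * cnj (p r)))"
  have AC\<Phi>: "AC (\<lambda>r. of_real (\<Phi> r)) (\<lambda>r. of_real (\<phi> r))"
    using AC_mult[OF ACw AC_mult[OF sD(4) AC_cnj[OF sD(4)]]]
    by (rule AC_cong; unfold \<Phi>_def \<phi>_def U_def cmod_power2)
      (simp_all add: complex_eq_iff power2_eq_square algebra_simps)
  have "(LINT r|halfline. H r) \<le> 0"
  proof (rule halfline_integral_le[OF iH iU(2), of M])
    fix R :: real assume R: "R > 0"
    note ml = antimono_weighted_integral[OF V m AC\<Phi>, of R]
    have \<Phi>0: "\<Phi> 0 = 0" "\<And>r. r \<ge> 0 \<Longrightarrow> \<Phi> r \<ge> 0"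
      unfolding \<Phi>_def U_def using sD(3) w(1) K by (auto intro!: mult_nonneg_nonneg order_trans[OF _ w(1)])
    define h where "h = (\<lambda>r. (of_real (V r) - k\<^sup>2) * u r - f r)"
    define D where "D = (\<lambda>r. of_real (w' r) * (p r * cnj (p r) + (of_real ((cmod k)\<^sup>2)) * (u r * cnj (u r)))
       + of_real (w r) * ((h r * cnj (p r) + p r * cnj (h r)) + (of_real ((cmod k)\<^sup>2)) * (p r * cnj (u r) + u r * cnj (p r))))"
    have "AC (\<lambda>r. of_real (w r) * (p r * cnj (p r) + (of_real ((cmod k)\<^sup>2)) * (u r * cnj (u r)))) D"
      unfolding D_def h_def by (intro AC_mult AC_add AC_cmult AC_cnj sD ACw)
    moreover have "Re (of_real (w r) * (p r * cnj (p r) + (of_real ((cmod k)\<^sup>2)) * (u r * cnj (u r)))) = w r * E r" for r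
      unfolding E_def cmod_power2 by (simp add: power2_eq_square)
    moreover note has_integral_linear[OF AC_has_integral[OF calculation(1)] bounded_linear_Re, of R]
    ultimately
    have D: "((\<lambda>r. Re (D r)) has_integral (w R * E R - w 0 * E 0)) {0..R}"
      using R by (simp only: o_def minus_complex.simps)
    have le: "J r + V r * \<phi> r \<le> Re (D r)" if r: "r \<ge> 0" for r
    proof -
      have "Re (D r) = w' r * E r + V r * (\<phi> r - w' r * U r) - 2 * w r * Re (f r * cnj (p r))
         + 2 * w r * Re ((of_real ((cmod k)\<^sup>2) - k\<^sup>2) * (u r * cnj (p r)))"
      proof -
        define X where "X = u r * cnj (p r)"
        have "h r * cnj (p r) = of_real (V r) * X - k\<^sup>2 * X - f r * cnj (p r)"
          unfolding h_def X_def by (simp only: ring_distribs mult.assoc)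
        then have 1: "Re (h r * cnj (p r)) = V r * Re X - Re (k\<^sup>2 * X) - Re (f r * cnj (p r))"
          by (simp only: minus_complex.sel Re_complex_of_real_mult)
        have 2: "Re ((of_real ((cmod k)\<^sup>2) - k\<^sup>2) * X) = (cmod k)\<^sup>2 * Re X - Re (k\<^sup>2 * X)"
          by (simp only: ring_distribs minus_complex.sel Re_complex_of_real_mult)
        show ?thesis
          unfolding D_def[THEN fun_cong, of r, THEN arg_cong, of Re, unfolded Re_energy_derivative] X_def[symmetric] 1 2 E_def U_def \<phi>_def
          by (simp add: algebra_simps)
      qed
      moreover have "w r * Re (f r * cnj (p r)) \<le> M * (cmod (f r) * cmod (p r))"
      proof -
        have "Re (f r * cnj (p r)) \<le> cmod (f r) * cmod (p r)"
          using complex_Re_le_cmod[of "f r * cnj (p r)"] by (simp add: norm_mult)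
        then have "w r * Re (f r * cnj (p r)) \<le> w r * (cmod (f r) * cmod (p r))"
          using w(1)[OF r] K by (intro mult_left_mono) auto
        also have "\<dots> \<le> M * (cmod (f r) * cmod (p r))" using w(2)[OF r] by (intro mult_right_mono) auto
        finally show ?thesis .
      qed
      moreover have "w r * Re ((of_real ((cmod k)\<^sup>2) - k\<^sup>2) * (u r * cnj (p r))) \<ge> - (M * Im k * E r)"
      proof -
        \<comment> \<open>The number is \<open>k * (cnj k - k)\<close>; its factor Im k is what
          makes the term comparable with \<open>resolvent_identity\<close>.\<close>
        have "of_real ((cmod k)\<^sup>2) - k\<^sup>2 = k * (- 2 * \<i> * Im k)"
          unfolding cmod_power2 by (simp add: complex_eq_iff power2_eq_square)
        then have n: "cmod (of_real ((cmod k)\<^sup>2) - k\<^sup>2) = 2 * Im k * cmod k"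
          using k by (simp add: norm_mult)
        have "- Re ((of_real ((cmod k)\<^sup>2) - k\<^sup>2) * (u r * cnj (p r))) \<le> cmod ((of_real ((cmod k)\<^sup>2) - k\<^sup>2) * (u r * cnj (p r)))"
          using abs_Re_le_cmod[of "(of_real ((cmod k)\<^sup>2) - k\<^sup>2) * (u r * cnj (p r))"] by linarith
        also have "\<dots> = Im k * (2 * cmod (p r) * (cmod k * cmod (u r)))"
          unfolding norm_mult[of "of_real ((cmod k)\<^sup>2) - k\<^sup>2"] n by (simp add: norm_mult)
        also have "\<dots> \<le> Im k * E r"
          unfolding E_def using k sum_squares_bound[of "cmod (p r)" "cmod k * cmod (u r)"]
          by (intro mult_left_mono) (auto simp: power_mult_distrib)
        finally have "w r * (- Re ((of_real ((cmod k)\<^sup>2) - k\<^sup>2) * (u r * cnj (p r)))) \<le> w r * (Im k * E r)"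
          using w(1)[OF r] K by (intro mult_left_mono) auto
        also have "\<dots> \<le> M * (Im k * E r)"
          using w(2)[OF r] k unfolding E_def by (intro mult_right_mono) auto
        finally show ?thesis unfolding mult_minus_right mult.assoc by linarith
      qed
      ultimately show ?thesis unfolding J_def by (simp add: algebra_simps)
    qed
    have jJ: "J integrable_on {0..R}" and jW: "(\<lambda>r. w r * (V r * (inverse (1 + r) * U r))) integrable_on {0..R}"
      using halfline_integrable_imp_abs[OF iJ] halfline_integrable_imp_abs[OF iwVu] by (auto simp: absolutely_integrable_on_def)
    have "integral {0..R} J + integral {0..R} (\<lambda>r. V r * \<phi> r) = integral {0..R} (\<lambda>r. J r + V r * \<phi> r)"
      using jJ ml(1) \<Phi>0 R by (subst Henstock_Kurzweil_Integration.integral_add) auto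
    also have "\<dots> \<le> w R * E R - w 0 * E 0"
      by (rule has_integral_le[OF integrable_integral D]) (use jJ ml(1) \<Phi>0 R le in \<open>auto intro: integrable_add\<close>)
    also have "\<dots> \<le> M * E R"
    proof -
      have "w R * E R \<le> M * E R" using w(2)[of R] R unfolding E_def by (intro mult_right_mono) auto
      moreover have "w 0 * E 0 \<ge> 0" using w(1)[of 0] K unfolding E_def by (intro mult_nonneg_nonneg) auto
      ultimately show ?thesis by linarith
    qed
    finally have "integral {0..R} J + integral {0..R} (\<lambda>r. V r * \<phi> r) \<le> M * E R" .
    moreover have "c * integral {0..R} (\<lambda>r. V r * \<Phi> r / (1 + r)) \<le> integral {0..R} (\<lambda>r. V r * \<phi> r)"
      using ml(3) \<Phi>0 R by auto
    moreover have "integral {0..R} (\<lambda>r. V r * \<Phi> r / (1 + r)) = integral {0..R} (\<lambda>r. w r * (V r * (inverse (1 + r) * U r)))"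
      by (rule Henstock_Kurzweil_Integration.integral_cong) (simp add: \<Phi>_def divide_inverse)
    moreover have "integral {0..R} H = integral {0..R} J + c * integral {0..R} (\<lambda>r. w r * (V r * (inverse (1 + r) * U r)))"
      unfolding H_def using jJ jW
      by (subst Henstock_Kurzweil_Integration.integral_add) (auto intro!: integrable_on_mult_right)
    ultimately show "integral {0..R} H \<le> 0 + M * E R" by simp
  qed (use M0 in auto)
  \<comment> \<open>Replaces the multiplier by constants: \<open>c * w\<close> is at least
    \<open>c * K\<close>, and \<open>w' r = (1 + r) powr (- \<delta>) * inverse (1 + r)\<close>
    takes at most 1 away from it.\<close>
  define A where "A = (\<lambda>r. w' r * E r + (c * K - 1) * (V r * (inverse (1 + r) * U r)) - 2 * M * (cmod (f r) * cmod (p r)) - 2 * M * Im k * E r)"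
  have iA: "integrable halfline A" unfolding A_def using iw'E iVu iq iU by auto
  have "(LINT r|halfline. A r) \<le> (LINT r|halfline. H r)"
  proof (rule integral_mono_AE[OF iA iH], rule AE_I2)
    fix r :: real assume "r \<in> space halfline"
    then have r: "r \<ge> 0" by simp
    have "w' r = (1 + r) powr (-\<delta>) * inverse (1 + r)"
      unfolding w'_def using r powr_diff[of "1 + r" "-\<delta>" 1] unfolding d1 by (simp add: divide_inverse)
    moreover have "c * w r - (1 + r) powr (-\<delta>) \<ge> c * K - 1"
    proof -
      have "c * w r \<ge> c * K" using w(1)[OF r] c by simp
      then show ?thesis using p1[OF r] by linarith
    qed
    then have "(c * w r - (1 + r) powr (-\<delta>)) * (V r * (inverse (1 + r) * U r)) \<ge> (c * K - 1) * (V r * (inverse (1 + r) * U r))"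
      using V(2)[OF r] r unfolding U_def by (intro mult_right_mono) auto
    ultimately show "A r \<le> H r" unfolding A_def H_def J_def by (simp add: algebra_simps)
  qed
  with \<open>(LINT r|halfline. H r) \<le> 0\<close> have "(LINT r|halfline. A r) \<le> 0" by linarith
  moreover have "(LINT r|halfline. A r) = (LINT r|halfline. w' r * E r) + (c * K - 1) * (LINT r|halfline. V r * (inverse (1 + r) * U r))
     - 2 * M * (LINT r|halfline. cmod (f r) * cmod (p r)) - 2 * M * Im k * (LINT r|halfline. E r)"
    unfolding A_def using iw'E iVu iq iU by simp
  moreover have "2 * M * (Im k * (LINT r|halfline. E r)) \<le> 2 * M * (cmod k * (LINT r|halfline. cmod (f r) * cmod (u r)))"
    using resolvent_identity[OF s f V(2) k] M0 unfolding E_def by (intro mult_left_mono) auto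
  ultimately have "(LINT r|halfline. w' r * E r) + (c * K - 1) * (LINT r|halfline. V r * (inverse (1 + r) * U r))
     \<le> 2 * M * (LINT r|halfline. cmod (f r) * cmod (p r)) + 2 * M * (cmod k * (LINT r|halfline. cmod (f r) * cmod (u r)))"
    by (simp add: algebra_simps)
  then show ?thesis unfolding w'_def E_def U_def by (simp add: algebra_simps)
qed

section \<open>Weighted bounds for solutions\<close>

lemma wt_sq: "r \<ge> 0 \<Longrightarrow> (wt a r)\<^sup>2 = (1 + r) powr (2 * a)"
  unfolding wt_def by (simp add: power2_eq_square powr_add[symmetric])

lemma wt_le_1: "a \<le> 0 \<Longrightarrow> r \<ge> 0 \<Longrightarrow> wt a r \<le> 1"
  unfolding wt_def using powr_mono[of a 0 "1 + r"] by simp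

lemma wt_nonneg [simp]: "wt a r \<ge> 0"
  by (simp add: wt_def)

lemma wt_measurable: "(\<lambda>r. wt a r) \<in> borel_measurable halfline"
  unfolding wt_def by (intro continuous_halfline_measurable continuous_intros)

lemma wt_measurable_complex: "(\<lambda>r. complex_of_real (wt a r)) \<in> borel_measurable halfline"
  using wt_measurable by measurable

lemma L2_wt: "a \<le> 0 \<Longrightarrow> f \<in> L2 \<Longrightarrow> (\<lambda>r. of_real (wt a r) * f r) \<in> L2"
  by (rule L2_bounded_mult[OF _ wt_measurable_complex, of _ _ 1]) (auto simp: wt_le_1)

text \<open>Completing squares turns the hypothesis into (X - N)^2 + (Y - N)^2 + Z \<le> 2 N^2. For
  nonnegative \<open>Z\<close> the point (X,Y) is thus within distance sqrt 2 N of (N,N), the origin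
  of the factor 1 + sqrt 2.\<close>

lemma quadratic_absorb:
  assumes "X\<^sup>2 + Y\<^sup>2 + Z \<le> 2 * N * (X + Y)" "N \<ge> (0::real)"
  shows "Z \<le> 2 * N\<^sup>2" "Z \<ge> 0 \<Longrightarrow> X \<le> (1 + sqrt 2) * N" "Z \<ge> 0 \<Longrightarrow> Y \<le> (1 + sqrt 2) * N"
proof -
  have *: "(X - N)\<^sup>2 + (Y - N)\<^sup>2 + Z \<le> 2 * N\<^sup>2"
    using assms(1) by (simp add: power2_eq_square algebra_simps)
  then show "Z \<le> 2 * N\<^sup>2" using zero_le_power2[of "X - N"] zero_le_power2[of "Y - N"] by linarith
  assume Z: "Z \<ge> 0"
  have "(X - N)\<^sup>2 \<le> (sqrt 2 * N)\<^sup>2" "(Y - N)\<^sup>2 \<le> (sqrt 2 * N)\<^sup>2"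
    using * Z zero_le_power2[of "X - N"] zero_le_power2[of "Y - N"]
    unfolding power_mult_distrib real_sqrt_pow2[OF zero_le_numeral] by linarith+
  then have "X - N \<le> sqrt 2 * N" "Y - N \<le> sqrt 2 * N"
    using assms(2) by (auto intro: power2_le_imp_le)
  then show "X \<le> (1 + sqrt 2) * N" "Y \<le> (1 + sqrt 2) * N" by (simp_all add: algebra_simps)
qed

text \<open>Integrate the derivative of (1+r)^(-2-\<delta>) |u|^2: it starts from 0 at the boundary
  and has the favourable sign at \<open>R\<close>. The argument gives the constant 2/(2+\<delta>),
  which is then relaxed to 1.\<close>

lemma Hardy_weighted:
  assumes "AC u p" "u 0 = 0" "u \<in> L2" "p \<in> L2" and \<delta>: "\<delta> > 0"
  shows "nrm (\<lambda>r. of_real (wt (- ((1 + \<delta>) / 2) - 1) r) * u r) \<le> nrm (\<lambda>r. of_real (wt (- ((1 + \<delta>) / 2)) r) * p r)"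
proof -
  define a where "a = - ((1 + \<delta>) / 2)"
  define U where "U = (\<lambda>r. of_real (wt (a - 1) r) * u r)"
  define W where "W = (\<lambda>r. of_real (wt a r) * p r)"
  have UL: "U \<in> L2" and WL: "W \<in> L2" unfolding U_def W_def using assms by (auto intro!: L2_wt simp: a_def)
  define H where "H = (\<lambda>r. (2 + \<delta>) * (cmod (U r))\<^sup>2 - 2 * (cmod (U r) * cmod (W r)))"
  have iH: "integrable halfline H"
    unfolding H_def using L2_integrable[OF UL] L2_prod_integrable(2)[OF UL WL] by auto
  have "(LINT r|halfline. H r) \<le> 0"
  proof (rule halfline_integral_le[OF iH L2_integrable[OF UL], of 0])
    fix R :: real assume R: "R > 0"
    define D where "D = (\<lambda>r. of_real ((2 * a - 1) * (1 + r) powr (2 * a - 1 - 1)) * (u r * cnj (u r)) + of_real ((1 + r) powr (2 * a - 1)) * (p r * cnj (u r) + u r * cnj (p r)))"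
    have "AC (\<lambda>r. of_real ((1 + r) powr (2 * a - 1)) * (u r * cnj (u r))) D"
      unfolding D_def by (intro AC_mult AC_powr AC_cnj assms)
    from has_integral_linear[OF AC_has_integral[OF this] bounded_linear_Re, of R]
    have D: "((\<lambda>r. Re (D r)) has_integral ((1 + R) powr (2 * a - 1) * (cmod (u R))\<^sup>2)) {0..R}"
      using R assms(2) unfolding cmod_power2 by (simp add: o_def power2_eq_square)
    have le: "H r \<le> - Re (D r)" if "r \<ge> 0" for r
    proof -
      have e1: "Re (D r) = (2 * a - 1) * ((1 + r) powr (2 * a - 1 - 1) * (cmod (u r))\<^sup>2) + 2 * ((1 + r) powr (2 * a - 1) * Re (u r * cnj (p r)))"
        unfolding D_def cmod_power2 by (simp add: power2_eq_square algebra_simps)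
      have e2: "(1 + r) powr (2 * a - 1 - 1) * (cmod (u r))\<^sup>2 = (cmod (U r))\<^sup>2"
        unfolding U_def using wt_sq[OF that, of "a - 1"] by (simp add: norm_mult power_mult_distrib)
      have e3: "(1 + r) powr (2 * a - 1) * Re (u r * cnj (p r)) \<le> cmod (U r) * cmod (W r)"
      proof -
        have "(1 + r) powr (2 * a - 1) = wt (a - 1) r * wt a r"
          unfolding wt_def by (simp add: powr_add[symmetric])
        moreover have "Re (u r * cnj (p r)) \<le> cmod (u r) * cmod (p r)"
          using abs_Re_le_cmod[of "u r * cnj (p r)"] by (simp add: norm_mult)
        then have "(1 + r) powr (2 * a - 1) * Re (u r * cnj (p r)) \<le> (1 + r) powr (2 * a - 1) * (cmod (u r) * cmod (p r))"
          by (intro mult_left_mono) auto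
        ultimately show ?thesis unfolding U_def W_def by (simp add: norm_mult algebra_simps)
      qed
      have e4: "(2 * a - 1) * (cmod (U r))\<^sup>2 = - ((2 + \<delta>) * (cmod (U r))\<^sup>2)" unfolding a_def by (simp add: field_simps)
      have "x - 2 * b \<le> - (- x + 2 * y)" if "y \<le> b" for x y b :: real using that by linarith
      from this[OF e3] show ?thesis unfolding H_def e1 e2 e4 .
    qed
    have "integral {0..R} H \<le> - ((1 + R) powr (2 * a - 1) * (cmod (u R))\<^sup>2)"
      by (rule has_integral_le[OF integrable_integral has_integral_neg[OF D]])
        (use halfline_integrable_imp_abs[OF iH] le in \<open>auto simp: absolutely_integrable_on_def\<close>)
    also have "\<dots> \<le> 0" by simp
    finally show "integral {0..R} H \<le> 0 + 0 * (cmod (U R))\<^sup>2" by simp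
  qed auto
  moreover have "(LINT r|halfline. H r) = (2 + \<delta>) * (nrm U)\<^sup>2 - 2 * (LINT r|halfline. cmod (U r) * cmod (W r))"
    unfolding H_def nrm_sq using L2_integrable[OF UL] L2_prod_integrable(2)[OF UL WL] by simp
  ultimately have "(2 + \<delta>) * (nrm U)\<^sup>2 \<le> 2 * (nrm U * nrm W)"
    using Cauchy_Schwarz_L2[OF UL WL] by linarith
  moreover have "2 * (nrm U)\<^sup>2 \<le> (2 + \<delta>) * (nrm U)\<^sup>2" using \<delta> by (intro mult_right_mono) auto
  ultimately have "nrm U * nrm U \<le> nrm U * nrm W" by (simp add: power2_eq_square)
  then have "nrm U \<le> nrm W" using nrm_nonneg[of U] nrm_nonneg[of W]
    by (metis antisym_conv2 mult_le_cancel_left_pos)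
  then show ?thesis unfolding U_def W_def a_def .
qed

text \<open>The measure inequality has been traded for monotonicity of
  \<open>V r * (1 + r) powr c\<close>, the only form in which the estimates see it.\<close>

locale decaying_potential =
  fixes V :: "real \<Rightarrow> real" and B c :: real
  assumes V_antimono: "antimono_on {0..} V" and V_nonneg: "r \<ge> 0 \<Longrightarrow> V r \<ge> 0" and V_le: "r \<ge> 0 \<Longrightarrow> V r \<le> B"
    and V_decay: "0 \<le> x \<Longrightarrow> x \<le> y \<Longrightarrow> V y * (1 + y) powr c \<le> V x * (1 + x) powr c"
    and c_pos: "c > 0"
begin

lemma V_measurable: "V \<in> borel_measurable halfline"
  by (rule antimono_measurable[OF V_antimono])

lemma sqrt_weight_L2:
  assumes "u \<in> L2"
  shows "(\<lambda>r. of_real (sqrt (V r) * wt (- (1 / 2)) r) * u r) \<in> L2"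
    "(nrm (\<lambda>r. of_real (sqrt (V r) * wt (- (1 / 2)) r) * u r))\<^sup>2 = (LINT r|halfline. V r * inverse (1 + r) * (cmod (u r))\<^sup>2)"
proof -
  show "(\<lambda>r. of_real (sqrt (V r) * wt (- (1 / 2)) r) * u r) \<in> L2"
  proof (rule L2_bounded_mult[OF assms, of _ "sqrt B"])
    show "(\<lambda>r. complex_of_real (sqrt (V r) * wt (- (1 / 2)) r)) \<in> borel_measurable halfline"
      using V_measurable wt_measurable by measurable
    fix r :: real assume r: "r > 0"
    have "sqrt (V r) * wt (- (1 / 2)) r \<le> sqrt B * 1"
      using r V_le V_nonneg by (intro mult_mono wt_le_1) (auto intro: order_trans)
    then show "cmod (complex_of_real (sqrt (V r) * wt (- (1 / 2)) r)) \<le> sqrt B"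
      using r V_nonneg[of r] unfolding norm_of_real by simp
  qed
  show "(nrm (\<lambda>r. of_real (sqrt (V r) * wt (- (1 / 2)) r) * u r))\<^sup>2 = (LINT r|halfline. V r * inverse (1 + r) * (cmod (u r))\<^sup>2)"
    unfolding nrm_sq
  proof (rule Bochner_Integration.integral_cong[OF refl])
    fix r assume "r \<in> space halfline"
    then have r: "r > 0" by simp
    show "(cmod (complex_of_real (sqrt (V r) * wt (- (1 / 2)) r) * u r))\<^sup>2 = V r * inverse (1 + r) * (cmod (u r))\<^sup>2"
      using r V_nonneg[of r] wt_sq[of r "-(1/2)"] by (simp add: norm_mult power_mult_distrib powr_minus)
  qed
qed

text \<open>The source carries the same weight that is measured in \<open>X\<close> and
  \<open>Y\<close>. Cauchy-Schwarz shifts it from \<open>g\<close> to \<open>p\<close> and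
  \<open>u\<close>, which makes the right side linear in X + Y and ready for
  \<open>quadratic_absorb\<close>.\<close>

lemma weighted_estimate:
  assumes s: "solves V (k\<^sup>2) (\<lambda>r. of_real (wt (- ((1 + \<delta>) / 2)) r) * g r) u p" and g: "g \<in> L2"
    and \<delta>: "\<delta> > 0" and k: "Im k > 0" and K: "c * K \<ge> 1"
  defines "X \<equiv> nrm (\<lambda>r. of_real (wt (- ((1 + \<delta>) / 2)) r) * p r)"
    and "Y \<equiv> cmod k * nrm (\<lambda>r. of_real (wt (- ((1 + \<delta>) / 2)) r) * u r)"
    and "Z \<equiv> nrm (\<lambda>r. of_real (sqrt (V r) * wt (- (1 / 2)) r) * u r)"
  shows "X\<^sup>2 + Y\<^sup>2 + (c * K - 1) * Z\<^sup>2 \<le> 2 * ((1 / \<delta> + K) * nrm g) * (X + Y)"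
proof -
  define a where "a = - ((1 + \<delta>) / 2)"
  have a: "a \<le> 0" unfolding a_def using \<delta> by simp
  have K0: "K > 0" using K c_pos by (metis less_le_trans zero_less_mult_pos zero_less_one)
  have "2 * a = - 1 - \<delta>" unfolding a_def by (simp add: field_simps)
  note sD = solvesD[OF s]
  have pL: "(\<lambda>r. of_real (wt a r) * p r) \<in> L2" and uL: "(\<lambda>r. of_real (wt a r) * u r) \<in> L2"
    using sD a by (auto intro: L2_wt)
  have "(LINT r|halfline. (1 + r) powr (- 1 - \<delta>) * ((cmod (p r))\<^sup>2 + (cmod k)\<^sup>2 * (cmod (u r))\<^sup>2))
    = (LINT r|halfline. (cmod (of_real (wt a r) * p r))\<^sup>2 + (cmod k)\<^sup>2 * (cmod (of_real (wt a r) * u r))\<^sup>2)"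
    by (rule Bochner_Integration.integral_cong[OF refl])
      (simp add: norm_mult power_mult_distrib wt_sq \<open>2 * a = - 1 - \<delta>\<close> distrib_left mult.left_commute)
  also have "\<dots> = X\<^sup>2 + Y\<^sup>2"
    unfolding X_def Y_def power_mult_distrib nrm_sq a_def[symmetric] using L2_integrable[OF pL] L2_integrable[OF uL] by simp
  finally have 1: "(LINT r|halfline. (1 + r) powr (- 1 - \<delta>) * ((cmod (p r))\<^sup>2 + (cmod k)\<^sup>2 * (cmod (u r))\<^sup>2)) = X\<^sup>2 + Y\<^sup>2" .
  have 2: "(LINT r|halfline. cmod (of_real (wt a r) * g r) * cmod (v r)) \<le> nrm g * nrm (\<lambda>r. of_real (wt a r) * v r)"
    if "v \<in> L2" for v
  proof -
    have "(LINT r|halfline. cmod (of_real (wt a r) * g r) * cmod (v r)) = (LINT r|halfline. cmod (g r) * cmod (of_real (wt a r) * v r))"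
      by (rule Bochner_Integration.integral_cong[OF refl]) (simp add: norm_mult)
    then show ?thesis using Cauchy_Schwarz_L2[OF g L2_wt[OF a that]] by simp
  qed
  have fL: "(\<lambda>r. of_real (wt (- ((1 + \<delta>) / 2)) r) * g r) \<in> L2" using L2_wt[OF a g] unfolding a_def .
  have "X\<^sup>2 + Y\<^sup>2 + (c * K - 1) * Z\<^sup>2 \<le> 2 * (1 / \<delta> + K) * ((LINT r|halfline. cmod (of_real (wt a r) * g r) * cmod (p r))
     + cmod k * (LINT r|halfline. cmod (of_real (wt a r) * g r) * cmod (u r)))"
    using weighted_energy_estimate[OF V_antimono V_nonneg V_le V_decay c_pos K \<delta> k s fL]
    unfolding 1 Z_def sqrt_weight_L2(2)[OF sD(1)] a_def[symmetric] .
  also have "\<dots> \<le> 2 * (1 / \<delta> + K) * (nrm g * X + nrm g * Y)"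
  proof (intro mult_left_mono add_mono)
    show "(LINT r|halfline. cmod (of_real (wt a r) * g r) * cmod (p r)) \<le> nrm g * X"
      using 2[OF sD(2)] unfolding X_def a_def .
    have "cmod k * (LINT r|halfline. cmod (of_real (wt a r) * g r) * cmod (u r)) \<le> cmod k * (nrm g * nrm (\<lambda>r. of_real (wt a r) * u r))"
      by (intro mult_left_mono 2 sD) auto
    then show "cmod k * (LINT r|halfline. cmod (of_real (wt a r) * g r) * cmod (u r)) \<le> nrm g * Y"
      unfolding Y_def a_def by (simp add: mult.left_commute)
    have "1 / \<delta> > 0" using \<delta> by simp
    then show "0 \<le> 2 * (1 / \<delta> + K)" using K0 by (intro mult_nonneg_nonneg add_nonneg_nonneg) auto
  qed
  also have "\<dots> = 2 * ((1 / \<delta> + K) * nrm g) * (X + Y)"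
    by (simp only: distrib_left[symmetric] mult.assoc)
  finally show ?thesis .
qed

lemma weighted_bounds:
  assumes s: "solves V (k\<^sup>2) (\<lambda>r. of_real (wt (- ((1 + \<delta>) / 2)) r) * g r) u p" and g: "g \<in> L2"
    and \<delta>: "\<delta> > 0" and k: "Im k > 0"
  shows "nrm (\<lambda>r. of_real (wt (- ((1 + \<delta>) / 2)) r) * u r) \<le> (1 + sqrt 2) / cmod k * (1 / \<delta> + 1 / c) * nrm g"
    and "nrm (\<lambda>r. of_real (wt (- ((1 + \<delta>) / 2) - 1) r) * u r) \<le> (1 + sqrt 2) * (1 / \<delta> + 1 / c) * nrm g"
    and "nrm (\<lambda>r. of_real (sqrt (V r) * wt (- (1 / 2)) r) * u r) \<le> 2 * sqrt 2 / c * sqrt (1 + c / \<delta>) * nrm g"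
proof -
  note sD = solvesD[OF s]
  \<comment> \<open>The smallest admissible \<open>K\<close>: it minimises 1/\<delta> + K at the
    price of losing the \<open>Z\<close> term.\<close>
  have K0: "c * (1 / c) \<ge> 1" using c_pos by simp
  have N: "(1 / \<delta> + 1 / c) * nrm g \<ge> 0" using \<delta> c_pos by (intro mult_nonneg_nonneg add_nonneg_nonneg) auto
  have nn: "(c * (1 / c) - 1) * x\<^sup>2 \<ge> 0" for x :: real using c_pos by simp
  have k0: "cmod k > 0" using k by auto
  note q = quadratic_absorb[OF weighted_estimate[OF s g \<delta> k K0] N]
  show "nrm (\<lambda>r. of_real (wt (- ((1 + \<delta>) / 2)) r) * u r) \<le> (1 + sqrt 2) / cmod k * (1 / \<delta> + 1 / c) * nrm g"
    using q(3)[OF nn] k0 by (simp add: field_simps)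
  show "nrm (\<lambda>r. of_real (wt (- ((1 + \<delta>) / 2) - 1) r) * u r) \<le> (1 + sqrt 2) * (1 / \<delta> + 1 / c) * nrm g"
    using order_trans[OF Hardy_weighted[OF sD(4,3,1,2) \<delta>] q(2)[OF nn]] by (simp add: mult.assoc)
  \<comment> \<open>This \<open>K\<close> minimises (1/\<delta> + K)^2 / (c K - 1), up to a factor 2
    the square of the resulting constant; it turns numerator base and denominator into multiples of
    the same number \<open>t\<close>.\<close>
  define K where "K = 1 / \<delta> + 2 / c"
  define t where "t = 1 + c / \<delta>"
  define Z where "Z = nrm (\<lambda>r. of_real (sqrt (V r) * wt (- (1 / 2)) r) * u r)"
  have t: "t > 0" "c * K - 1 = t" "1 / \<delta> + K = 2 / c * t"
    unfolding t_def K_def using \<delta> c_pos by (auto simp: field_simps intro!: add_pos_pos)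
  have K1: "c * K \<ge> 1" using t by simp
  have "1 / \<delta> + K \<ge> 0" unfolding t(3) using t(1) c_pos by simp
  then have N: "(1 / \<delta> + K) * nrm g \<ge> 0" by simp
  have "t * Z\<^sup>2 \<le> 2 * (2 / c * t * nrm g)\<^sup>2"
    using quadratic_absorb(1)[OF weighted_estimate[OF s g \<delta> k K1] N] unfolding t(2,3) Z_def by simp
  then have "t * Z\<^sup>2 \<le> t * ((2 * sqrt 2 / c * sqrt t * nrm g)\<^sup>2)"
    using t(1) by (simp add: power_mult_distrib power_divide) (simp add: power2_eq_square algebra_simps)
  then have "Z\<^sup>2 \<le> (2 * sqrt 2 / c * sqrt t * nrm g)\<^sup>2" using t(1) by simp
  then show "Z \<le> 2 * sqrt 2 / c * sqrt t * nrm g"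
    by (rule power2_le_imp_le) (use t(1) c_pos in simp)
qed

end

section \<open>Interpolation between weighted bounds\<close>

text \<open>The ratios of a log-convex sequence do not decrease, so the first ratio is a lower bound
  for the exponential growth rate. For iterates of a self-adjoint operator this turns a growth rate
  into a bound on the first step with no loss in the constant.\<close>

lemma log_convex_geometric_bound:
  fixes p :: "nat \<Rightarrow> real"
  assumes nn: "\<And>n. p n \<ge> 0" and lc: "\<And>n. (p (Suc n))\<^sup>2 \<le> p (Suc (Suc n)) * p n"
    and gr: "\<And>n. p (Suc n) \<le> L * \<mu> ^ n" and \<mu>: "\<mu> \<ge> 0"
  shows "p 1 \<le> \<mu> * p 0"
proof (rule ccontr)
  assume "\<not> ?thesis"
  then have less: "\<mu> * p 0 < p 1" by simp
  then have p1: "p 1 > 0" using mult_nonneg_nonneg[OF \<mu> nn[of 0]] by linarith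
  have p0: "p 0 > 0"
  proof -
    have "(p 1)\<^sup>2 \<le> p 2 * p 0" using lc[of 0] by (simp add: numeral_2_eq_2)
    then have "p 0 \<noteq> 0" using p1 by auto
    then show ?thesis using nn[of 0] by simp
  qed
  define \<rho> where "\<rho> = p 1 / p 0"
  have \<rho>: "\<rho> > \<mu>" unfolding \<rho>_def using less p0 by (simp add: field_simps)
  have \<rho>0: "\<rho> > 0" using \<rho> \<mu> by simp
  have st: "p n > 0 \<and> p (Suc n) \<ge> \<rho> * p n" for n
  proof (induction n)
    case 0 then show ?case using p0 by (simp add: \<rho>_def)
  next
    case (Suc n)
    then have pos: "p (Suc n) > 0" using \<rho>0 by (meson less_le_trans mult_pos_pos)
    have "(\<rho> * p n) * p (Suc n) \<le> p (Suc n) * p (Suc n)" using Suc pos by (intro mult_right_mono) auto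
    also have "\<dots> \<le> p (Suc (Suc n)) * p n" using lc[of n] by (simp add: power2_eq_square)
    finally have "p n * (\<rho> * p (Suc n)) \<le> p n * p (Suc (Suc n))" by (simp add: algebra_simps)
    then show ?case using Suc pos by simp
  qed
  have lower: "p (Suc n) \<ge> \<rho> ^ n * p 1" for n
  proof (induction n)
    case (Suc n)
    have "\<rho> * (\<rho> ^ n * p 1) \<le> \<rho> * p (Suc n)" using Suc \<rho>0 by (intro mult_left_mono) auto
    then show ?case using st[of "Suc n"] by (simp add: mult.assoc)
  qed auto
  show False
  proof (cases "\<mu> = 0")
    \<comment> \<open>Division by \<mu> is impossible here; instead \<open>p 2 \<le> 0\<close>
      contradicts positivity.\<close>
    case True
    then show False using gr[of 1] st[of 2] by (simp add: numeral_2_eq_2)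
  next
    case False
    then have \<mu>0: "\<mu> > 0" using \<mu> by simp
    obtain n where n: "(\<rho> / \<mu>) ^ n > L / p 1"
      using real_arch_pow[of "\<rho> / \<mu>"] \<rho> \<mu>0 by auto
    have "\<rho> ^ n * p 1 \<le> L * \<mu> ^ n" using lower[of n] gr[of n] by linarith
    then have "(\<rho> / \<mu>) ^ n \<le> L / p 1" using \<mu>0 p1 by (simp add: field_simps)
    then show False using n by simp
  qed
qed

section \<open>Bounded operators that are symmetric for the bilinear pairing\<close>

definition ip :: "(real \<Rightarrow> complex) \<Rightarrow> (real \<Rightarrow> complex) \<Rightarrow> complex" where
  "ip f g = (LINT r|halfline. f r * cnj (g r))"

lemma ip_self: "f \<in> L2 \<Longrightarrow> ip f f = of_real ((nrm f)\<^sup>2)"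
  unfolding ip_def nrm_sq complex_norm_square[symmetric] by (rule integral_of_real[OF L2_integrable])

lemma ip_le: "f \<in> L2 \<Longrightarrow> g \<in> L2 \<Longrightarrow> cmod (ip f g) \<le> nrm f * nrm g"
  unfolding ip_def using Cauchy_Schwarz_L2_norm[OF _ L2_cnj] by simp

lemma ip_cnj: "ip g f = cnj (ip f g)"
  unfolding ip_def using Bochner_Integration.integral_cnj[of halfline "\<lambda>r. f r * cnj (g r)"] by (simp add: mult.commute)

text \<open>Only norms and integrals of \<open>T f\<close> enter, so the axioms tolerate the
  arbitrary representatives picked by \<open>resolvent\<close>, for which linearity would hold only
  up to null sets.\<close>

locale symmetric_operator =
  fixes T :: "(real \<Rightarrow> complex) \<Rightarrow> (real \<Rightarrow> complex)" and K0 :: real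
  assumes T_L2: "f \<in> L2 \<Longrightarrow> T f \<in> L2"
    and T_bounded: "f \<in> L2 \<Longrightarrow> nrm (T f) \<le> K0 * nrm f"
    and T_symmetric: "f \<in> L2 \<Longrightarrow> g \<in> L2 \<Longrightarrow> (LINT r|halfline. T f r * g r) = (LINT r|halfline. f r * T g r)"
    and K0_nonneg: "K0 \<ge> 0"
begin

definition sandwich :: "(real \<Rightarrow> real) \<Rightarrow> (real \<Rightarrow> real) \<Rightarrow> (real \<Rightarrow> complex) \<Rightarrow> (real \<Rightarrow> complex)" where
  "sandwich a b f = (\<lambda>r. of_real (a r) * T (\<lambda>r. of_real (b r) * f r) r)"

definition sandwich_le :: "(real \<Rightarrow> real) \<Rightarrow> (real \<Rightarrow> real) \<Rightarrow> real \<Rightarrow> bool" where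
  "sandwich_le a b N \<longleftrightarrow> (\<forall>f\<in>L2. nrm (sandwich a b f) \<le> N * nrm f)"

end

text \<open>Products depend on the sum of the parameters only, as for geometric means of
  \<open>c 0\<close> and \<open>c 1\<close>. In this form no division by weights occurs, so weights
  may vanish where the potential does.\<close>

locale weight_family = symmetric_operator +
  fixes c :: "real \<Rightarrow> real \<Rightarrow> real" and B :: real
  assumes c_measurable: "s \<in> {0..1} \<Longrightarrow> c s \<in> borel_measurable halfline"
    and c_bounded: "s \<in> {0..1} \<Longrightarrow> r > 0 \<Longrightarrow> \<bar>c s r\<bar> \<le> B"
    and c_mult: "s \<in> {0..1} \<Longrightarrow> t \<in> {0..1} \<Longrightarrow> s' \<in> {0..1} \<Longrightarrow> t' \<in> {0..1} \<Longrightarrow> s + t = s' + t'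
      \<Longrightarrow> c s r * c t r = c s' r * c t' r"
begin

lemma B_nonneg: "B \<ge> 0"
  using c_bounded[of 0 1] by auto

lemma c_L2:
  assumes "s \<in> {0..1}" "f \<in> L2" shows "(\<lambda>r. of_real (c s r) * f r) \<in> L2" "nrm (\<lambda>r. of_real (c s r) * f r) \<le> B * nrm f"
proof -
  have m: "(\<lambda>r. complex_of_real (c s r)) \<in> borel_measurable halfline" using c_measurable[OF assms(1)] by measurable
  show "(\<lambda>r. of_real (c s r) * f r) \<in> L2"
    by (rule L2_bounded_mult[OF assms(2) m, of B]) (use c_bounded[OF assms(1)] in auto)
  show "nrm (\<lambda>r. of_real (c s r) * f r) \<le> B * nrm f"
    by (rule nrm_bounded_mult[OF assms(2) m, of B]) (use c_bounded[OF assms(1)] B_nonneg in auto)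
qed

lemma sandwich_L2:
  assumes "s \<in> {0..1}" "t \<in> {0..1}" "f \<in> L2"
  shows "sandwich (c s) (c t) f \<in> L2" "nrm (sandwich (c s) (c t) f) \<le> B * (K0 * B) * nrm f"
proof -
  note L = c_L2[OF assms(2,3)]
  show "sandwich (c s) (c t) f \<in> L2" unfolding sandwich_def by (intro c_L2 assms T_L2)
  have "nrm (sandwich (c s) (c t) f) \<le> B * nrm (T (\<lambda>r. of_real (c t r) * f r))"
    unfolding sandwich_def by (intro c_L2 assms T_L2)
  also have "\<dots> \<le> B * (K0 * (B * nrm f))"
    by (intro mult_left_mono order_trans[OF T_bounded[OF L(1)]] L B_nonneg K0_nonneg)
  finally show "nrm (sandwich (c s) (c t) f) \<le> B * (K0 * B) * nrm f" by (simp add: mult.assoc)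
qed

lemma sandwich_transpose:
  assumes "s \<in> {0..1}" "t \<in> {0..1}" "f \<in> L2" "g \<in> L2"
  shows "(LINT r|halfline. sandwich (c s) (c t) f r * g r) = (LINT r|halfline. f r * sandwich (c t) (c s) g r)"
proof -
  have "(LINT r|halfline. sandwich (c s) (c t) f r * g r)
      = (LINT r|halfline. T (\<lambda>r. of_real (c t r) * f r) r * (of_real (c s r) * g r))"
    unfolding sandwich_def by (intro Bochner_Integration.integral_cong) auto
  also have "\<dots> = (LINT r|halfline. of_real (c t r) * f r * T (\<lambda>r. of_real (c s r) * g r) r)"
    by (intro T_symmetric c_L2 assms)
  also have "\<dots> = (LINT r|halfline. f r * sandwich (c t) (c s) g r)"
    unfolding sandwich_def by (intro Bochner_Integration.integral_cong) auto
  finally show ?thesis .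
qed

text \<open>Pairing \<open>x\<close> with its own conjugate moves the operator onto
  \<open>cnj x\<close>, which has the norm of \<open>x\<close>; one factor \<open>nrm x\<close>
  cancels.\<close>

lemma sandwich_le_transpose:
  assumes "s \<in> {0..1}" "t \<in> {0..1}" "sandwich_le (c s) (c t) N" "N \<ge> 0"
  shows "sandwich_le (c t) (c s) N"
  unfolding sandwich_le_def
proof
  fix g assume g: "g \<in> L2"
  define x where "x = sandwich (c t) (c s) g"
  have x: "x \<in> L2" unfolding x_def by (intro sandwich_L2 assms g)
  have "of_real ((nrm x)\<^sup>2) = (LINT r|halfline. x r * cnj (x r))" using ip_self[OF x] by (simp add: ip_def)
  also have "\<dots> = (LINT r|halfline. g r * sandwich (c s) (c t) (\<lambda>r. cnj (x r)) r)"
    by (subst (1) x_def) (intro sandwich_transpose assms g L2_cnj x)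
  finally have "(nrm x)\<^sup>2 = cmod (LINT r|halfline. g r * sandwich (c s) (c t) (\<lambda>r. cnj (x r)) r)"
    by (metis norm_of_real abs_of_nonneg zero_le_power2)
  also have "\<dots> \<le> nrm g * nrm (sandwich (c s) (c t) (\<lambda>r. cnj (x r)))"
    by (intro Cauchy_Schwarz_L2_norm sandwich_L2 assms g L2_cnj x)
  also have "\<dots> \<le> nrm g * (N * nrm (\<lambda>r. cnj (x r)))"
    using assms(3) L2_cnj[OF x] unfolding sandwich_le_def by (intro mult_left_mono) auto
  finally have *: "nrm x * nrm x \<le> nrm x * (N * nrm g)" by (simp add: power2_eq_square algebra_simps)
  show "nrm (sandwich (c t) (c s) g) \<le> N * nrm g"
  proof (cases "nrm x = 0")
    case True then show ?thesis using assms(4) by (simp add: x_def)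
  next
    case False
    then have "nrm x > 0" using nrm_nonneg[of x] by linarith
    then show ?thesis using * unfolding x_def by simp
  qed
qed

text \<open>With \<open>S = c\<^sub>\<theta> T c\<^sub>1\<^sub>-\<^sub>\<theta>\<close>, the powers of \<open>S\<^sup>*S\<close> are, up to bounded factors on both ends,
  powers of a product of \<open>c\<^sub>2\<^sub>\<theta> T c\<^sub>1\<^sub>-\<^sub>2\<^sub>\<theta>\<close> and the adjoint of \<open>c\<^sub>0 T c\<^sub>1\<close>; the norm of the
  self-adjoint \<open>S\<^sup>*S\<close> is its spectral radius.\<close>

lemma sandwich_midpoint:
  assumes \<theta>: "\<theta> \<in> {0..1/2}" and M: "sandwich_le (c 1) (c 0) M" "M \<ge> 0"
    and N: "sandwich_le (c (2 * \<theta>)) (c (1 - 2 * \<theta>)) N" "N \<ge> 0"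
  shows "sandwich_le (c \<theta>) (c (1 - \<theta>)) (sqrt (M * N))"
  unfolding sandwich_le_def
proof
  fix f assume f: "f \<in> L2"
  have th: "\<theta> \<in> {0..1}" "1 - \<theta> \<in> {0..1}" "2 * \<theta> \<in> {0..1}" "1 - 2 * \<theta> \<in> {0..1}" "0 \<in> {0..1::real}" "1 \<in> {0..1::real}"
    using \<theta> by auto
  define S where "S = sandwich (c \<theta>) (c (1 - \<theta>))"
  \<comment> \<open>The Hilbert adjoint of \<open>S\<close>: transposition exchanges the two
    weights, and conjugation before and after turns the bilinear pairing into the inner
    product.\<close>
  define S' where "S' = (\<lambda>g r. cnj (sandwich (c (1 - \<theta>)) (c \<theta>) (\<lambda>r. cnj (g r)) r))"
  define X where "X = (\<lambda>g r. cnj (sandwich (c (1 - \<theta>)) (c 0) (\<lambda>r. cnj (g r)) r))"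
  define Y where "Y = sandwich (c (2 * \<theta>)) (c (1 - \<theta>))"
  have SL: "S g \<in> L2" "S' g \<in> L2" "X g \<in> L2" "Y g \<in> L2" if "g \<in> L2" for g
    unfolding S_def S'_def X_def Y_def using that th by (auto intro!: sandwich_L2 L2_cnj)
  have adj: "ip g (S' h) = ip (S g) h" if "g \<in> L2" "h \<in> L2" for g h
    unfolding ip_def S_def S'_def using sandwich_transpose[OF th(1,2) that(1) L2_cnj[OF that(2)]] by simp
  \<comment> \<open>The two weights meeting in the middle multiply to
    \<open>c 0 * c (2 * \<theta>)\<close>; since they are real they commute with conjugation and can
    be redistributed.\<close>
  have SX: "S' (S g) = X (Y g)" for g
  proof
    fix r
    have eq: "of_real (c \<theta> r) * cnj (of_real (c \<theta> r) * t r) = complex_of_real (c 0 r) * cnj (of_real (c (2 * \<theta>) r) * t r)" for r t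
    proof -
      have "c \<theta> r * c \<theta> r = c 0 r * c (2 * \<theta>) r" by (rule c_mult) (use th in auto)
      then have "complex_of_real (c \<theta> r) * of_real (c \<theta> r) = of_real (c 0 r) * of_real (c (2 * \<theta>) r)"
        by (metis of_real_mult)
      then show ?thesis by (simp add: mult.assoc[symmetric])
    qed
    show "S' (S g) r = X (Y g) r" unfolding S_def S'_def X_def Y_def sandwich_def eq by (rule refl)
  qed
  \<comment> \<open>In the opposite order the middle weights are \<open>c (1 - \<theta>)\<close>
    twice, that is \<open>c (1 - 2 * \<theta>) * c 1\<close>, and both factors become operators with
    the known bounds \<open>N\<close> and \<open>M\<close>.\<close>
  have YX: "nrm (Y (X g)) \<le> M * N * nrm g" if g: "g \<in> L2" for g
  proof -
    define h where "h = (\<lambda>r. cnj (sandwich (c 1) (c 0) (\<lambda>r. cnj (g r)) r))"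
    have h: "h \<in> L2" unfolding h_def using g th by (auto intro!: sandwich_L2 L2_cnj)
    have eq: "of_real (c (1 - \<theta>) r) * cnj (of_real (c (1 - \<theta>) r) * t r) = complex_of_real (c (1 - 2 * \<theta>) r) * cnj (of_real (c 1 r) * t r)" for r t
    proof -
      have "c (1 - \<theta>) r * c (1 - \<theta>) r = c (1 - 2 * \<theta>) r * c 1 r" by (rule c_mult) (use th in auto)
      then have "complex_of_real (c (1 - \<theta>) r) * of_real (c (1 - \<theta>) r) = of_real (c (1 - 2 * \<theta>) r) * of_real (c 1 r)"
        by (metis of_real_mult)
      then show ?thesis by (simp add: mult.assoc[symmetric])
    qed
    have "Y (X g) = sandwich (c (2 * \<theta>)) (c (1 - 2 * \<theta>)) h"
      unfolding X_def Y_def h_def sandwich_def eq by (rule refl)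
    then have "nrm (Y (X g)) \<le> N * nrm h" using N(1) h unfolding sandwich_le_def by simp
    also have "\<dots> \<le> N * (M * nrm g)"
    proof (rule mult_left_mono)
      have "nrm h = nrm (sandwich (c 1) (c 0) (\<lambda>r. cnj (g r)))" unfolding h_def by simp
      also have "\<dots> \<le> M * nrm (\<lambda>r. cnj (g r))" using M(1) L2_cnj[OF g] unfolding sandwich_le_def by blast
      finally show "nrm h \<le> M * nrm g" by simp
    qed (rule N)
    finally show ?thesis by (simp add: algebra_simps)
  qed
  define P where "P = (\<lambda>n. ((\<lambda>g. S' (S g)) ^^ n) f)"
  have P0: "P 0 = f" and PS: "P (Suc n) = S' (S (P n))" for n unfolding P_def by auto
  have PL: "P n \<in> L2" for n by (induction n) (auto simp: P0 PS f SL)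
  \<comment> \<open>Self-adjointness: the squared norm of an iterate is the inner product of its two
    neighbours.\<close>
  have lc: "(nrm (P (Suc n)))\<^sup>2 \<le> nrm (P (Suc (Suc n))) * nrm (P n)" for n
  proof -
    have "complex_of_real ((nrm (P (Suc n)))\<^sup>2) = ip (P (Suc n)) (S' (S (P n)))" using ip_self[OF PL[of "Suc n"]] PS by simp
    also have "\<dots> = ip (S (P (Suc n))) (S (P n))" by (rule adj[OF PL SL(1)[OF PL]])
    also have "\<dots> = cnj (ip (S (P n)) (S (P (Suc n))))" by (rule ip_cnj)
    also have "\<dots> = cnj (ip (P n) (P (Suc (Suc n))))" using adj[OF PL SL(1)[OF PL], of n "Suc n"] PS[of "Suc n"] by simp
    finally have "(nrm (P (Suc n)))\<^sup>2 = cmod (ip (P n) (P (Suc (Suc n))))"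
      by (metis norm_of_real abs_of_nonneg zero_le_power2 complex_mod_cnj)
    then show ?thesis using ip_le[OF PL PL, of n "Suc (Suc n)"] by (simp add: mult.commute)
  qed
  \<comment> \<open>Each \<open>P (Suc n)\<close> is \<open>X (Q n)\<close>, so the outer operators
    enter once; their size affects the prefactor and not the growth rate
    \<open>M * N\<close>.\<close>
  define Q where "Q = (\<lambda>n. ((\<lambda>g. Y (X g)) ^^ n) (Y f))"
  have Q: "Q n \<in> L2 \<and> nrm (Q n) \<le> (M * N) ^ n * nrm (Y f)" for n
  proof (induction n)
    case 0 then show ?case by (simp add: Q_def SL f)
  next
    case (Suc n)
    have QS: "Q (Suc n) = Y (X (Q n))" by (simp add: Q_def)
    have "nrm (Q (Suc n)) \<le> M * N * nrm (Q n)" unfolding QS using YX Suc by blast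
    also have "\<dots> \<le> M * N * ((M * N) ^ n * nrm (Y f))" using Suc M N by (intro mult_left_mono) auto
    finally show ?case unfolding QS using Suc by (auto simp: SL)
  qed
  have PQ: "P (Suc n) = X (Q n)" for n
    by (induction n) (auto simp: PS P0 SX Q_def)
  have gr: "nrm (P (Suc n)) \<le> (B * (K0 * B) * nrm (Y f)) * (M * N) ^ n" for n
  proof -
    have "nrm (X (Q n)) = nrm (sandwich (c (1 - \<theta>)) (c 0) (\<lambda>r. cnj (Q n r)))" unfolding X_def by simp
    also have "\<dots> \<le> B * (K0 * B) * nrm (\<lambda>r. cnj (Q n r))"
      by (rule sandwich_L2) (use th Q L2_cnj in auto)
    also have "\<dots> \<le> B * (K0 * B) * ((M * N) ^ n * nrm (Y f))"
      using Q B_nonneg K0_nonneg by (intro mult_left_mono) auto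
    finally show ?thesis unfolding PQ by (simp add: algebra_simps)
  qed
  have "nrm (P 1) \<le> M * N * nrm (P 0)"
    by (rule log_convex_geometric_bound[of "\<lambda>n. nrm (P n)", OF _ lc gr]) (use M N in auto)
  then have P1: "nrm (P (Suc 0)) \<le> M * N * nrm f" by (simp add: P0)
  have "complex_of_real ((nrm (S f))\<^sup>2) = ip f (P (Suc 0))"
    using ip_self[OF SL(1)[OF f]] adj[OF f SL(1)[OF f]] PS[of 0] P0 by simp
  then have "(nrm (S f))\<^sup>2 = cmod (ip f (P (Suc 0)))"
    by (metis norm_of_real abs_of_nonneg zero_le_power2)
  also have "\<dots> \<le> nrm f * (M * N * nrm f)"
    by (rule order_trans[OF ip_le[OF f PL]]) (intro mult_left_mono P1, auto)
  finally have "(nrm (S f))\<^sup>2 \<le> (sqrt (M * N) * nrm f)\<^sup>2"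
    using M N by (simp add: power_mult_distrib) (simp add: power2_eq_square algebra_simps)
  then show "nrm (sandwich (c \<theta>) (c (1 - \<theta>)) f) \<le> sqrt (M * N) * nrm f"
    unfolding S_def by (rule power2_le_imp_le) (use M N in simp)
qed

text \<open>One constant \<open>N\<close> for all parameters at once closes the recursion:
  \<open>sandwich_midpoint\<close> covers [0,1/2] because 2\<theta> stays in [0,1], transposition
  covers the rest, and so N \<le> sqrt (M N), which forces N \<le> M.\<close>

theorem sandwich_interpolation:
  assumes M: "sandwich_le (c 1) (c 0) M" "M \<ge> 0" and \<theta>: "\<theta> \<in> {0..1}"
  shows "sandwich_le (c \<theta>) (c (1 - \<theta>)) M"
proof -
  define A where "A = {N. N \<ge> 0 \<and> (\<forall>\<theta>\<in>{0..1}. sandwich_le (c \<theta>) (c (1 - \<theta>)) N)}"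
  \<comment> \<open>A finite constant exists beforehand since operator and weights are bounded; the
    final cancellation of \<open>N\<close> relies on it.\<close>
  have ne: "B * (K0 * B) \<in> A"
    unfolding A_def sandwich_le_def using B_nonneg K0_nonneg by (auto intro!: sandwich_L2)
  have bdd: "bdd_below A" unfolding A_def by (auto intro!: bdd_belowI[of _ 0])
  define N where "N = Inf A"
  have N0: "N \<ge> 0" unfolding N_def by (rule cInf_greatest) (use ne in \<open>auto simp: A_def\<close>)
  \<comment> \<open>The infimum is itself admissible, because the inequality for a fixed
    \<open>f\<close> survives limits of the constant.\<close>
  have NA: "sandwich_le (c t) (c (1 - t)) N" if t: "t \<in> {0..1}" for t
    unfolding sandwich_le_def
  proof
    fix f assume f: "f \<in> L2"
    have le: "nrm (sandwich (c t) (c (1 - t)) f) \<le> N' * nrm f" if "N' \<in> A" for N'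
      using that t f unfolding A_def sandwich_le_def by blast
    show "nrm (sandwich (c t) (c (1 - t)) f) \<le> N * nrm f"
    proof (cases "nrm f = 0")
      case True then show ?thesis using le[OF ne] by simp
    next
      case False
      then have pos: "nrm f > 0" using nrm_nonneg[of f] by linarith
      have "nrm (sandwich (c t) (c (1 - t)) f) / nrm f \<le> N"
        unfolding N_def by (rule cInf_greatest) (use ne le pos in \<open>auto simp: pos_divide_le_eq\<close>)
      then show ?thesis using pos by (simp add: pos_divide_le_eq)
    qed
  qed
  have half: "sandwich_le (c t) (c (1 - t)) (sqrt (M * N))" if "t \<in> {0..1/2}" for t
  proof (rule sandwich_midpoint[OF that M _ N0])
    show "sandwich_le (c (2 * t)) (c (1 - 2 * t)) N" by (rule NA) (use that in auto)
  qed
  have "sqrt (M * N) \<in> A"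
    unfolding A_def
  proof (intro CollectI conjI ballI)
    fix t :: real assume t: "t \<in> {0..1}"
    show "sandwich_le (c t) (c (1 - t)) (sqrt (M * N))"
    proof (cases "t \<le> 1/2")
      \<comment> \<open>Parameters above 1/2 are reflected: the transpose exchanges \<open>t\<close>
        and \<open>1 - t\<close>.\<close>
      case False
      have "sandwich_le (c (1 - t)) (c (1 - (1 - t))) (sqrt (M * N))" by (rule half) (use False t in auto)
      then show ?thesis using sandwich_le_transpose[of "1 - t" t "sqrt (M * N)"] t M N0 by simp
    qed (use half t in auto)
  qed (use M N0 in auto)
  then have "N \<le> sqrt (M * N)" unfolding N_def using bdd by (auto intro: cInf_lower)
  then have "N\<^sup>2 \<le> (sqrt (M * N))\<^sup>2" using N0 by (intro power_mono) auto
  then have "N * N \<le> M * N" using M N0 by (simp add: power2_eq_square)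
  then have "N \<le> M" using N0 M(2) by (cases "N = 0") (auto simp: mult_le_cancel_right)
  then show ?thesis
    using NA[OF \<theta>] unfolding sandwich_le_def by (meson mult_right_mono nrm_nonneg order_trans)
qed

end

section \<open>Existence of solutions\<close>

text \<open>Integrating the differential inequality for |g|^2 leaves one boundary term. The sign
  \<sigma> is the direction of the argument: with 1 a bound at the far end \<open>R\<close> is
  needed, with -1 a bound at 0.\<close>

lemma L2_dissipative:
  assumes g: "AC g g'" and h: "integrable halfline h" "\<And>r. r > 0 \<Longrightarrow> h r \<ge> 0" and b: "b > 0"
    and le: "\<And>r. r \<ge> 0 \<Longrightarrow> b * (cmod (g r))\<^sup>2 \<le> \<sigma> * (2 * Re (g' r * cnj (g r))) + h r"
    and D: "\<And>R. R > 0 \<Longrightarrow> \<sigma> * ((cmod (g R))\<^sup>2 - (cmod (g 0))\<^sup>2) \<le> D"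
  shows "g \<in> L2"
proof (rule L2_I_continuous[OF AC_continuous[OF g]])
  fix R :: real assume R: "R > 0"
  have cg: "continuous_on {0..R} (\<lambda>r. (cmod (g r))\<^sup>2)"
    by (intro continuous_intros continuous_on_subset[OF AC_continuous[OF g]]) auto
  have "((\<lambda>r. Re (g' r * cnj (g r) + g r * cnj (g' r))) has_integral Re (g R * cnj (g R) - g 0 * cnj (g 0))) {0..R}"
    using has_integral_linear[OF AC_has_integral[OF AC_mult[OF g AC_cnj[OF g]]] bounded_linear_Re, of R] R
    by (simp add: o_def)
  then have "((\<lambda>r. 2 * Re (g' r * cnj (g r))) has_integral ((cmod (g R))\<^sup>2 - (cmod (g 0))\<^sup>2)) {0..R}"
    unfolding cmod_power2 by (simp add: power2_eq_square mult.commute)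
  from has_integral_mult_right[OF this, of \<sigma>]
  have 1: "((\<lambda>r. \<sigma> * (2 * Re (g' r * cnj (g r)))) has_integral \<sigma> * ((cmod (g R))\<^sup>2 - (cmod (g 0))\<^sup>2)) {0..R}" .
  have hi: "h integrable_on {0..R}"
    using halfline_integrable_imp_abs[OF h(1)] by (simp add: absolutely_integrable_on_def)
  have "integral {0..R} (\<lambda>r. b * (cmod (g r))\<^sup>2) \<le> \<sigma> * ((cmod (g R))\<^sup>2 - (cmod (g 0))\<^sup>2) + integral {0..R} h"
  proof (rule has_integral_le[OF integrable_integral has_integral_add[OF 1 integrable_integral[OF hi]]])
    show "(\<lambda>r. b * (cmod (g r))\<^sup>2) integrable_on {0..R}"
      by (intro integrable_continuous_real continuous_intros cg)
  qed (use le in auto)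
  also have "\<dots> \<le> D + (LINT r|halfline. h r)"
    using D[OF R] halfline_integral_Icc_le[OF h] by (intro add_mono) auto
  finally show "integral {0..R} (\<lambda>r. (cmod (g r))\<^sup>2) \<le> (D + (LINT r|halfline. h r)) / b"
    using b by (simp add: field_simps)
qed

lemma two_Re_le: "b > 0 \<Longrightarrow> \<bar>2 * Re (x * cnj y)\<bar> \<le> (cmod x)\<^sup>2 / b + b * (cmod y)\<^sup>2"
proof -
  assume b: "b > 0"
  have "\<bar>2 * Re (x * cnj y)\<bar> \<le> 2 * (cmod x * cmod y)"
    using abs_Re_le_cmod[of "x * cnj y"] by (simp add: norm_mult)
  also have "\<dots> = 2 * (cmod x / sqrt b) * (sqrt b * cmod y)" using b by simp
  also have "\<dots> \<le> (cmod x / sqrt b)\<^sup>2 + (sqrt b * cmod y)\<^sup>2" by (rule sum_squares_bound)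
  finally show ?thesis using b by (simp add: power_divide power_mult_distrib)
qed

lemma AC_exp: "AC (\<lambda>r. exp (c * of_real r)) (\<lambda>r. c * exp (c * of_real r))"
proof (rule AC_C1)
  fix x :: real
  have "((\<lambda>z. exp (c * z)) has_field_derivative c * exp (c * of_real x)) (at (of_real x))"
    by (auto intro!: derivative_eq_intros)
  from has_vector_derivative_real_field[OF this]
  show "((\<lambda>r. exp (c * of_real r)) has_vector_derivative c * exp (c * of_real x)) (at x within {0..})"
    by (rule has_vector_derivative_at_within)
qed (intro continuous_intros)

lemma AC_integral:
  assumes "\<And>r. f absolutely_integrable_on {0..r}"
  shows "AC (\<lambda>r. integral {0..r} f) f"
  by (rule AC_I) (use assms in auto)

text \<open>The operator factors: \<open>y' = -ik y - f\<close> is solved from infinity and \<open>u' = ik u + y\<close> from \<open>0\<close>.\<close>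

lemma solves_free:
  assumes k: "Im k > 0" and f: "f \<in> L2"
  shows "\<exists>u p. solves (\<lambda>_. 0) (k\<^sup>2) f u p"
proof -
  define b where "b = Im k"
  have b: "b > 0" using k by (simp add: b_def)
  define e where "e = (\<lambda>r::real. exp (\<i> * k * of_real r))"
  define e' where "e' = (\<lambda>r::real. exp ((- (\<i> * k)) * of_real r))"
  have ne: "cmod (e r) = exp (- b * r)" "cmod (e' r) = exp (b * r)" for r
    unfolding e_def e'_def b_def by (simp_all add: norm_exp_eq_Re)
  have ee: "e' r * e r = 1" "e r * e' r = 1" for r unfolding e_def e'_def by (simp_all add: exp_add[symmetric])
  have ce: "continuous_on S e" "continuous_on S e'" for S unfolding e_def e'_def by (intro continuous_intros)+
  have fa: "f absolutely_integrable_on {0..r}" for r by (rule L2_absolutely_integrable[OF f])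
  have efa: "(\<lambda>r. e r * f r) absolutely_integrable_on {0..r}" for r
    by (rule absolutely_integrable_continuous_mult[OF fa ce(1)])
  define F where "F = (\<lambda>r. integral {0..r} (\<lambda>r. e r * f r))"
  have ACF: "AC F (\<lambda>r. e r * f r)" unfolding F_def by (rule AC_integral[OF efa])
  have expint: "((\<lambda>s. exp (- 2 * b * (s - R))) has_integral ((1 - exp (- 2 * b * (S - R))) / (2 * b))) {R..S}" if "R \<le> S" for R S
  proof -
    have "((\<lambda>s. exp (- 2 * b * (s - R))) has_integral ((- exp (- 2 * b * (S - R)) / (2 * b)) - (- exp (- 2 * b * (R - R)) / (2 * b)))) {R..S}"
      by (rule fundamental_theorem_of_calculus[OF that])
        (use b in \<open>auto intro!: derivative_eq_intros simp: has_real_derivative_iff_has_vector_derivative[symmetric] field_simps\<close>)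
    then show ?thesis using b by (simp add: field_simps)
  qed
  have eL: "e \<in> L2"
  proof (rule L2_I_continuous[OF ce(1), of "1 / (2 * b)"])
    fix R :: real assume R: "R > 0"
    have "(cmod (e r))\<^sup>2 = exp (- 2 * b * (r - 0))" for r unfolding ne by (simp add: power2_eq_square exp_add[symmetric])
    then have "((\<lambda>r. (cmod (e r))\<^sup>2) has_integral ((1 - exp (- 2 * b * (R - 0))) / (2 * b))) {0..R}"
      using expint[of 0 R] R by simp
    then show "integral {0..R} (\<lambda>r. (cmod (e r))\<^sup>2) \<le> 1 / (2 * b)"
      using b by (simp add: integral_unique divide_right_mono)
  qed
  have iJ: "integrable halfline (\<lambda>r. e r * f r)" by (rule L2_prod_integrable[OF eL f])
  define J where "J = (LINT r|halfline. e r * f r)"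
  have limF: "(F \<longlongrightarrow> J) at_top" unfolding F_def J_def by (rule halfline_integral_tendsto[OF iJ])
  \<comment> \<open>This is \<open>e' r\<close> times the integral of \<open>e * f\<close> from r to
    infinity; starting from infinity cancels the growth of \<open>e'\<close>.\<close>
  define y where "y = (\<lambda>r. e' r * (J - F r))"
  have ACe': "AC e' (\<lambda>r. - (\<i> * k) * e' r)" unfolding e'_def by (rule AC_exp)
  have ACe: "AC e (\<lambda>r. \<i> * k * e r)" unfolding e_def by (rule AC_exp)
  have "AC y (\<lambda>r. - (\<i> * k) * e' r * (J - F r) + e' r * (0 - e r * f r))"
    unfolding y_def by (intro AC_mult ACe' AC_diff AC_const ACF)
  then have ACy: "AC y (\<lambda>r. - (\<i> * k) * y r - f r)"
  proof (rule AC_cong)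
    fix r
    have "e' r * (e r * f r) = f r" using ee(1)[of r] by (simp add: mult.assoc[symmetric])
    then show "- (\<i> * k) * e' r * (J - F r) + e' r * (0 - e r * f r) = - (\<i> * k) * y r - f r" unfolding y_def by simp
  qed simp
  define D where "D = (1 / (2 * b) + (nrm f)\<^sup>2) / 2"
  have f2: "(\<lambda>r. (cmod (f r))\<^sup>2) absolutely_integrable_on {0..S}" for S
    by (rule halfline_integrable_imp_abs[OF L2_integrable[OF f]])
  \<comment> \<open>Uniform bound through finite \<open>S\<close>: the two exponentials combine to
    exp (- b (s - R)), and 2xy \<le> x^2 + y^2 separates it from \<open>f\<close>.\<close>
  have yD: "cmod (y R) \<le> D" if R: "R \<ge> 0" for R
  proof -
    have *: "cmod (e' R * (F S - F R)) \<le> D" if S: "S > R" for S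
    proof -
      have "F S - F R = integral {R..S} (\<lambda>r. e r * f r)"
      proof -
        have "(\<lambda>r. e r * f r) integrable_on {0..S}" using efa[of S] by (simp add: absolutely_integrable_on_def)
        then have "F R + integral {R..S} (\<lambda>r. e r * f r) = F S"
          unfolding F_def using R S by (intro Henstock_Kurzweil_Integration.integral_combine) auto
        then show ?thesis by (simp add: algebra_simps)
      qed
      then have "e' R * (F S - F R) = integral {R..S} (\<lambda>r. e' R * (e r * f r))" by simp
      also have "cmod \<dots> \<le> integral {R..S} (\<lambda>s. (exp (- 2 * b * (s - R)) + (cmod (f s))\<^sup>2) / 2)"
      proof (rule integral_norm_bound_integral)
        have "(\<lambda>r. e r * f r) integrable_on {R..S}"
          using efa[of S] R S by (auto simp: absolutely_integrable_on_def intro: integrable_on_subinterval)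
        then show "(\<lambda>r. e' R * (e r * f r)) integrable_on {R..S}" by (rule integrable_on_mult_right)
        have "(\<lambda>s. (cmod (f s))\<^sup>2) integrable_on {R..S}"
          using f2[of S] R S by (auto simp: absolutely_integrable_on_def intro: integrable_on_subinterval)
        moreover have "(\<lambda>s. exp (- 2 * b * (s - R))) integrable_on {R..S}"
          using expint[of R S] S by (auto simp: integrable_on_def)
        ultimately show "(\<lambda>s. (exp (- 2 * b * (s - R)) + (cmod (f s))\<^sup>2) / 2) integrable_on {R..S}"
          by (intro integrable_on_divide integrable_add)
        fix s
        have "cmod (e' R * (e s * f s)) = exp (- b * (s - R)) * cmod (f s)"
          by (simp add: norm_mult ne exp_add[symmetric] algebra_simps)
        also have "\<dots> \<le> (exp (- b * (s - R)) ^ 2 + (cmod (f s))\<^sup>2) / 2"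
          using sum_squares_bound[of "exp (- b * (s - R))" "cmod (f s)"] by simp
        also have "exp (- b * (s - R)) ^ 2 = exp (- 2 * b * (s - R))"
          by (simp add: power2_eq_square exp_add[symmetric])
        finally show "cmod (e' R * (e s * f s)) \<le> (exp (- 2 * b * (s - R)) + (cmod (f s))\<^sup>2) / 2" .
      qed
      also have "\<dots> = (integral {R..S} (\<lambda>s. exp (- 2 * b * (s - R))) + integral {R..S} (\<lambda>s. (cmod (f s))\<^sup>2)) / 2"
      proof -
        have "(\<lambda>s. (cmod (f s))\<^sup>2) integrable_on {R..S}"
          using f2[of S] R S by (auto simp: absolutely_integrable_on_def intro: integrable_on_subinterval)
        moreover have "(\<lambda>s. exp (- 2 * b * (s - R))) integrable_on {R..S}"
          using expint[of R S] S by (auto simp: integrable_on_def)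
        ultimately show ?thesis by (simp add: Henstock_Kurzweil_Integration.integral_add)
      qed
      also have "\<dots> \<le> (1 / (2 * b) + (nrm f)\<^sup>2) / 2"
      proof -
        have "integral {R..S} (\<lambda>s. exp (- 2 * b * (s - R))) \<le> 1 / (2 * b)"
          using integral_unique[OF expint[of R S]] S b by (simp add: divide_right_mono)
        moreover have "integral {R..S} (\<lambda>s. (cmod (f s))\<^sup>2) \<le> integral {0..S} (\<lambda>s. (cmod (f s))\<^sup>2)"
          using f2[of S] R S by (intro integral_subset_le) (auto simp: absolutely_integrable_on_def intro: integrable_on_subinterval)
        moreover have "\<dots> \<le> (nrm f)\<^sup>2"
          unfolding nrm_sq by (rule halfline_integral_Icc_le[OF L2_integrable[OF f]]) auto
        ultimately show ?thesis by simp
      qed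
      finally show ?thesis unfolding D_def .
    qed
    have "((\<lambda>S. cmod (e' R * (F S - F R))) \<longlongrightarrow> cmod (e' R * (J - F R))) at_top"
      by (intro tendsto_intros limF)
    then show ?thesis unfolding y_def
      by (rule tendsto_upperbound) (use * in \<open>auto intro: eventually_mono[OF eventually_gt_at_top[of R]]\<close>)
  qed
  \<comment> \<open>Apart from the source \<open>f\<close>, |y|^2 grows; hence \<sigma> = 1, and the
    uniform bound \<open>D\<close> controls the far end.\<close>
  have yL: "y \<in> L2"
  proof (rule L2_dissipative[OF ACy, of "\<lambda>r. (cmod (f r))\<^sup>2 / b" b 1 "D\<^sup>2"])
    fix r
    have "2 * Re ((- (\<i> * k) * y r - f r) * cnj (y r)) = 2 * b * (cmod (y r))\<^sup>2 - 2 * Re (f r * cnj (y r))"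
      unfolding b_def cmod_power2 by (simp add: power2_eq_square algebra_simps)
    then show "b * (cmod (y r))\<^sup>2 \<le> 1 * (2 * Re ((- (\<i> * k) * y r - f r) * cnj (y r))) + (cmod (f r))\<^sup>2 / b"
      using two_Re_le[OF b, of "f r" "y r"] by linarith
  next
    fix R :: real assume "R > 0"
    then have "(cmod (y R))\<^sup>2 \<le> D\<^sup>2" by (intro power_mono yD) auto
    then show "1 * ((cmod (y R))\<^sup>2 - (cmod (y 0))\<^sup>2) \<le> D\<^sup>2"
      using zero_le_power2[of "cmod (y 0)"] unfolding mult_1 by linarith
  qed (use L2_integrable[OF f] b in auto)
  have cy: "continuous_on {0..r} y" for r by (rule continuous_on_subset[OF AC_continuous[OF ACy]]) auto
  have eya: "(\<lambda>r. e' r * y r) absolutely_integrable_on {0..r}" for r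
    by (intro absolutely_integrable_continuous_real continuous_intros ce cy)
  define u where "u = (\<lambda>r. e r * integral {0..r} (\<lambda>r. e' r * y r))"
  have "AC u (\<lambda>r. \<i> * k * e r * integral {0..r} (\<lambda>r. e' r * y r) + e r * (e' r * y r))"
    unfolding u_def by (intro AC_mult ACe AC_integral eya)
  then have ACu: "AC u (\<lambda>r. \<i> * k * u r + y r)"
  proof (rule AC_cong)
    fix r
    have "e r * (e' r * y r) = y r" using ee(2)[of r] by (simp add: mult.assoc[symmetric])
    then show "\<i> * k * e r * integral {0..r} (\<lambda>r. e' r * y r) + e r * (e' r * y r) = \<i> * k * u r + y r"
      unfolding u_def by simp
  qed simp
  have u0: "u 0 = 0" unfolding u_def by simp
  \<comment> \<open>Apart from the source \<open>y\<close>, |u|^2 decays; hence \<sigma> = -1, and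
    the boundary condition at 0 gives the bound 0.\<close>
  have uL: "u \<in> L2"
  proof (rule L2_dissipative[OF ACu, of "\<lambda>r. (cmod (y r))\<^sup>2 / b" b "-1" 0])
    fix r
    have "2 * Re ((\<i> * k * u r + y r) * cnj (u r)) = - (2 * b * (cmod (u r))\<^sup>2) + 2 * Re (y r * cnj (u r))"
      unfolding b_def cmod_power2 by (simp add: power2_eq_square algebra_simps)
    then show "b * (cmod (u r))\<^sup>2 \<le> -1 * (2 * Re ((\<i> * k * u r + y r) * cnj (u r))) + (cmod (y r))\<^sup>2 / b"
      using two_Re_le[OF b, of "y r" "u r"] by linarith
  qed (use L2_integrable[OF yL] b u0 in auto)
  define p where "p = (\<lambda>r. \<i> * k * u r + y r)"
  have "AC p (\<lambda>r. \<i> * k * (\<i> * k * u r + y r) + (- (\<i> * k) * y r - f r))"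
    unfolding p_def by (intro AC_add AC_cmult ACu ACy)
  then have "AC p (\<lambda>r. (of_real 0 - k\<^sup>2) * u r - f r)"
    by (rule AC_cong) (auto simp: power2_eq_square algebra_simps)
  moreover have "p \<in> L2" unfolding p_def by (intro L2_add L2_cmult uL yL)
  ultimately have "solves (\<lambda>_. 0) (k\<^sup>2) f u p"
    unfolding solves_def using uL u0 ACu p_def by simp
  then show ?thesis by blast
qed

text \<open>The values of |g|^2 at \<open>R\<close> and \<open>S\<close> differ by the integral of 2
  Re (g' cnj g), and |g(S)| is small for some large \<open>S\<close>. This upgrades norm bounds on
  the terms of the Neumann series to uniform bounds, as required for a pointwise sum.\<close>

lemma AC_sup_bound:
  assumes g: "AC g g'" and L: "g \<in> L2" "g' \<in> L2" and R: "R \<ge> 0"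
  shows "(cmod (g R))\<^sup>2 \<le> 2 * (nrm g' * nrm g)"
proof (rule field_le_epsilon)
  fix \<epsilon> :: real assume "\<epsilon> > 0"
  obtain S where S: "S > R" "(cmod (g S))\<^sup>2 < \<epsilon>"
    using integrable_small_value[OF L2_integrable[OF L(1)] \<open>\<epsilon> > 0\<close>, of R] by blast
  have hi: "((\<lambda>r. 2 * Re (g' r * cnj (g r))) has_integral ((cmod (g r'))\<^sup>2 - (cmod (g 0))\<^sup>2)) {0..r'}" if "r' \<ge> 0" for r'
  proof -
    have "((\<lambda>r. Re (g' r * cnj (g r) + g r * cnj (g' r))) has_integral Re (g r' * cnj (g r') - g 0 * cnj (g 0))) {0..r'}"
      using has_integral_linear[OF AC_has_integral[OF AC_mult[OF g AC_cnj[OF g]]] bounded_linear_Re, of r'] that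
      by (simp add: o_def)
    then show ?thesis
      unfolding cmod_power2 by (simp add: power2_eq_square mult.commute)
  qed
  have int: "(\<lambda>r. 2 * Re (g' r * cnj (g r))) integrable_on {0..S}" using hi[of S] S R by (auto simp: integrable_on_def)
  have iG: "(\<lambda>r. 2 * (cmod (g' r) * cmod (g r))) absolutely_integrable_on {0..S}"
    by (rule halfline_integrable_imp_abs) (use L2_prod_integrable(2)[OF L(2,1)] in simp)
  have "integral {R..S} (\<lambda>r. 2 * Re (g' r * cnj (g r))) = (cmod (g S))\<^sup>2 - (cmod (g R))\<^sup>2"
    using Henstock_Kurzweil_Integration.integral_combine[OF R _ int] S integral_unique[OF hi[of R]] integral_unique[OF hi[of S]] R by simp
  moreover have "\<bar>integral {R..S} (\<lambda>r. 2 * Re (g' r * cnj (g r)))\<bar> \<le> integral {R..S} (\<lambda>r. 2 * (cmod (g' r) * cmod (g r)))"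
    unfolding real_norm_def[symmetric]
  proof (rule integral_norm_bound_integral)
    show "(\<lambda>r. 2 * Re (g' r * cnj (g r))) integrable_on {R..S}"
      using int R S by (auto intro: integrable_on_subinterval)
    show "(\<lambda>r. 2 * (cmod (g' r) * cmod (g r))) integrable_on {R..S}"
      using iG R S by (auto simp: absolutely_integrable_on_def intro: integrable_on_subinterval)
    fix r
    show "norm (2 * Re (g' r * cnj (g r))) \<le> 2 * (cmod (g' r) * cmod (g r))"
      using abs_Re_le_cmod[of "g' r * cnj (g r)"] by (simp add: norm_mult)
  qed
  moreover have "integral {R..S} (\<lambda>r. 2 * (cmod (g' r) * cmod (g r))) \<le> integral {0..S} (\<lambda>r. 2 * (cmod (g' r) * cmod (g r)))"
    using iG R S by (intro integral_subset_le) (auto simp: absolutely_integrable_on_def intro: integrable_on_subinterval)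
  moreover have "\<dots> \<le> (LINT r|halfline. 2 * (cmod (g' r) * cmod (g r)))"
    by (rule halfline_integral_Icc_le) (use L2_prod_integrable(2)[OF L(2,1)] in auto)
  moreover have "\<dots> \<le> 2 * (nrm g' * nrm g)" using Cauchy_Schwarz_L2[OF L(2,1)] by simp
  ultimately show "(cmod (g R))\<^sup>2 \<le> 2 * (nrm g' * nrm g) + \<epsilon>" using S by linarith
qed

section \<open>Series with geometrically decreasing terms\<close>

lemma summable_geometric_half:
  assumes "\<And>n. norm (x n :: complex) \<le> A * (1/2) ^ n"
  shows "summable x" "norm (\<Sum>n<N. x n) \<le> 2 * A"
proof -
  have A: "A \<ge> 0" by (rule order_trans[OF norm_ge_zero[of "x 0"]]) (use assms[of 0] in simp)
  have s: "summable (\<lambda>n. A * (1/2::real) ^ n)" by (intro summable_mult summable_geometric) auto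
  show "summable x" by (rule summable_comparison_test'[OF s, of 0]) (use assms in auto)
  have "norm (\<Sum>n<N. x n) \<le> (\<Sum>n<N. A * (1/2) ^ n)" by (rule sum_norm_le) (use assms in auto)
  also have "\<dots> \<le> (\<Sum>n. A * (1/2) ^ n)" by (rule sum_le_suminf[OF s]) (use A in auto)
  also have "\<dots> = 2 * A" by (subst suminf_mult) (auto simp: suminf_geometric summable_geometric)
  finally show "norm (\<Sum>n<N. x n) \<le> 2 * A" .
qed

lemma AC_sum: "(\<And>n. AC (F n) (f n)) \<Longrightarrow> AC (\<lambda>r. \<Sum>n<(N::nat). F n r) (\<lambda>r. \<Sum>n<N. f n r)"
  by (induction N) (auto intro: AC_add AC_const)

text \<open>Dominated convergence on [0,r] with a constant as dominating function, whence the
  uniform bounds on the functions and on their derivatives.\<close>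

lemma AC_suminf:
  assumes AC: "\<And>n. AC (F n) (f n)" and F: "\<And>n r. r \<ge> 0 \<Longrightarrow> cmod (F n r) \<le> A * (1/2) ^ n"
    and f: "\<And>n r. r \<ge> 0 \<Longrightarrow> cmod (f n r) \<le> A' * (1/2) ^ n"
  shows "AC (\<lambda>r. \<Sum>n. F n r) (\<lambda>r. \<Sum>n. f n r)"
proof (rule AC_I)
  fix r :: real assume r: "r \<ge> 0"
  have a: "(\<lambda>r. \<Sum>n<N. f n r) absolutely_integrable_on {0..r}" for N
    by (rule AC_absolutely_integrable[OF AC_sum[OF AC]])
  have lim: "(\<lambda>N. \<Sum>n<N. f n s) \<longlonglongrightarrow> (\<Sum>n. f n s)" if "s \<in> {0..r}" for s
    by (rule summable_LIMSEQ[OF summable_geometric_half(1)]) (use f that in auto)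
  have limF: "(\<lambda>N. \<Sum>n<N. F n s) \<longlonglongrightarrow> (\<Sum>n. F n s)" if "s \<ge> 0" for s
    by (rule summable_LIMSEQ[OF summable_geometric_half(1)]) (use F that in auto)
  have bd: "cmod (\<Sum>n<N. f n s) \<le> 2 * A'" if "s \<in> {0..r}" for N s
    by (rule summable_geometric_half(2)) (use f that in auto)
  have bdl: "cmod (\<Sum>n. f n s) \<le> 2 * A'" if "s \<in> {0..r}" for s
    by (rule tendsto_upperbound[OF tendsto_norm[OF lim[OF that]]]) (use bd that in auto)
  show "(\<lambda>r. \<Sum>n. f n r) absolutely_integrable_on {0..r}"
    by (rule dominated_convergence_absolutely_integrable[OF a _ bdl lim]) auto
  have "(\<lambda>N. integral {0..r} (\<lambda>r. \<Sum>n<N. f n r)) \<longlonglongrightarrow> integral {0..r} (\<lambda>r. \<Sum>n. f n r)"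
    by (rule dominated_convergence(2)[where h = "\<lambda>_. 2 * A'"]) (use a bd lim in \<open>auto simp: absolutely_integrable_on_def\<close>)
  moreover have "integral {0..r} (\<lambda>r. \<Sum>n<N. f n r) = (\<Sum>n<N. F n r) - (\<Sum>n<N. F n 0)" for N
    using AC_eq[OF AC_sum[where N = N, OF AC] r] by simp
  moreover have "(\<lambda>N. (\<Sum>n<N. F n r) - (\<Sum>n<N. F n 0)) \<longlonglongrightarrow> (\<Sum>n. F n r) - (\<Sum>n. F n 0)"
    by (intro tendsto_diff limF) (use r in auto)
  ultimately have "integral {0..r} (\<lambda>r. \<Sum>n. f n r) = (\<Sum>n. F n r) - (\<Sum>n. F n 0)"
    using LIMSEQ_unique by auto
  then show "(\<Sum>n. F n r) = (\<Sum>n. F n 0) + integral {0..r} (\<lambda>r. \<Sum>n. f n r)" by simp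
qed

text \<open>Partial sums are bounded in norm by the triangle inequality, and the bound passes to the
  pointwise limit on each [0,R]; this takes the place of completeness of \<open>L2\<close>.\<close>

lemma L2_suminf:
  assumes c: "continuous_on {0..} (\<lambda>r. \<Sum>n. F n r)" and cF: "\<And>n. continuous_on {0..} (F n)"
    and L: "\<And>n. F n \<in> L2" "\<And>n. nrm (F n) \<le> A' * (1/2) ^ n"
    and F: "\<And>n r. r \<ge> 0 \<Longrightarrow> cmod (F n r) \<le> A * (1/2) ^ n"
  shows "(\<lambda>r. \<Sum>n. F n r) \<in> L2"
proof (rule L2_I_continuous[OF c])
  fix R :: real assume R: "R > 0"
  have LS: "(\<lambda>r. \<Sum>n<N. F n r) \<in> L2 \<and> nrm (\<lambda>r. \<Sum>n<N. F n r) \<le> (\<Sum>n<N. A' * (1/2) ^ n)" for N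
  proof (induction N)
    case 0 then show ?case by (simp add: nrm_def)
  next
    case (Suc N)
    then show ?case using nrm_triangle[of "\<lambda>r. \<Sum>n<N. F n r" "F N"] L[of N] by (auto intro: L2_add)
  qed
  have A'0: "A' \<ge> 0" by (rule order_trans[OF nrm_nonneg[of "F 0"]]) (use L(2)[of 0] in simp)
  have s: "summable (\<lambda>n. A' * (1/2::real) ^ n)" by (intro summable_mult summable_geometric) auto
  have le: "(\<Sum>n<N. A' * (1/2) ^ n) \<le> (\<Sum>n. A' * (1/2::real) ^ n)" for N
    by (rule sum_le_suminf[OF s]) (use A'0 in auto)
  have lim: "(\<lambda>N. (cmod (\<Sum>n<N. F n s))\<^sup>2) \<longlonglongrightarrow> (cmod (\<Sum>n. F n s))\<^sup>2" if "s \<in> {0..R}" for s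
    by (intro tendsto_intros summable_LIMSEQ[OF summable_geometric_half(1)]) (use F that in auto)
  have ci: "(\<lambda>s. (cmod (\<Sum>n<N. F n s))\<^sup>2) integrable_on {0..R}" for N
    by (intro integrable_continuous_real continuous_intros continuous_on_subset[OF cF]) auto
  have "(\<lambda>N. integral {0..R} (\<lambda>s. (cmod (\<Sum>n<N. F n s))\<^sup>2)) \<longlonglongrightarrow> integral {0..R} (\<lambda>s. (cmod (\<Sum>n. F n s))\<^sup>2)"
  proof (rule dominated_convergence(2)[where h = "\<lambda>_. (2 * A)\<^sup>2"])
    show "norm ((cmod (\<Sum>n<N. F n s))\<^sup>2) \<le> (2 * A)\<^sup>2" if "s \<in> {0..R}" for N s
    proof -
      have "(cmod (\<Sum>n<N. F n s))\<^sup>2 \<le> (2 * A)\<^sup>2"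
        by (intro power_mono summable_geometric_half(2)) (use F that in auto)
      then show ?thesis by simp
    qed
  qed (use ci lim in auto)
  then show "integral {0..R} (\<lambda>s. (cmod (\<Sum>n. F n s))\<^sup>2) \<le> (\<Sum>n. A' * (1/2) ^ n)\<^sup>2"
  proof (rule LIMSEQ_le_const2, intro exI[of _ 0] allI impI)
    fix N
    have "integral {0..R} (\<lambda>s. (cmod (\<Sum>n<N. F n s))\<^sup>2) \<le> (nrm (\<lambda>r. \<Sum>n<N. F n r))\<^sup>2"
      unfolding nrm_sq by (rule halfline_integral_Icc_le) (use L2_integrable LS in auto)
    also have "\<dots> \<le> (\<Sum>n. A' * (1/2) ^ n)\<^sup>2"
      using LS[of N] le[of N] by (intro power_mono) auto
    finally show "integral {0..R} (\<lambda>s. (cmod (\<Sum>n<N. F n s))\<^sup>2) \<le> (\<Sum>n. A' * (1/2) ^ n)\<^sup>2" .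
  qed
qed

text \<open>Neumann series: each correction \<open>u\<^sub>n\<^sub>+\<^sub>1\<close> solves the unperturbed equation with source \<open>-e u\<^sub>n\<close>.\<close>

lemma solves_perturb:
  assumes k: "Im k > 0"
    and q: "q \<in> borel_measurable halfline" "\<And>r. r \<ge> 0 \<Longrightarrow> q r \<ge> 0" "\<And>r. r \<ge> 0 \<Longrightarrow> q r \<le> B"
    and e: "e \<in> borel_measurable halfline" "\<And>r. r \<ge> 0 \<Longrightarrow> e r \<ge> 0" "\<And>r. r \<ge> 0 \<Longrightarrow> e r \<le> \<eta>"
    and \<eta>: "2 * \<eta> \<le> Im k * cmod k"
    and ex: "\<And>f. f \<in> L2 \<Longrightarrow> \<exists>u p. solves q (k\<^sup>2) f u p"
    and f: "f \<in> L2"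
  shows "\<exists>u p. solves (\<lambda>r. q r + e r) (k\<^sup>2) f u p"
proof -
  obtain U P where UP: "\<And>f. f \<in> L2 \<Longrightarrow> solves q (k\<^sup>2) f (U f) (P f)"
    using ex by metis
  define fs where "fs = (\<lambda>n. ((\<lambda>g r. - of_real (e r) * U g r) ^^ n) f)"
  define u where "u = (\<lambda>n. U (fs n))"
  define p where "p = (\<lambda>n. P (fs n))"
  have fs0: "fs 0 = f" and fsS: "fs (Suc n) = (\<lambda>r. - of_real (e r) * u n r)" for n
    unfolding fs_def u_def by auto
  have em: "(\<lambda>r. - complex_of_real (e r)) \<in> borel_measurable halfline" using e(1) by measurable
  have eb: "cmod (- complex_of_real (e r)) \<le> \<eta>" if "r > 0" for r using e(2,3)[of r] that by simp
  have eb': "cmod (complex_of_real (e r)) \<le> \<eta>" if "r \<ge> 0" for r using e(2,3)[of r] that by simp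
  have \<eta>0: "\<eta> \<ge> 0" using e(2,3)[of 0] by simp
  have B0: "B \<ge> 0" using q(2,3)[of 0] by simp
  have fsL: "fs n \<in> L2" for n
  proof (induction n)
    case (Suc n)
    show ?case unfolding fsS u_def by (rule L2_bounded_mult[OF solvesD(1)[OF UP[OF Suc]] em eb])
  qed (simp add: fs0 f)
  have S: "solves q (k\<^sup>2) (fs n) (u n) (p n)" for n unfolding u_def p_def by (rule UP[OF fsL])
  note SD = solvesD[OF S]
  define b where "b = Im k"
  have b: "b > 0" "cmod k > 0" unfolding b_def using k by auto
  note ap = solves_apriori[OF S fsL q(2) k, folded b_def]
  define A0 where "A0 = nrm f"
  have A0: "A0 \<ge> 0" unfolding A0_def by simp
  have fsn: "nrm (fs n) \<le> A0 * (1/2) ^ n" for n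
  proof (induction n)
    case 0 then show ?case by (simp add: fs0 A0_def)
  next
    case (Suc n)
    have "nrm (fs (Suc n)) \<le> \<eta> * nrm (u n)"
      unfolding fsS by (rule nrm_bounded_mult[OF SD(1) em eb \<eta>0])
    also have "\<dots> \<le> \<eta> * (nrm (fs n) / (b * cmod k))" by (intro mult_left_mono ap \<eta>0)
    \<comment> \<open>The hypothesis on \<eta> enters here: the source norm at least halves from one
      correction to the next.\<close>
    also have "\<dots> \<le> (b * cmod k / 2) * (nrm (fs n) / (b * cmod k))"
      using \<eta> b unfolding b_def[symmetric] by (intro mult_right_mono) auto
    also have "\<dots> = nrm (fs n) / 2" using b by simp
    finally show ?case using Suc by simp
  qed
  define Au where "Au = A0 / (b * cmod k)"
  define Ap where "Ap = A0 / b"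
  have Au: "nrm (u n) \<le> Au * (1/2) ^ n" for n
    using ap(1)[of n] divide_right_mono[OF fsn[of n], of "b * cmod k"] b unfolding Au_def by simp
  have Ap: "nrm (p n) \<le> Ap * (1/2) ^ n" for n
    using ap(2)[of n] divide_right_mono[OF fsn[of n], of b] b unfolding Ap_def by simp
  have Au0: "Au \<ge> 0" "Ap \<ge> 0" unfolding Au_def Ap_def using A0 b by auto
  define Q where "Q = B + (cmod k)\<^sup>2"
  have Q0: "Q \<ge> 0" unfolding Q_def using B0 by simp
  have qm: "(\<lambda>r. complex_of_real (q r) - k\<^sup>2) \<in> borel_measurable halfline" using q(1) by measurable
  have qb: "cmod (complex_of_real (q r) - k\<^sup>2) \<le> Q" if "r \<ge> 0" for r
    using norm_triangle_ineq4[of "complex_of_real (q r)" "k\<^sup>2"] q(2,3)[OF that] unfolding Q_def by (simp add: norm_power)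
  define Ah where "Ah = Q * Au + A0"
  define h where "h = (\<lambda>n r. (complex_of_real (q r) - k\<^sup>2) * u n r - fs n r)"
  have hL: "h n \<in> L2" for n
    unfolding h_def by (intro L2_diff L2_bounded_mult[OF SD(1) qm qb] fsL) simp
  have hn: "nrm (h n) \<le> Ah * (1/2) ^ n" for n
  proof -
    have "nrm (h n) \<le> nrm (\<lambda>r. (complex_of_real (q r) - k\<^sup>2) * u n r) + nrm (\<lambda>r. -1 * fs n r)"
      using nrm_triangle[of "\<lambda>r. (complex_of_real (q r) - k\<^sup>2) * u n r" "\<lambda>r. -1 * fs n r"]
        L2_bounded_mult[OF SD(1)[of n] qm qb] L2_cmult[OF fsL, of "-1" n]
      unfolding h_def by simp
    also have "\<dots> \<le> Q * nrm (u n) + nrm (fs n)"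
      using nrm_bounded_mult[OF SD(1)[of n] qm qb Q0] unfolding nrm_cmult by simp
    also have "\<dots> \<le> Q * (Au * (1/2) ^ n) + A0 * (1/2) ^ n" by (intro add_mono mult_left_mono Au fsn Q0)
    finally show ?thesis unfolding Ah_def by (simp add: algebra_simps)
  qed
  have ACu: "AC (u n) (p n)" and ACp: "AC (p n) (h n)" for n using SD(4,5)[of n] unfolding h_def by auto
  define Cu where "Cu = sqrt (2 * (Ap * Au))"
  define Cp where "Cp = sqrt (2 * (Ah * Ap))"
  have Ah0: "Ah \<ge> 0" unfolding Ah_def using Q0 Au0 A0 by simp
  have bound: "cmod x \<le> sqrt (2 * (a * a')) * (1/2) ^ n" if "(cmod x)\<^sup>2 \<le> 2 * (y * y')" "y \<le> a * (1/2) ^ n" "y' \<le> a' * (1/2) ^ n"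
      "y \<ge> 0" "y' \<ge> 0" "a \<ge> 0" "a' \<ge> 0" for x y y' a a' and n :: nat
  proof (rule power2_le_imp_le)
    have "y * y' \<le> (a * (1/2) ^ n) * (a' * (1/2) ^ n)" using that by (intro mult_mono) auto
    also have "\<dots> = (a * a') * ((1/2) ^ n)\<^sup>2" by (simp add: power2_eq_square algebra_simps)
    finally have "(cmod x)\<^sup>2 \<le> 2 * ((a * a') * ((1/2) ^ n)\<^sup>2)" using that(1) by linarith
    also have "\<dots> = (sqrt (2 * (a * a')) * (1/2) ^ n)\<^sup>2" using that by (simp add: power_mult_distrib)
    finally show "(cmod x)\<^sup>2 \<le> (sqrt (2 * (a * a')) * (1/2) ^ n)\<^sup>2" .
  qed (use that in auto)
  have us: "cmod (u n r) \<le> Cu * (1/2) ^ n" if "r \<ge> 0" for n r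
    unfolding Cu_def by (rule bound[OF AC_sup_bound[OF ACu SD(1,2) that] Ap Au]) (use Au0 in auto)
  have ps: "cmod (p n r) \<le> Cp * (1/2) ^ n" if "r \<ge> 0" for n r
    unfolding Cp_def by (rule bound[OF AC_sup_bound[OF ACp SD(2) hL that] hn Ap]) (use Ah0 Au0 in auto)
  have su: "summable (\<lambda>n. u n r)" and sp: "summable (\<lambda>n. p n r)" if "r \<ge> 0" for r
    by (rule summable_geometric_half(1), rule us ps, rule that)+
  define u' where "u' = (\<lambda>r. \<Sum>n. u n r)"
  define p' where "p' = (\<lambda>r. \<Sum>n. p n r)"
  have ACu': "AC u' p'" unfolding u'_def p'_def by (rule AC_suminf[OF ACu us ps])
  have hS: "h (Suc n) = (\<lambda>r. (complex_of_real (q r) - k\<^sup>2) * u (Suc n) r + of_real (e r) * u n r)" for n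
    unfolding h_def fsS by simp
  \<comment> \<open>The head is split off: \<open>h 0\<close> contains \<open>f\<close>, which need
    not be bounded, whereas from \<open>h 1\<close> on only bounded functions occur.\<close>
  have "AC (\<lambda>r. \<Sum>n. p (Suc n) r) (\<lambda>r. \<Sum>n. h (Suc n) r)"
  proof (rule AC_suminf[OF ACp])
    fix n and r :: real assume r: "r \<ge> 0"
    have half: "(1/2::real) ^ Suc n \<le> (1/2) ^ n" by simp
    show "cmod (p (Suc n) r) \<le> (Cp / 2) * (1 / 2) ^ n" using ps[OF r, of "Suc n"] by simp
    have Cu0: "Cu \<ge> 0" unfolding Cu_def using Au0 by simp
    have "cmod (h (Suc n) r) \<le> Q * (Cu * (1/2) ^ Suc n) + \<eta> * (Cu * (1/2) ^ n)"
      unfolding hS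
      by (rule order_trans[OF norm_triangle_ineq], unfold norm_mult)
        (intro add_mono mult_mono qb us eb' r Q0 \<eta>0 norm_ge_zero)
    also have "\<dots> = (Q * Cu / 2 + \<eta> * Cu) * (1 / 2) ^ n" by (simp add: algebra_simps)
    finally show "cmod (h (Suc n) r) \<le> (Q * Cu / 2 + \<eta> * Cu) * (1 / 2) ^ n" .
  qed
  from AC_add[OF ACp[of 0] this]
  have ACp': "AC p' (\<lambda>r. (of_real (q r + e r) - k\<^sup>2) * u' r - f r)"
  proof (rule AC_cong)
    fix r :: real assume r: "r \<ge> 0"
    show "p 0 r + (\<Sum>n. p (Suc n) r) = p' r" unfolding p'_def using suminf_split_head[OF sp[OF r]] by simp
    have su': "summable (\<lambda>n. u (Suc n) r)" using su[OF r] by (subst summable_Suc_iff)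
    have h1: "(\<Sum>n. h (Suc n) r) = (complex_of_real (q r) - k\<^sup>2) * (\<Sum>n. u (Suc n) r) + of_real (e r) * u' r"
      unfolding hS u'_def using su' su[OF r]
      by (simp add: suminf_add[symmetric] suminf_mult summable_mult)
    have h2: "(\<Sum>n. u (Suc n) r) = u' r - u 0 r" unfolding u'_def by (rule suminf_split_head[OF su[OF r]])
    have h3: "h 0 r = (complex_of_real (q r) - k\<^sup>2) * u 0 r - f r" unfolding h_def fs0 ..
    show "h 0 r + (\<Sum>n. h (Suc n) r) = (of_real (q r + e r) - k\<^sup>2) * u' r - f r"
      unfolding h1 h2 h3 of_real_add by (simp add: algebra_simps)
  qed
  have u'L: "u' \<in> L2" unfolding u'_def
    by (rule L2_suminf[OF AC_continuous[OF ACu'[unfolded u'_def]] AC_continuous[OF ACu] SD(1) Au us])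
  have p'L: "p' \<in> L2" unfolding p'_def
    by (rule L2_suminf[OF AC_continuous[OF ACp'[unfolded p'_def]] AC_continuous[OF ACp] SD(2) Ap ps])
  have "u' 0 = 0" unfolding u'_def using SD(3) by simp
  then have "solves (\<lambda>r. q r + e r) (k\<^sup>2) f u' p'"
    unfolding solves_def using u'L p'L ACu' ACp' by simp
  then show ?thesis by blast
qed

lemma solves_exists:
  assumes k: "Im k > 0"
    and q: "q \<in> borel_measurable halfline" "\<And>r. r \<ge> 0 \<Longrightarrow> q r \<ge> 0" "\<And>r. r \<ge> 0 \<Longrightarrow> q r \<le> B"
    and f: "f \<in> L2"
  shows "\<exists>u p. solves q (k\<^sup>2) f u p"
proof -
  \<comment> \<open>The largest portion that \<open>solves_perturb\<close> accepts; it involves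
    \<open>k\<close> only, so the same \<open>N\<close> serves at every stage.\<close>
  define \<eta> where "\<eta> = Im k * cmod k / 2"
  have \<eta>: "\<eta> > 0" unfolding \<eta>_def using k by (intro divide_pos_pos mult_pos_pos) auto
  obtain N :: nat where N: "real N > B / \<eta>" using reals_Archimedean2 by blast
  have B0: "B \<ge> 0" using q(2,3)[of 0] by simp
  have N0: "real N > 0" using divide_nonneg_pos[OF B0 \<eta>] N by linarith
  have eta: "B / real N \<le> \<eta>" using N N0 \<eta> by (simp add: field_simps)
  have "\<exists>u p. solves (\<lambda>r. real j / real N * q r) (k\<^sup>2) f u p" if "f \<in> L2" for j f
    using that
  proof (induction j arbitrary: f)
    case 0
    then show ?case using solves_free[OF k] by simp
  next
    case (Suc j)
    have "\<exists>u p. solves (\<lambda>r. real j / real N * q r + 1 / real N * q r) (k\<^sup>2) f u p"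
    proof (rule solves_perturb[OF k, of _ "real j / real N * B" _ \<eta>])
      fix r :: real assume r: "r \<ge> 0"
      show "0 \<le> real j / real N * q r" "0 \<le> 1 / real N * q r" using q(2)[OF r] by auto
      show "real j / real N * q r \<le> real j / real N * B" using q(3)[OF r] by (intro mult_left_mono) auto
      have "1 / real N * q r \<le> 1 / real N * B" using q(3)[OF r] by (intro mult_left_mono) auto
      then show "1 / real N * q r \<le> \<eta>" using eta by simp
    qed (use q(1) Suc \<eta>_def in auto)
    moreover have "(\<lambda>r. real j / real N * q r + 1 / real N * q r) = (\<lambda>r. real (Suc j) / real N * q r)"
      by (rule ext) (simp add: add_divide_distrib algebra_simps)
    ultimately show ?case by simp
  qed
  from this[OF f, of N] show ?thesis using N0 by simp
qed

section \<open>Bump functions and weak derivatives\<close>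

text \<open>exp(-1/x) extended by 0; the powers of 1/x make the family closed under differentiation
  up to linear combinations.\<close>

definition flat_exp :: "nat \<Rightarrow> real \<Rightarrow> real" where
  "flat_exp n x = (if x \<le> 0 then 0 else inverse x ^ n * exp (- inverse x))"

lemma flat_exp_tendsto_0: "((\<lambda>x. flat_exp n x) \<longlongrightarrow> 0) (at_right 0)"
proof -
  have "((\<lambda>x. inverse x ^ n / exp (inverse x)) \<longlongrightarrow> (0::real)) (at_right 0)"
    by (rule filterlim_compose[OF tendsto_power_div_exp_0 filterlim_inverse_at_top_right])
  moreover have "\<forall>\<^sub>F x in at_right 0. inverse x ^ n / exp (inverse x) = flat_exp n x"
    unfolding eventually_at_right_field flat_exp_def by (intro exI[of _ 1]) (auto simp: exp_minus divide_inverse)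
  ultimately show ?thesis by (rule Lim_transform_eventually)
qed

lemma flat_exp_has_derivative:
  "(flat_exp n has_real_derivative (flat_exp (n + 2) x - real n * flat_exp (n + 1) x)) (at x)"
proof -
  consider "x < 0" | "x = 0" | "x > 0" by linarith
  then show ?thesis
  proof cases
    case 1
    have "((\<lambda>_. 0) has_real_derivative 0) (at x)" by simp
    then have "(flat_exp n has_real_derivative 0) (at x)"
      by (rule has_field_derivative_transform_within_open[of _ _ _ "{..<0}"]) (use 1 in \<open>auto simp: flat_exp_def\<close>)
    then show ?thesis using 1 by (simp add: flat_exp_def)
  next
    case 3
    have "((\<lambda>x. inverse x ^ n * exp (- inverse x)) has_real_derivative
       inverse x ^ (n + 2) * exp (- inverse x) - real n * (inverse x ^ (n + 1) * exp (- inverse x))) (at x)"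
    proof (rule DERIV_cong)
      show "((\<lambda>x. inverse x ^ n * exp (- inverse x)) has_real_derivative
          (real n * inverse x ^ (n - 1) * - (inverse x)\<^sup>2) * exp (- inverse x) + exp (- inverse x) * (inverse x)\<^sup>2 * inverse x ^ n) (at x)"
        using 3 by (auto intro!: derivative_eq_intros simp: power2_eq_square)
      show "(real n * inverse x ^ (n - 1) * - (inverse x)\<^sup>2) * exp (- inverse x) + exp (- inverse x) * (inverse x)\<^sup>2 * inverse x ^ n =
          inverse x ^ (n + 2) * exp (- inverse x) - real n * (inverse x ^ (n + 1) * exp (- inverse x))"
        by (cases n) (simp_all add: power2_eq_square algebra_simps)
    qed
    then have "(flat_exp n has_real_derivative
       inverse x ^ (n + 2) * exp (- inverse x) - real n * (inverse x ^ (n + 1) * exp (- inverse x))) (at x)"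
      by (rule has_field_derivative_transform_within_open[of _ _ _ "{0<..}"]) (use 3 in \<open>auto simp: flat_exp_def\<close>)
    then show ?thesis using 3 by (simp add: flat_exp_def)
  next
    case 2
    \<comment> \<open>To the right of 0 the difference quotient is \<open>flat_exp (n + 1)\<close>,
      so the known limit settles it.\<close>
    have "((\<lambda>h. flat_exp n h / h) \<longlongrightarrow> 0) (at 0)"
    proof (rule filterlim_split_at)
      show "((\<lambda>h. flat_exp n h / h) \<longlongrightarrow> 0) (at_left 0)"
        by (rule tendsto_eventually) (auto simp: eventually_at_left_field flat_exp_def intro!: exI[of _ "-1"])
      have "\<forall>\<^sub>F h in at_right 0. flat_exp (n + 1) h = flat_exp n h / h"
        unfolding eventually_at_right_field flat_exp_def by (intro exI[of _ 1]) (auto simp: field_simps)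
      with flat_exp_tendsto_0[of "n + 1"] show "((\<lambda>h. flat_exp n h / h) \<longlongrightarrow> 0) (at_right 0)"
        by (rule Lim_transform_eventually)
    qed
    then have "(flat_exp n has_real_derivative 0) (at 0)"
      unfolding DERIV_def by (simp add: flat_exp_def)
    then show ?thesis using 2 by (simp add: flat_exp_def)
  qed
qed

text \<open>A differentiation-invariant class containing the bump functions, so that its members are smooth.\<close>

inductive_set flat_algebra :: "(real \<Rightarrow> real) set" where
  base: "(\<lambda>x. flat_exp n (a * x + c)) \<in> flat_algebra"
| const: "(\<lambda>x. c) \<in> flat_algebra"
| add: "f \<in> flat_algebra \<Longrightarrow> g \<in> flat_algebra \<Longrightarrow> (\<lambda>x. f x + g x) \<in> flat_algebra"
| mult: "f \<in> flat_algebra \<Longrightarrow> g \<in> flat_algebra \<Longrightarrow> (\<lambda>x. f x * g x) \<in> flat_algebra"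

lemma flat_algebra_derivative:
  assumes "f \<in> flat_algebra"
  shows "\<exists>f'\<in>flat_algebra. \<forall>x. (f has_real_derivative f' x) (at x)"
  using assms
proof induction
  case (base n a c)
  have "((\<lambda>x. flat_exp n (a * x + c)) has_real_derivative
      (flat_exp (n + 2) (a * x + c) + (- real n) * flat_exp (n + 1) (a * x + c)) * a) (at x)" for x
  proof -
    have "((\<lambda>x. a * x + c) has_real_derivative a) (at x)" by (auto intro!: derivative_eq_intros)
    from DERIV_chain2[OF flat_exp_has_derivative this] show ?thesis by simp
  qed
  moreover have "(\<lambda>x. (flat_exp (n + 2) (a * x + c) + (- real n) * flat_exp (n + 1) (a * x + c)) * a) \<in> flat_algebra"
    by (intro flat_algebra.intros)
  ultimately show ?case
    by (intro bexI[of _ "\<lambda>x. (flat_exp (n + 2) (a * x + c) + (- real n) * flat_exp (n + 1) (a * x + c)) * a"] allI)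
next
  case (const c)
  then show ?case using flat_algebra.const[of 0] by (intro bexI[of _ "\<lambda>_. 0"]) auto
next
  case (add f g)
  then obtain f' g' where "f' \<in> flat_algebra" "g' \<in> flat_algebra"
    "\<And>x. (f has_real_derivative f' x) (at x)" "\<And>x. (g has_real_derivative g' x) (at x)" by blast
  then show ?case
    by (intro bexI[of _ "\<lambda>x. f' x + g' x"]) (auto intro!: flat_algebra.intros DERIV_add)
next
  case (mult f g)
  then obtain f' g' where *: "f' \<in> flat_algebra" "g' \<in> flat_algebra"
    "\<And>x. (f has_real_derivative f' x) (at x)" "\<And>x. (g has_real_derivative g' x) (at x)" by blast
  then have "(\<lambda>x. f' x * g x + f x * g' x) \<in> flat_algebra" using mult by (intro flat_algebra.intros)
  moreover have "((\<lambda>x. f x * g x) has_real_derivative f' x * g x + f x * g' x) (at x)" for x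
    using DERIV_mult[OF *(3)[of x] *(4)[of x]] by (simp add: mult.commute add.commute)
  ultimately show ?case by (intro bexI[of _ "\<lambda>x. f' x * g x + f x * g' x"] allI)
qed

lemma flat_algebra_funpow_deriv:
  assumes "f \<in> flat_algebra" shows "(deriv ^^ k) f \<in> flat_algebra"
proof (induction k)
  case (Suc k)
  then obtain f' where f': "f' \<in> flat_algebra" "\<And>x. ((deriv ^^ k) f has_real_derivative f' x) (at x)"
    using flat_algebra_derivative by blast
  then have "deriv ((deriv ^^ k) f) = f'" by (intro ext DERIV_imp_deriv)
  then show ?case using f' by simp
qed (use assms in simp)

lemma flat_algebra_smooth:
  assumes "f \<in> flat_algebra" shows "(deriv ^^ k) f differentiable (at x)"
  using flat_algebra_derivative[OF flat_algebra_funpow_deriv[OF assms, of k]]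
  by (auto simp: real_differentiable_def)

lemma flat_algebra_continuous: "f \<in> flat_algebra \<Longrightarrow> continuous_on S f"
  by (metis flat_algebra_derivative DERIV_isCont continuous_at_imp_continuous_on)

lemma test_functionI:
  assumes "\<And>k x. (deriv ^^ k) \<phi> differentiable (at x)" "\<And>x. x \<notin> {c..d} \<Longrightarrow> \<phi> x = 0" "0 < c"
  shows "test_function \<phi>"
proof -
  have "{x. \<phi> x \<noteq> 0} \<subseteq> {c..d}" using assms(2) by blast
  then have sub: "closure {x. \<phi> x \<noteq> 0} \<subseteq> {c..d}" by (rule closure_minimal) auto
  have "compact ({c..d} \<inter> closure {x. \<phi> x \<noteq> 0})" by (rule compact_Int_closed) auto
  then have "compact (closure {x. \<phi> x \<noteq> 0})" using sub by (simp add: Int_absorb1)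
  moreover have "closure {x. \<phi> x \<noteq> 0} \<subseteq> {0<..}" using sub assms(3) by fastforce
  ultimately show ?thesis unfolding test_function_def using assms(1) by blast
qed

lemma test_function_support:
  assumes "test_function \<phi>"
  obtains c d where "0 < c" "c < d" "\<And>x. x \<notin> {c..d} \<Longrightarrow> \<phi> x = 0" "\<And>x. x \<notin> {c..d} \<Longrightarrow> deriv \<phi> x = 0"
    "\<And>x. (\<phi> has_real_derivative deriv \<phi> x) (at x)" "continuous_on UNIV (deriv \<phi>)" "continuous_on UNIV \<phi>"
proof -
  let ?K = "closure {x. \<phi> x \<noteq> 0}"
  have K: "compact ?K" "?K \<subseteq> {0<..}" and sm: "\<And>k x. (deriv ^^ k) \<phi> differentiable (at x)"
    using assms unfolding test_function_def by auto
  have "\<exists>c d. 0 < c \<and> c < d \<and> ?K \<subseteq> {c..d}"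
  proof (cases "?K = {}")
    case False
    obtain c where c: "c \<in> ?K" "\<And>x. x \<in> ?K \<Longrightarrow> c \<le> x" using compact_attains_inf[OF K(1) False] by blast
    obtain d where d: "d \<in> ?K" "\<And>x. x \<in> ?K \<Longrightarrow> x \<le> d" using compact_attains_sup[OF K(1) False] by blast
    show ?thesis using c d K(2) by (intro exI[of _ c] exI[of _ "d + 1"]) force
  next
    case True
    then show ?thesis by (intro exI[of _ 1] exI[of _ 2]) simp
  qed
  then obtain c d where cd: "0 < c" "c < d" "?K \<subseteq> {c..d}" by blast
  have z: "\<phi> x = 0" if "x \<notin> {c..d}" for x
    using that cd(3) closure_subset[of "{x. \<phi> x \<noteq> 0}"] by blast
  have d1: "(\<phi> has_real_derivative deriv \<phi> x) (at x)" for x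
    using sm[of 0 x] by (simp add: real_differentiable_def DERIV_deriv_iff_real_differentiable)
  have d2: "deriv \<phi> differentiable (at x)" for x using sm[of 1 x] by simp
  have z': "deriv \<phi> x = 0" if "x \<notin> {c..d}" for x
  proof -
    have "((\<lambda>_. 0) has_real_derivative 0) (at x)" by simp
    then have "(\<phi> has_real_derivative 0) (at x)"
      by (rule has_field_derivative_transform_within_open[of _ _ _ "- {c..d}"]) (use that z in auto)
    then show ?thesis by (rule DERIV_imp_deriv)
  qed
  show ?thesis
  proof (rule that[OF cd(1,2) z z' d1])
    show "continuous_on UNIV (deriv \<phi>)"
      by (intro continuous_at_imp_continuous_on ballI differentiable_imp_continuous_within d2)
    show "continuous_on UNIV \<phi>"
      using d1 DERIV_isCont by (intro continuous_at_imp_continuous_on ballI) blast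
  qed auto
qed

text \<open>Two cut-offs whose steepness grows with \<open>n\<close>, tending to the indicator of
  (c,d). The arguments are in the affine form that the rule \<open>base\<close> of
  \<open>flat_algebra\<close> accepts.\<close>

definition bump :: "nat \<Rightarrow> real \<Rightarrow> real \<Rightarrow> real \<Rightarrow> real" where
  "bump n c d x = flat_exp 0 (real (Suc n) * x + - (real (Suc n) * c)) * flat_exp 0 (- real (Suc n) * x + real (Suc n) * d)"

lemma bump_flat: "bump n c d \<in> flat_algebra"
  unfolding bump_def[abs_def] by (intro flat_algebra.intros)

lemma bump_eq:
  "bump n c d x = (if x \<in> {c<..<d} then exp (- inverse (real (Suc n) * (x - c))) * exp (- inverse (real (Suc n) * (d - x))) else 0)"
proof -
  have *: "real (Suc n) * x + - (real (Suc n) * c) = real (Suc n) * (x - c)" "- real (Suc n) * x + real (Suc n) * d = real (Suc n) * (d - x)"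
    by (simp_all add: algebra_simps)
  have "real (Suc n) * t \<le> 0 \<longleftrightarrow> t \<le> 0" for t by (simp add: mult_le_0_iff)
  then show ?thesis unfolding bump_def * flat_exp_def by auto
qed

lemma bump_zero: "x \<notin> {c..d} \<Longrightarrow> bump n c d x = 0"
  and bump_nonneg: "bump n c d x \<ge> 0"
  and bump_pos: "x \<in> {c<..<d} \<Longrightarrow> bump n c d x > 0"
  unfolding bump_eq by auto

lemma bump_le_1: "bump n c d x \<le> 1"
proof -
  have "exp (- inverse (real (Suc n) * (x - c))) * exp (- inverse (real (Suc n) * (d - x))) \<le> 1 * 1" if "x \<in> {c<..<d}"
    using that by (intro mult_mono) (auto simp: mult_nonneg_nonneg)
  then show ?thesis unfolding bump_eq by auto
qed

lemma bump_tendsto: "(\<lambda>n. bump n c d x) \<longlonglongrightarrow> (if x \<in> {c<..<d} then 1 else 0)"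
proof (cases "x \<in> {c<..<d}")
  case True
  have l: "(\<lambda>n. exp (- inverse (real (Suc n) * t))) \<longlonglongrightarrow> exp (- 0)" for t
  proof -
    have "(\<lambda>n. inverse (real (Suc n)) * inverse t) \<longlonglongrightarrow> 0 * inverse t"
      by (intro tendsto_mult LIMSEQ_inverse_real_of_nat tendsto_const)
    then have "(\<lambda>n. inverse (real (Suc n) * t)) \<longlonglongrightarrow> 0" by simp
    then show ?thesis by (intro tendsto_intros)
  qed
  have "(\<lambda>n. exp (- inverse (real (Suc n) * (x - c))) * exp (- inverse (real (Suc n) * (d - x)))) \<longlonglongrightarrow> exp (- 0) * exp (- 0)"
    by (intro tendsto_mult l)
  then show ?thesis using True unfolding bump_eq by simp
next
  case False
  have "bump n c d x = 0" for n unfolding bump_eq by (rule if_not_P[OF False])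
  then show ?thesis unfolding if_not_P[OF False] by simp
qed

lemma bump_test: "0 < c \<Longrightarrow> test_function (bump n c d)"
  by (rule test_functionI[OF flat_algebra_smooth[OF bump_flat] bump_zero])

section \<open>Local integrability and the lemma of du Bois-Reymond\<close>

definition loc_int :: "(real \<Rightarrow> complex) \<Rightarrow> bool" where
  "loc_int h \<longleftrightarrow> (\<forall>c d. 0 < c \<longrightarrow> h absolutely_integrable_on {c..d})"

lemma locally_integrable_loc_int: "locally_integrable h \<Longrightarrow> loc_int h"
  unfolding locally_integrable_def loc_int_def
proof (intro allI impI)
  fix c d :: real assume *: "\<forall>K. compact K \<and> K \<subseteq> {0<..} \<longrightarrow> complex_set_integrable lebesgue K h" "0 < c"
  have "{c..d} \<subseteq> {0<..}" using *(2) by auto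
  then show "h absolutely_integrable_on {c..d}" using *(1) by simp
qed

text \<open>A nonempty compact subset of the open half line lies between its minimum and its
  maximum, so intervals suffice.\<close>

lemma loc_int_locally_integrable: assumes "loc_int h" shows "locally_integrable h"
  unfolding locally_integrable_def
proof (intro allI impI)
  fix K :: "real set" assume K: "compact K \<and> K \<subseteq> {0<..}"
  show "set_integrable lebesgue K h"
  proof (cases "K = {}")
    case False
    obtain c where c: "c \<in> K" "\<And>x. x \<in> K \<Longrightarrow> c \<le> x" using compact_attains_inf[of K] K False by blast
    obtain d where d: "d \<in> K" "\<And>x. x \<in> K \<Longrightarrow> x \<le> d" using compact_attains_sup[of K] K False by blast
    have "h absolutely_integrable_on {c..d}" using assms c K unfolding loc_int_def by auto
    then show ?thesis
      by (rule set_integrable_subset) (use K c d in \<open>auto simp: compact_imp_closed borel_closed\<close>)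
  qed auto
qed

lemma loc_int_diff: "loc_int f \<Longrightarrow> loc_int g \<Longrightarrow> loc_int (\<lambda>r. f r - g r)"
  unfolding loc_int_def by (auto intro: set_integral_diff)

lemma loc_int_const: "loc_int (\<lambda>r. C)"
  unfolding loc_int_def by (auto intro: absolutely_integrable_continuous_real)

lemma halfline_integral_supported:
  fixes g :: "real \<Rightarrow> 'a::euclidean_space"
  assumes "g absolutely_integrable_on {c..d}" "0 < c" "\<And>r. r \<notin> {c..d} \<Longrightarrow> g r = 0"
  shows "integrable halfline g" "(LINT r|halfline. g r) = integral {c..d} g"
proof -
  have "(\<lambda>r. if r \<in> {c..d} then g r else 0) absolutely_integrable_on UNIV"
    unfolding absolutely_integrable_restrict_UNIV by (rule assms)
  moreover have e: "(\<lambda>r. if r \<in> {c..d} then g r else 0) = g" using assms(3) by auto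
  ultimately have "g absolutely_integrable_on UNIV" by simp
  then have "g absolutely_integrable_on {0<..}" by (rule set_integrable_subset) auto
  then show i: "integrable halfline g" by (rule absolutely_integrable_imp_integrable) auto
  have "(LINT r|halfline. g r) = integral {0<..} g" by (rule lebesgue_integral_eq_integral[OF i]) auto
  also have "\<dots> = integral {0<..} (\<lambda>r. if r \<in> {c..d} then g r else 0)" unfolding e ..
  also have "\<dots> = integral ({c..d} \<inter> {0<..}) g" by (rule integral_restrict_Int)
  also have "{c..d} \<inter> {0<..} = {c..d}" using assms(2) by auto
  finally show "(LINT r|halfline. g r) = integral {c..d} g" .
qed

lemma abs_integrable_mult_real:
  fixes h :: "real \<Rightarrow> complex" and \<phi> :: "real \<Rightarrow> real"
  assumes "h absolutely_integrable_on {c..d}" "continuous_on {c..d} \<phi>"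
  shows "(\<lambda>r. h r * of_real (\<phi> r)) absolutely_integrable_on {c..d}"
proof -
  have "(\<lambda>r. of_real (\<phi> r) * h r) absolutely_integrable_on {c..d}"
  proof (rule absolutely_integrable_bounded_measurable_product[of "(*)" "\<lambda>r. of_real (\<phi> r)", OF _ _ _ _ assms(1)])
    have c: "continuous_on {c..d} (\<lambda>r. complex_of_real (\<phi> r))" by (intro continuous_intros assms)
    show "(\<lambda>r. complex_of_real (\<phi> r)) \<in> borel_measurable (lebesgue_on {c..d})"
      by (rule continuous_imp_measurable_on_sets_lebesgue[OF c]) auto
    show "bounded ((\<lambda>r. complex_of_real (\<phi> r)) ` {c..d})"
      using c compact_continuous_image compact_imp_bounded by blast
  qed (auto simp: bilinear_times)
  then show ?thesis by (simp add: mult.commute)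
qed

lemma test_integrable:
  assumes h: "loc_int h" and \<phi>: "test_function \<phi>"
  shows "integrable halfline (\<lambda>r. h r * of_real (\<phi> r))" "integrable halfline (\<lambda>r. h r * of_real (deriv \<phi> r))"
proof -
  obtain c d where cd: "0 < c" "c < d" "\<And>x. x \<notin> {c..d} \<Longrightarrow> \<phi> x = 0" "\<And>x. x \<notin> {c..d} \<Longrightarrow> deriv \<phi> x = 0"
    "continuous_on UNIV (deriv \<phi>)" "continuous_on UNIV \<phi>"
    using test_function_support[OF \<phi>] by metis
  have "h absolutely_integrable_on {c..d}" using h cd unfolding loc_int_def by blast
  then have a: "(\<lambda>r. h r * of_real (\<phi> r)) absolutely_integrable_on {c..d}" "(\<lambda>r. h r * of_real (deriv \<phi> r)) absolutely_integrable_on {c..d}"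
    using cd(5,6) by (auto intro!: abs_integrable_mult_real intro: continuous_on_subset)
  show "integrable halfline (\<lambda>r. h r * of_real (\<phi> r))" "integrable halfline (\<lambda>r. h r * of_real (deriv \<phi> r))"
    by (rule halfline_integral_supported(1)[OF a(1) cd(1)], simp add: cd(3))
      (rule halfline_integral_supported(1)[OF a(2) cd(1)], simp add: cd(4))
qed

lemma AE_halfline_negligible:
  assumes "negligible N" "\<And>r. r > 0 \<Longrightarrow> r \<notin> N \<Longrightarrow> P r"
  shows "AE r in halfline. P r"
proof -
  have "AE r in lebesgue. r \<notin> N" using assms(1) by (simp add: negligible_iff_null_sets AE_not_in)
  then have "AE r in lebesgue. r \<in> {0<..} \<longrightarrow> P r" by (rule eventually_mono) (use assms(2) in auto)
  then show ?thesis by (subst AE_restrict_space_iff) auto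
qed

lemma AE_halfline_obtain_negligible:
  assumes "AE r in halfline. P r"
  obtains N where "negligible N" "\<And>r. r > 0 \<Longrightarrow> r \<notin> N \<Longrightarrow> P r"
proof -
  have "AE r in lebesgue. r \<in> {0<..} \<longrightarrow> P r" using assms by (subst (asm) AE_restrict_space_iff) auto
  then obtain N where N: "N \<in> null_sets lebesgue" "\<And>x. x \<notin> N \<Longrightarrow> (x \<in> {0<..} \<longrightarrow> P x)"
    unfolding completion.AE_iff_null_sets by auto
  then show ?thesis using that[of N] by (auto simp: negligible_iff_null_sets)
qed

text \<open>Lebesgue's differentiation theorem recovers \<open>h\<close> from its integrals over intervals.\<close>

lemma zero_integrals_imp_AE_zero:
  assumes h: "loc_int h" and z: "\<And>c d. 0 < c \<Longrightarrow> c < d \<Longrightarrow> integral {c..d} h = 0"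
  shows "AE r in halfline. h r = 0"
proof -
  \<comment> \<open>Truncation makes \<open>h\<close> integrable on every interval of the line, as
    the differentiation theorem asks; the truncations exhaust the open half line.\<close>
  define hm where "hm = (\<lambda>m::nat. \<lambda>r. if r \<in> {1 / real (Suc m)..real (Suc m)} then h r else 0)"
  have "\<exists>N. negligible N \<and> (\<forall>r. r \<notin> N \<longrightarrow> hm m r = 0)" for m
  proof -
    have "h absolutely_integrable_on {1 / real (Suc m)..real (Suc m)}" using h unfolding loc_int_def by simp
    then have "hm m absolutely_integrable_on UNIV" unfolding hm_def absolutely_integrable_restrict_UNIV .
    then have "hm m absolutely_integrable_on cbox a b" for a b by (rule set_integrable_subset) auto
    then have i: "hm m integrable_on cbox a b" for a b by (simp add: absolutely_integrable_on_def)
    have zero: "integral (cbox a b) (hm m) = 0" for a b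
    proof -
      have "integral (cbox a b) (hm m) = integral ({1 / real (Suc m)..real (Suc m)} \<inter> {a..b}) h"
        unfolding hm_def by (subst integral_restrict_Int) simp
      also have "{1 / real (Suc m)..real (Suc m)} \<inter> {a..b} = {max (1 / real (Suc m)) a..min (real (Suc m)) b}" by auto
      also have "integral \<dots> h = 0"
      proof (cases "max (1 / real (Suc m)) a < min (real (Suc m)) b")
        case True
        have "0 < 1 / real (Suc m)" by simp
        then show ?thesis using z[OF _ True] by (simp add: less_max_iff_disj)
      next
        case False
        then consider "max (1 / real (Suc m)) a = min (real (Suc m)) b" | "min (real (Suc m)) b < max (1 / real (Suc m)) a" by linarith
        then show ?thesis by cases auto
      qed
      finally show ?thesis .
    qed
    obtain N where N: "negligible N" "\<And>x e. \<lbrakk>x \<notin> N; 0 < e\<rbrakk> \<Longrightarrow>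
               \<exists>d>0. \<forall>h. 0 < h \<and> h < d \<longrightarrow> norm (integral (cbox x (x + h *\<^sub>R One)) (hm m) /\<^sub>R h ^ DIM(real) - hm m x) < e"
      using integrable_ccontinuous_explicit[of "hm m", OF i] by metis
    have "hm m r = 0" if rN: "r \<notin> N" for r
    proof (rule ccontr)
      assume nz: "hm m r \<noteq> 0"
      obtain d where d: "d > 0" "\<And>h. 0 < h \<Longrightarrow> h < d \<Longrightarrow> norm (integral (cbox r (r + h *\<^sub>R One)) (hm m) /\<^sub>R h ^ DIM(real) - hm m r) < norm (hm m r)"
        using N(2)[OF rN, of "norm (hm m r)"] nz unfolding zero_less_norm_iff by blast
      from d(2)[of "d/2"] d(1) show False unfolding zero by simp
    qed
    then show ?thesis using N by blast
  qed
  then obtain N where N: "\<And>m. negligible (N m)" "\<And>m r. r \<notin> N m \<Longrightarrow> hm m r = 0" by metis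
  show ?thesis
  proof (rule AE_halfline_negligible[of "\<Union>m. N m"])
    show "negligible (\<Union>m. N m)" by (rule negligible_countable_Union) (use N in auto)
    fix r :: real assume r: "r > 0" "r \<notin> (\<Union>m. N m)"
    obtain m :: nat where m: "real m > max r (1 / r)" using reals_Archimedean2 by blast
    then have "r \<in> {1 / real (Suc m)..real (Suc m)}" using r by (auto simp: field_simps)
    then show "h r = 0" using N(2)[of r m] r by (auto simp: hm_def)
  qed
qed

text \<open>The bumps are bounded by 1 and converge to the indicator of (c,d), so dominated
  convergence passes from test functions to intervals.\<close>

lemma zero_bump_integrals_imp_AE_zero:
  assumes h: "loc_int h" and z: "\<And>n c d. 0 < c \<Longrightarrow> c < d \<Longrightarrow> (LINT r|halfline. h r * of_real (bump n c d r)) = 0"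
  shows "AE r in halfline. h r = 0"
proof (rule zero_integrals_imp_AE_zero[OF h])
  fix c d :: real assume cd: "0 < c" "c < d"
  have ha: "h absolutely_integrable_on {c..d}" using h cd unfolding loc_int_def by blast
  have a: "(\<lambda>r. h r * of_real (bump n c d r)) absolutely_integrable_on {c..d}" for n
    by (rule abs_integrable_mult_real[OF ha flat_algebra_continuous[OF bump_flat]])
  have 0: "integral {c..d} (\<lambda>r. h r * of_real (bump n c d r)) = 0" for n
    using halfline_integral_supported(2)[OF a cd(1), of n] z[OF cd, of n] by (simp add: bump_zero)
  have "(\<lambda>n. integral {c..d} (\<lambda>r. h r * of_real (bump n c d r))) \<longlonglongrightarrow> integral {c..d} (\<lambda>r. h r * of_real (if r \<in> {c<..<d} then 1 else 0))"
  proof (rule dominated_convergence(2)[where h = "\<lambda>r. cmod (h r)"])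
    show "norm (h r * of_real (bump n c d r)) \<le> cmod (h r)" for n r
      using mult_left_mono[OF bump_le_1[of n c d r], of "cmod (h r)"] bump_nonneg[of n c d r] by (simp add: norm_mult)
    show "(\<lambda>n. h r * of_real (bump n c d r)) \<longlonglongrightarrow> h r * of_real (if r \<in> {c<..<d} then 1 else 0)" for r
      by (intro tendsto_intros bump_tendsto)
  qed (use a ha in \<open>auto simp: absolutely_integrable_on_def\<close>)
  then have "integral {c..d} (\<lambda>r. h r * of_real (if r \<in> {c<..<d} then 1 else 0)) = 0"
    unfolding 0 by (simp add: LIMSEQ_const_iff)
  moreover have "integral {c..d} (\<lambda>r. h r * of_real (if r \<in> {c<..<d} then 1 else 0)) = integral {c..d} h"
    by (rule integral_spike[of "{c, d}"]) auto
  ultimately show "integral {c..d} h = 0" by simp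
qed

text \<open>A combination of bumps with integral 0 is the derivative of a test function. Subtracting
  a multiple of the fixed bump \<beta> from any other bump achieves this, and \<open>C\<close> is
  the average of \<open>h\<close> against \<beta>.\<close>

lemma du_Bois_Reymond:
  assumes h: "loc_int h" and z: "\<And>\<phi>. test_function \<phi> \<Longrightarrow> (LINT r|halfline. h r * of_real (deriv \<phi> r)) = 0"
  shows "\<exists>C. AE r in halfline. h r = C"
proof -
  define \<beta> where "\<beta> = bump 0 1 2"
  have \<beta>t: "test_function \<beta>" unfolding \<beta>_def by (rule bump_test) simp
  have bc: "continuous_on S (bump n c d)" for S n c d by (rule flat_algebra_continuous[OF bump_flat])
  define I\<beta> where "I\<beta> = integral {1..2} \<beta>"
  have I\<beta>: "I\<beta> > 0"
  proof -
    have "I\<beta> \<ge> 0" unfolding I\<beta>_def \<beta>_def by (rule integral_nonneg) (use bc bump_nonneg in \<open>auto intro: integrable_continuous_real\<close>)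
    moreover have "I\<beta> \<noteq> 0"
    proof
      assume "I\<beta> = 0"
      then have "(\<beta> has_integral 0) {1..2}" unfolding I\<beta>_def \<beta>_def using integrable_integral[OF integrable_continuous_real[OF bc]] by metis
      then have "\<beta> (3/2) = 0" using has_integral_0_cbox_imp_0[of 1 2 \<beta> "3/2"] bc bump_nonneg by (auto simp: \<beta>_def)
      then show False using bump_pos[of "3/2" 1 2 0] by (simp add: \<beta>_def)
    qed
    ultimately show ?thesis by simp
  qed
  define C where "C = (LINT r|halfline. h r * of_real (\<beta> r)) / of_real I\<beta>"
  have "AE r in halfline. h r - C = 0"
  proof (rule zero_bump_integrals_imp_AE_zero[OF loc_int_diff[OF h loc_int_const]])
    fix n and c d :: real assume cd: "0 < c" "c < d"
    define \<psi> where "\<psi> = bump n c d"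
    have \<psi>t: "test_function \<psi>" unfolding \<psi>_def by (rule bump_test) (use cd in simp)
    define I\<psi> where "I\<psi> = integral {c..d} \<psi>"
    define g where "g = (\<lambda>x. \<psi> x + (- (I\<psi> / I\<beta>)) * \<beta> x)"
    have gf: "g \<in> flat_algebra" unfolding g_def \<psi>_def \<beta>_def by (intro flat_algebra.intros bump_flat)
    have gc: "continuous_on S g" for S by (rule flat_algebra_continuous[OF gf])
    define m where "m = min c 1"
    define M where "M = max d 2"
    have m0: "m > 0" "m < M" unfolding m_def M_def using cd by auto
    have gz: "g x = 0" if "x \<notin> {m..M}" for x
    proof -
      have "x \<notin> {c..d}" "x \<notin> {1..2}" using that unfolding m_def M_def by auto
      then show ?thesis unfolding g_def \<psi>_def \<beta>_def by (simp only: bump_zero[OF \<open>x \<notin> {c..d}\<close>] bump_zero[OF \<open>x \<notin> {1..2}\<close>] mult_zero_right add_0)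
    qed
    \<comment> \<open>Starting left of the support makes \<open>\<Phi>\<close> differentiable also
      at \<open>m\<close>; that \<open>g\<close> has integral 0 makes it vanish beyond
      \<open>M\<close>.\<close>
    define \<Phi> where "\<Phi> = (\<lambda>x. integral {m - 1..x} g)"
    have gi: "g integrable_on S'" if "S' = {x..y}" for S' x y unfolding that by (rule integrable_continuous_real[OF gc])
    have low: "\<Phi> x = 0" if "x < m" for x
      unfolding \<Phi>_def by (subst integral_cong[of _ g "\<lambda>_. 0"]) (use gz that in auto)
    have ext_int: "integral {m - 1..M} (bump n' a b) = integral {a..b} (bump n' a b)" if "m \<le> a" "b \<le> M" for n' a b
    proof -
      have "integral {m - 1..M} (bump n' a b) = integral {m - 1..M} (\<lambda>x. if x \<in> {a..b} then bump n' a b x else 0)"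
        by (rule Henstock_Kurzweil_Integration.integral_cong) (auto simp: bump_zero)
      also have "\<dots> = integral ({a..b} \<inter> {m - 1..M}) (bump n' a b)" by (rule integral_restrict_Int)
      also have "{a..b} \<inter> {m - 1..M} = {a..b}" using that by auto
      finally show ?thesis .
    qed
    have \<Phi>M: "\<Phi> M = 0"
    proof -
      have i: "bump n' a b integrable_on {m - 1..M}" for n' a b by (rule integrable_continuous_real[OF bc])
      have "\<Phi> M = integral {m - 1..M} \<psi> + integral {m - 1..M} (\<lambda>x. (- (I\<psi> / I\<beta>)) * \<beta> x)"
        unfolding \<Phi>_def g_def \<psi>_def \<beta>_def
        by (rule Henstock_Kurzweil_Integration.integral_add[OF i integrable_on_mult_right[OF i]])
      also have "\<dots> = I\<psi> + (- (I\<psi> / I\<beta>)) * I\<beta>"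
        unfolding I\<psi>_def I\<beta>_def \<psi>_def \<beta>_def Henstock_Kurzweil_Integration.integral_mult_right
        by (subst (1 2) ext_int) (auto simp: m_def M_def)
      also have "\<dots> = 0" using I\<beta> by simp
      finally show ?thesis .
    qed
    have high: "\<Phi> x = 0" if "x > M" for x
    proof -
      have "\<Phi> x = \<Phi> M + integral {M..x} g"
        unfolding \<Phi>_def using m0 that by (intro Henstock_Kurzweil_Integration.integral_combine[symmetric] gi) auto
      moreover have "integral {M..x} g = integral {M..x} (\<lambda>_. 0)"
        by (rule integral_spike[of "{M}"]) (use gz in auto)
      ultimately show ?thesis using \<Phi>M by simp
    qed
    have d\<Phi>: "(\<Phi> has_real_derivative g x) (at x)" for x
    proof (cases "x < m")
      case True
      have "((\<lambda>_. 0) has_real_derivative 0) (at x)" by simp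
      then have "(\<Phi> has_real_derivative 0) (at x)"
        by (rule has_field_derivative_transform_within_open[of _ _ _ "{..<m}"]) (use True low in auto)
      then show ?thesis using gz[of x] True by simp
    next
      case False
      have "(\<Phi> has_real_derivative g x) (at x within {m - 1..x + 1})"
        unfolding \<Phi>_def using integral_has_vector_derivative[OF gc, of x "m - 1" "x + 1"] False
        by (simp add: has_real_derivative_iff_has_vector_derivative)
      then show ?thesis using False at_within_Icc_at[of "m - 1" x "x + 1"] by simp
    qed
    have der: "deriv \<Phi> = g" by (rule ext) (rule DERIV_imp_deriv[OF d\<Phi>])
    have "test_function \<Phi>"
    proof (rule test_functionI[OF _ _ m0(1), of _ M])
      show "(deriv ^^ k) \<Phi> differentiable at x" for k x
      proof (cases k)
        case 0 then show ?thesis using d\<Phi> by (auto simp: real_differentiable_def)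
      next
        case (Suc j)
        then have "(deriv ^^ k) \<Phi> = (deriv ^^ j) g" by (simp add: funpow_Suc_right der del: funpow.simps)
        then show ?thesis using flat_algebra_smooth[OF gf] by simp
      qed
      show "\<Phi> x = 0" if "x \<notin> {m..M}" for x using that low high by force
    qed
    from z[OF this] have "(LINT r|halfline. h r * of_real (g r)) = 0" unfolding der .
    moreover have "(LINT r|halfline. h r * of_real (g r)) = (LINT r|halfline. h r * of_real (\<psi> r) - of_real (I\<psi> / I\<beta>) * (h r * of_real (\<beta> r)))"
      by (rule Bochner_Integration.integral_cong) (auto simp: g_def algebra_simps)
    moreover have "\<dots> = (LINT r|halfline. h r * of_real (\<psi> r)) - of_real (I\<psi> / I\<beta>) * (LINT r|halfline. h r * of_real (\<beta> r))"
      using test_integrable(1)[OF h \<psi>t] test_integrable(1)[OF h \<beta>t] by simp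
    ultimately have 1: "(LINT r|halfline. h r * of_real (\<psi> r)) = C * of_real I\<psi>"
      using I\<beta> unfolding C_def by (simp add: field_simps)
    have a: "(\<lambda>r. C * complex_of_real (\<psi> r)) absolutely_integrable_on {c..d}"
      unfolding \<psi>_def by (intro absolutely_integrable_continuous_real continuous_intros bc)
    have "(LINT r|halfline. C * of_real (\<psi> r)) = integral {c..d} (\<lambda>r. C * complex_of_real (\<psi> r))"
      by (rule halfline_integral_supported(2)[OF a cd(1)]) (simp add: \<psi>_def bump_zero)
    also have "\<dots> = C * of_real I\<psi>"
    proof -
      have "((\<lambda>r. complex_of_real (\<psi> r)) has_integral of_real I\<psi>) {c..d}"
        unfolding I\<psi>_def \<psi>_def by (intro has_integral_of_real integrable_integral integrable_continuous_real bc)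
      from has_integral_mult_right[OF this, of C] show ?thesis by (rule integral_unique)
    qed
    finally have 2: "(LINT r|halfline. C * of_real (\<psi> r)) = C * of_real I\<psi>" .
    show "(LINT r|halfline. (h r - C) * of_real (bump n c d r)) = 0"
      using test_integrable(1)[OF h \<psi>t] test_integrable(1)[OF loc_int_const \<psi>t, of C] unfolding left_diff_distrib \<psi>_def[symmetric]
      by (subst Bochner_Integration.integral_diff) (simp_all only: 1 2 diff_self)
  qed
  then show ?thesis by (intro exI[of _ C]) (auto elim: eventually_mono)
qed

section \<open>Weak derivatives and absolutely continuous representatives\<close>

lemma AC_loc_int: "AC U v \<Longrightarrow> loc_int v" "AC U v \<Longrightarrow> loc_int U"
proof -
  assume AC: "AC U v"
  show "loc_int v" unfolding loc_int_def
    by (auto intro!: set_integrable_subset[OF AC_absolutely_integrable[OF AC]])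
  show "loc_int U" unfolding loc_int_def
    by (auto intro!: absolutely_integrable_continuous_real continuous_on_subset[OF AC_continuous[OF AC]])
qed

text \<open>By the product rule \<open>U * \<phi>\<close> is a primitive of the sum of both
  integrands. It vanishes at 0 and beyond the support of \<phi>, so the integrals over [0,R] are
  eventually 0.\<close>

lemma AC_weak_deriv:
  assumes AC: "AC U v"
  shows "is_weak_deriv U v"
  unfolding is_weak_deriv_def
proof (intro conjI allI impI)
  show "locally_integrable U" "locally_integrable v"
    using AC_loc_int[OF AC] loc_int_locally_integrable by auto
  fix \<phi> assume \<phi>: "test_function \<phi>"
  obtain c d where cd: "0 < c" "c < d" "\<And>x. x \<notin> {c..d} \<Longrightarrow> \<phi> x = 0" "\<And>x. x \<notin> {c..d} \<Longrightarrow> deriv \<phi> x = 0"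
    "\<And>x. (\<phi> has_real_derivative deriv \<phi> x) (at x)" "continuous_on UNIV (deriv \<phi>)" "continuous_on UNIV \<phi>"
    using test_function_support[OF \<phi>] by metis
  have AC\<phi>: "AC (\<lambda>r. of_real (\<phi> r)) (\<lambda>r. of_real (deriv \<phi> r))"
    by (rule AC_C1_real) (auto intro: has_field_derivative_at_within[OF cd(5)] continuous_on_subset[OF cd(6)])
  have "(LINT r|halfline. v r * of_real (\<phi> r) + U r * of_real (deriv \<phi> r)) = 0"
  proof -
    let ?g = "\<lambda>r. v r * of_real (\<phi> r) + U r * of_real (deriv \<phi> r)"
    have i: "integrable halfline ?g"
      using test_integrable(1)[OF AC_loc_int(1)[OF AC] \<phi>] test_integrable(2)[OF AC_loc_int(2)[OF AC] \<phi>] by simp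
    have "\<forall>\<^sub>F R in at_top. integral {0..R} ?g = 0"
      using eventually_gt_at_top[of d]
    proof (rule eventually_mono)
      fix R assume R: "d < R"
      have "(?g has_integral (U R * of_real (\<phi> R) - U 0 * of_real (\<phi> 0))) {0..R}"
        by (rule AC_has_integral[OF AC_mult[OF AC AC\<phi>]]) (use R cd in auto)
      moreover have "\<phi> R = 0" "\<phi> 0 = 0" using cd(1,2) R by (auto intro!: cd(3))
      ultimately show "integral {0..R} ?g = 0" by (auto intro: integral_unique)
    qed
    then have "((\<lambda>R. integral {0..R} ?g) \<longlongrightarrow> 0) at_top" by (rule tendsto_eventually)
    with halfline_integral_tendsto[OF i] show ?thesis by (rule tendsto_unique[OF trivial_limit_at_top_linorder])
  qed
  then show "(LINT r|halfline. U r * of_real (deriv \<phi> r)) = - (LINT r|halfline. v r * of_real (\<phi> r))"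
    using test_integrable(1)[OF AC_loc_int(1)[OF AC] \<phi>] test_integrable(2)[OF AC_loc_int(2)[OF AC] \<phi>]
    by (simp add: eq_neg_iff_add_eq_0 add.commute)
qed

lemma weak_deriv_loc_int: "is_weak_deriv u v \<Longrightarrow> loc_int u" "is_weak_deriv u v \<Longrightarrow> loc_int v"
  unfolding is_weak_deriv_def by (auto intro: locally_integrable_loc_int)

lemma weak_deriv_unique:
  assumes "is_weak_deriv u v" "is_weak_deriv u v'"
  shows "AE r in halfline. v r = v' r"
proof -
  note li = weak_deriv_loc_int(2)[OF assms(1)] weak_deriv_loc_int(2)[OF assms(2)]
  have "AE r in halfline. v r - v' r = 0"
  proof (rule zero_bump_integrals_imp_AE_zero[OF loc_int_diff[OF li]])
    fix n and c d :: real assume cd: "0 < c" "c < d"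
    have t: "test_function (bump n c d)" by (rule bump_test[OF cd(1)])
    have "(LINT r|halfline. v r * of_real (bump n c d r)) = (LINT r|halfline. v' r * of_real (bump n c d r))"
    proof -
      have "- (LINT r|halfline. v r * of_real (bump n c d r)) = - (LINT r|halfline. v' r * of_real (bump n c d r))"
        using assms(1)[unfolded is_weak_deriv_def, THEN conjunct2, THEN conjunct2, rule_format, OF t]
          assms(2)[unfolded is_weak_deriv_def, THEN conjunct2, THEN conjunct2, rule_format, OF t] by (rule trans[OF sym])
      then show ?thesis by simp
    qed
    then show "(LINT r|halfline. (v r - v' r) * of_real (bump n c d r)) = 0"
      unfolding left_diff_distrib
      using test_integrable(1)[OF li(1) t] test_integrable(1)[OF li(2) t]
      by (subst Bochner_Integration.integral_diff) simp_all
  qed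
  then show ?thesis by (rule eventually_mono) simp
qed

lemma loc_int_AE_cong:
  assumes "loc_int u" "AE r in halfline. u' r = u r"
  shows "loc_int u'"
  unfolding loc_int_def
proof (intro allI impI)
  fix c d :: real assume c: "0 < c"
  obtain N where N: "negligible N" "\<And>r. r > 0 \<Longrightarrow> r \<notin> N \<Longrightarrow> u' r = u r"
    using AE_halfline_obtain_negligible[OF assms(2)] by blast
  show "u' absolutely_integrable_on {c..d}"
    by (rule absolutely_integrable_spike[OF _ N(1)]) (use assms(1) c N(2) in \<open>auto simp: loc_int_def\<close>)
qed

lemma weak_deriv_AE_cong:
  assumes "is_weak_deriv u v" "AE r in halfline. u' r = u r"
  shows "is_weak_deriv u' v"
  unfolding is_weak_deriv_def
proof (intro conjI allI impI)
  have li: "loc_int u'" by (rule loc_int_AE_cong[OF weak_deriv_loc_int(1)[OF assms(1)] assms(2)])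
  then show "locally_integrable u'" by (rule loc_int_locally_integrable)
  show "locally_integrable v" using assms(1) unfolding is_weak_deriv_def by blast
  fix \<phi> assume \<phi>: "test_function \<phi>"
  have "(LINT r|halfline. u' r * of_real (deriv \<phi> r)) = (LINT r|halfline. u r * of_real (deriv \<phi> r))"
    by (rule integral_cong_AE)
      (use borel_measurable_integrable[OF test_integrable(2)[OF li \<phi>]]
        borel_measurable_integrable[OF test_integrable(2)[OF weak_deriv_loc_int(1)[OF assms(1)] \<phi>]] assms(2)
        in \<open>auto elim!: eventually_mono\<close>)
  then show "(LINT r|halfline. u' r * of_real (deriv \<phi> r)) = - (LINT r|halfline. v r * of_real (\<phi> r))"
    using assms(1) \<phi> unfolding is_weak_deriv_def by metis
qed

lemma weak_deriv_AE:
  assumes "is_weak_deriv u v"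
  shows "is_weak_deriv u (weak_deriv u)" "AE r in halfline. weak_deriv u r = v r"
proof -
  show *: "is_weak_deriv u (weak_deriv u)" unfolding weak_deriv_def using assms by (rule someI[where P = "is_weak_deriv u"])
  show "AE r in halfline. weak_deriv u r = v r" by (rule weak_deriv_unique[OF * assms])
qed

text \<open>The representative chosen by \<open>weak_deriv u\<close> differs from \<open>v\<close>
  on a null set only, hence still has the weak derivative \<open>w\<close>.\<close>

lemma second_weak_deriv_AE:
  assumes "is_weak_deriv u v" "is_weak_deriv v w"
  shows "AE r in halfline. weak_deriv (weak_deriv u) r = w r"
  by (rule weak_deriv_AE(2)[OF weak_deriv_AE_cong[OF assms(2) weak_deriv_AE(2)[OF assms(1)]]])

lemma AC_AE_cong:
  assumes "AC F f" "AE r in halfline. g r = f r"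
  shows "AC F g"
  unfolding AC_def
proof (intro allI impI conjI)
  obtain N where N: "negligible N" "\<And>r. r > 0 \<Longrightarrow> r \<notin> N \<Longrightarrow> g r = f r"
    using AE_halfline_obtain_negligible[OF assms(2)] by blast
  fix r :: real assume r: "r \<ge> 0"
  have N': "negligible (insert 0 N)" using N(1) by simp
  show "g absolutely_integrable_on {0..r}"
    by (rule absolutely_integrable_spike[OF AC_absolutely_integrable[OF assms(1)] N']) (use N(2) in auto)
  show "(g has_integral F r - F 0) {0..r}"
    by (rule has_integral_spike[OF N' _ AC_has_integral[OF assms(1) r]]) (use N(2) in auto)
qed

text \<open>As \<open>v\<close> is in \<open>L2\<close>, it can be integrated from 0. The primitive
  has the same weak derivative as \<open>u\<close>, and du Bois-Reymond makes the difference
  constant.\<close>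

lemma weak_deriv_imp_AC:
  assumes w: "is_weak_deriv u v" and v: "v \<in> L2"
  obtains U where "AC U v" "AE r in halfline. u r = U r"
proof -
  define U where "U = (\<lambda>r. integral {0..r} v)"
  have AC: "AC U v" unfolding U_def by (rule AC_I) (auto intro: L2_absolutely_integrable[OF v])
  have wU: "is_weak_deriv U v" by (rule AC_weak_deriv[OF AC])
  note li = weak_deriv_loc_int(1)[OF w] weak_deriv_loc_int(1)[OF wU]
  obtain C where C: "AE r in halfline. u r - U r = C"
  proof -
    have "(LINT r|halfline. (u r - U r) * of_real (deriv \<phi> r)) = 0" if \<phi>: "test_function \<phi>" for \<phi>
    proof -
      have "(LINT r|halfline. u r * of_real (deriv \<phi> r)) = (LINT r|halfline. U r * of_real (deriv \<phi> r))"
        using w wU \<phi> unfolding is_weak_deriv_def by metis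
      then show ?thesis
        unfolding left_diff_distrib
        using test_integrable(2)[OF li(1) \<phi>] test_integrable(2)[OF li(2) \<phi>]
        by (subst Bochner_Integration.integral_diff) simp_all
    qed
    then show ?thesis using du_Bois_Reymond[OF loc_int_diff[OF li]] that by blast
  qed
  have "AC (\<lambda>r. U r + C) v" using AC_add[OF AC AC_const[of C]] by simp
  moreover have "AE r in halfline. u r = U r + C" using C by (rule eventually_mono) (simp add: algebra_simps)
  ultimately show ?thesis by (rule that)
qed

text \<open>An open interval ending at 0 is not null. The lemma identifies the boundary value of the
  representative in \<open>zero_trace\<close> with that of any other continuous one.\<close>

lemma continuous_AE_eq_at_0:
  fixes F G :: "real \<Rightarrow> complex"
  assumes "continuous_on {0..} F" "continuous_on {0..} G" "AE r in halfline. F r = G r"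
  shows "F 0 = G 0"
proof (rule ccontr)
  assume ne: "F 0 \<noteq> G 0"
  have c: "continuous_on {0..} (\<lambda>r. F r - G r)" by (intro continuous_intros assms)
  then obtain d where d: "d > 0" "\<And>x. x \<in> {0..} \<Longrightarrow> dist x 0 < d \<Longrightarrow> dist (F x - G x) (F 0 - G 0) < cmod (F 0 - G 0)"
    unfolding continuous_on_iff using ne by (metis atLeast_iff order_refl right_minus_eq zero_less_norm_iff)
  obtain N where N: "negligible N" "\<And>r. r > 0 \<Longrightarrow> r \<notin> N \<Longrightarrow> F r = G r"
    using AE_halfline_obtain_negligible[OF assms(3)] by blast
  have "{0<..<d} \<subseteq> N"
  proof
    fix x assume x: "x \<in> {0<..<d}"
    then have "dist (F x - G x) (F 0 - G 0) < cmod (F 0 - G 0)" by (intro d) auto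
    then have "F x \<noteq> G x" by (auto simp: dist_norm norm_minus_commute)
    then show "x \<in> N" using N(2)[of x] x by auto
  qed
  then have "negligible {0<..<d}" using N(1) negligible_subset by blast
  moreover have "\<not> negligible (box 0 d)" by (rule open_not_negligible) (use d in auto)
  ultimately show False by simp
qed

section \<open>Passage between the operator \<open>PD\<close> and the ordinary differential
  equation\<close>

lemma solves_imp_dom_PD:
  assumes s: "solves V z f u p" and f: "f \<in> L2"
    and V: "V \<in> borel_measurable halfline" "\<And>r. r > 0 \<Longrightarrow> \<bar>V r\<bar> \<le> B"
  shows "u \<in> dom_PD" "AE r in halfline. PD V u r - z * u r = f r"
proof -
  note sD = solvesD[OF s]
  define h where "h = (\<lambda>r. (of_real (V r) - z) * u r - f r)"
  have wu: "is_weak_deriv u p" by (rule AC_weak_deriv[OF sD(4)])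
  have wp: "is_weak_deriv p h" unfolding h_def by (rule AC_weak_deriv[OF sD(5)])
  have m: "(\<lambda>r. complex_of_real (V r) - z) \<in> borel_measurable halfline" using V(1) by measurable
  have "(\<lambda>r. (of_real (V r) - z) * u r) \<in> L2"
    by (rule L2_bounded_mult[OF sD(1) m, of "B + cmod z"])
      (rule order_trans[OF norm_triangle_ineq4], use V(2) in simp)
  then have hL: "h \<in> L2" unfolding h_def by (intro L2_diff f)
  have "zero_trace u" unfolding zero_trace_def
    by (intro exI[of _ u]) (use AC_continuous[OF sD(4)] sD(3) in auto)
  then show "u \<in> dom_PD" unfolding dom_PD_def H2_def using sD hL wu wp by blast
  show "AE r in halfline. PD V u r - z * u r = f r"
    using second_weak_deriv_AE[OF wu wp] by (rule eventually_mono) (simp add: PD_def h_def algebra_simps)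
qed

text \<open>Each weak derivative is matched with an absolutely continuous representative; uniqueness
  of weak derivatives turns the equation for \<open>PD\<close> into the one for \<open>p\<close>,
  and the trace condition gives \<open>u 0 = 0\<close>.\<close>

lemma dom_PD_imp_solves:
  assumes d: "u\<^sub>0 \<in> dom_PD" and e: "AE r in halfline. PD V u\<^sub>0 r - z * u\<^sub>0 r = f r"
  obtains u p where "solves V z f u p" "AE r in halfline. u\<^sub>0 r = u r"
proof -
  obtain v w where vw: "u\<^sub>0 \<in> L2" "v \<in> L2" "w \<in> L2" "is_weak_deriv u\<^sub>0 v" "is_weak_deriv v w" "zero_trace u\<^sub>0"
    using d unfolding dom_PD_def H2_def by blast
  obtain u where u: "AC u v" "AE r in halfline. u\<^sub>0 r = u r" using weak_deriv_imp_AC[OF vw(4,2)] by blast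
  obtain p where p: "AC p w" "AE r in halfline. v r = p r" using weak_deriv_imp_AC[OF vw(5,3)] by blast
  have "AE r in halfline. p r = v r" using p(2) by (rule eventually_mono) simp
  note ACu = AC_AE_cong[OF u(1) this]
  have w: "AE r in halfline. (of_real (V r) - z) * u r - f r = w r"
    using second_weak_deriv_AE[OF vw(4,5)] e u(2)
    by eventually_elim (auto simp: PD_def algebra_simps)
  obtain u' where u': "continuous_on {0..} u'" "AE r in halfline. u' r = u\<^sub>0 r" "u' 0 = 0"
    using vw(6) unfolding zero_trace_def by blast
  have "AE r in halfline. u r = u' r" using u(2) u'(2) by eventually_elim simp
  then have "u 0 = u' 0" by (rule continuous_AE_eq_at_0[OF AC_continuous[OF u(1)] u'(1)])
  moreover have "u \<in> L2" by (rule L2_AE_cong(1)[OF vw(1)]) (use u(2) in \<open>auto elim: eventually_mono\<close>)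
  moreover have "p \<in> L2" by (rule L2_AE_cong(1)[OF vw(2)]) (use p(2) in \<open>auto elim: eventually_mono\<close>)
  ultimately have "solves V z f u p" unfolding solves_def using ACu AC_AE_cong[OF p(1) w] u'(3) by simp
  then show ?thesis using u(2) by (rule that)
qed

context decaying_potential begin

text \<open>Existence ensures that the choice in \<open>resolvent\<close> meets its specification;
  the estimates for \<open>solves\<close> then hold for whichever function was chosen.\<close>

lemma resolvent_solves:
  assumes k: "Im k > 0" and f: "f \<in> L2"
  obtains u p where "solves V (k\<^sup>2) f u p" "AE r in halfline. resolvent V (k\<^sup>2) f r = u r"
proof -
  obtain u p where s: "solves V (k\<^sup>2) f u p"
    using solves_exists[OF k V_measurable V_nonneg V_le f] by blast
  have b: "\<bar>V r\<bar> \<le> B" if "r > 0" for r using V_nonneg[of r] V_le[of r] that by simp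
  have "resolvent V (k\<^sup>2) f \<in> dom_PD \<and> (AE r in halfline. PD V (resolvent V (k\<^sup>2) f) r - k\<^sup>2 * resolvent V (k\<^sup>2) f r = f r)"
    unfolding resolvent_def
    by (rule someI[where x = u]) (use solves_imp_dom_PD[OF s f V_measurable b] in simp)
  then obtain u p where "solves V (k\<^sup>2) f u p" "AE r in halfline. resolvent V (k\<^sup>2) f r = u r"
    using dom_PD_imp_solves[of "resolvent V (k\<^sup>2) f" V "k\<^sup>2" f] by blast
  then show ?thesis by (rule that)
qed

lemma resolvent_symmetric_operator:
  assumes k: "Im k > 0"
  shows "symmetric_operator (resolvent V (k\<^sup>2)) (1 / (Im k * cmod k))"
proof
  fix f assume f: "f \<in> L2"
  obtain u p where u: "solves V (k\<^sup>2) f u p" "AE r in halfline. resolvent V (k\<^sup>2) f r = u r"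
    using resolvent_solves[OF k f] by blast
  note L = L2_AE_cong[OF solvesD(1)[OF u(1)] u(2)]
  show "resolvent V (k\<^sup>2) f \<in> L2" by (rule L(1))
  show "nrm (resolvent V (k\<^sup>2) f) \<le> 1 / (Im k * cmod k) * nrm f"
    unfolding L(2) using solves_apriori(1)[OF u(1) f V_nonneg k] by simp
  fix g assume g: "g \<in> L2"
  obtain v s where v: "solves V (k\<^sup>2) g v s" "AE r in halfline. resolvent V (k\<^sup>2) g r = v r"
    using resolvent_solves[OF k g] by blast
  note Lg = L2_AE_cong[OF solvesD(1)[OF v(1)] v(2)]
  have m: "f \<in> borel_measurable halfline" "g \<in> borel_measurable halfline" "u \<in> borel_measurable halfline" "v \<in> borel_measurable halfline"
    "resolvent V (k\<^sup>2) f \<in> borel_measurable halfline" "resolvent V (k\<^sup>2) g \<in> borel_measurable halfline"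
    using f g solvesD(1)[OF u(1)] solvesD(1)[OF v(1)] L(1) Lg(1) L2_measurable by auto
  have "(LINT r|halfline. resolvent V (k\<^sup>2) f r * g r) = (LINT r|halfline. u r * g r)"
    by (rule integral_cong_AE) (use m u(2) in \<open>auto elim!: eventually_mono\<close>)
  also have "\<dots> = (LINT r|halfline. f r * v r)" by (rule solves_symmetric[OF u(1) v(1) f g])
  also have "\<dots> = (LINT r|halfline. f r * resolvent V (k\<^sup>2) g r)"
    by (rule integral_cong_AE) (use m v(2) in \<open>auto elim!: eventually_mono\<close>)
  finally show "(LINT r|halfline. resolvent V (k\<^sup>2) f r * g r) = (LINT r|halfline. f r * resolvent V (k\<^sup>2) g r)" .
qed (use k in auto)

end

section \<open>The resolvent bounds\<close>

lemma op_norm_le: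
  assumes "\<And>f. f \<in> L2 \<Longrightarrow> T f \<in> L2" "\<And>f. f \<in> L2 \<Longrightarrow> nrm (T f) \<le> C * nrm f" "C \<ge> 0"
  shows "op_norm T \<le> ennreal C"
  unfolding op_norm_def
proof (rule SUP_least)
  fix f assume "f \<in> {f. L2_norm f \<le> 1}"
  then have "L2_norm f \<le> 1" by simp
  \<comment> \<open>Outside \<open>L2\<close> the value of \<open>L2_norm\<close> is infinite, so
    the unit ball lies in \<open>L2\<close>.\<close>
  then have f: "f \<in> L2" "nrm f \<le> 1"
    by (auto simp: L2_norm_def nrm_def top_unique split: if_splits)
  have "nrm (T f) \<le> C * 1"
    by (rule order_trans[OF assms(2)[OF f(1)]]) (intro mult_left_mono f assms)
  then show "L2_norm (T f) \<le> ennreal C"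
    using assms(1)[OF f(1)] by (simp add: L2_norm_def nrm_def ennreal_leI)
qed

text \<open>A real square root would make \<open>z\<close> a nonnegative real; otherwise one of the
  two roots lies in the upper half plane.\<close>

lemma exists_sqrt_upper_half_plane:
  assumes "z \<notin> complex_of_real ` {0..}"
  obtains k where "k\<^sup>2 = z" "Im k > 0"
proof -
  have "Im (csqrt z) \<noteq> 0"
  proof
    assume "Im (csqrt z) = 0"
    then have "csqrt z = of_real (Re (csqrt z))" by (simp add: complex_eq_iff)
    then have "z = of_real ((Re (csqrt z))\<^sup>2)" by (metis of_real_power power2_csqrt)
    then show False using assms by (metis atLeast_iff imageI zero_le_power2)
  qed
  then consider "Im (csqrt z) > 0" | "Im (- csqrt z) > 0" by fastforce
  then show ?thesis
    using that[of "csqrt z"] that[of "- csqrt z"] by cases (simp_all add: power2_csqrt)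
qed

lemma admissible_decaying_potential:
  assumes "admissible_potential c V" "c > 0"
  obtains B where "decaying_potential V B c"
proof -
  have V: "bounded (V ` {0..})" "\<And>r. r \<ge> 0 \<Longrightarrow> 0 \<le> V r" "antimono_on {0..} V" "log_decay c V"
    using assms(1) unfolding admissible_potential_def by auto
  obtain B where B: "\<And>r. r \<ge> 0 \<Longrightarrow> norm (V r) \<le> B" using V(1) unfolding bounded_iff by auto
  have "decaying_potential V B c"
  proof
    show "V r \<le> B" if "r \<ge> 0" for r using B[OF that] by simp
    show "V y * (1 + y) powr c \<le> V x * (1 + x) powr c" if "0 \<le> x" "x \<le> y" for x y
      by (rule log_decay_antimono[OF V(3,2,4) assms(2) that])
  qed (use V assms(2) in auto)
  then show ?thesis by (rule that)
qed

context decaying_potential begin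

lemma pot_power_measurable: "(\<lambda>r. pot_power V a r) \<in> borel_measurable halfline"
  unfolding pot_power_def using V_measurable by (cases "a = 0") auto

lemma pot_power_bounded:
  assumes "r > 0" "a \<in> {0..1}"
  shows "0 \<le> pot_power V a r" "pot_power V a r \<le> max 1 B"
proof -
  \<comment> \<open>With the base enlarged to at least 1, the power increases with the exponent and
    is largest at exponent 1.\<close>
  have "V r powr a \<le> max 1 B powr a"
    by (rule powr_mono2) (use assms V_nonneg[of r] V_le[of r] in auto)
  also have "\<dots> \<le> max 1 B powr 1" by (rule powr_mono) (use assms in auto)
  finally show "pot_power V a r \<le> max 1 B" unfolding pot_power_def by auto
qed (simp add: pot_power_def)

text \<open>The two weights of the second estimate are the members at \<theta> and 1 - \<theta>;
  both weights of the first are the member at 0.\<close>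

definition wt_family :: "real \<Rightarrow> real \<Rightarrow> real \<Rightarrow> real" where
  "wt_family \<delta> s = wt (- ((1 + \<delta>) / 2) - s)"

text \<open>The member at 1 - \<theta> is the right-hand weight of the third estimate. The exponents
  of \<open>V\<close> and of 1 + r are affine in \<open>s\<close>; the endpoints are sqrt V
  (1+r)^(-1/2) at 1 and (1+r)^(-(1+\<delta>)/2) at 0.\<close>

definition pot_family :: "real \<Rightarrow> real \<Rightarrow> real \<Rightarrow> real" where
  "pot_family \<delta> s = (\<lambda>r. pot_power V (s / 2) r * wt (- ((1 + (1 - s) * \<delta>) / 2)) r)"

lemma wt_family_interpolation:
  assumes k: "Im k > 0" and \<delta>: "\<delta> > 0"
  shows "weight_family (resolvent V (k\<^sup>2)) (1 / (Im k * cmod k)) (wt_family \<delta>) 1"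
proof -
  interpret symmetric_operator "resolvent V (k\<^sup>2)" "1 / (Im k * cmod k)"
    by (rule resolvent_symmetric_operator[OF k])
  show ?thesis
  proof
    fix s :: real assume s: "s \<in> {0..1}"
    show "wt_family \<delta> s \<in> borel_measurable halfline" unfolding wt_family_def by (rule wt_measurable)
    show "\<bar>wt_family \<delta> s r\<bar> \<le> 1" if "r > 0" for r
    proof -
      have "(1 + \<delta>) / 2 \<ge> 0" "s \<ge> 0" using s \<delta> by auto
      then have "- ((1 + \<delta>) / 2) - s \<le> 0" by linarith
      then show ?thesis unfolding wt_family_def using wt_le_1 that by simp
    qed
  next
    fix s t s' t' r :: real assume "s + t = s' + t'"
    then show "wt_family \<delta> s r * wt_family \<delta> t r = wt_family \<delta> s' r * wt_family \<delta> t' r"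
      unfolding wt_family_def wt_def by (simp add: powr_add[symmetric] algebra_simps)
  qed
qed

lemma pot_family_interpolation:
  assumes k: "Im k > 0" and \<delta>: "\<delta> > 0"
  shows "weight_family (resolvent V (k\<^sup>2)) (1 / (Im k * cmod k)) (pot_family \<delta>) (max 1 B)"
proof -
  interpret symmetric_operator "resolvent V (k\<^sup>2)" "1 / (Im k * cmod k)"
    by (rule resolvent_symmetric_operator[OF k])
  show ?thesis
  proof
    fix s :: real assume s: "s \<in> {0..1}"
    show "pot_family \<delta> s \<in> borel_measurable halfline" unfolding pot_family_def
      using pot_power_measurable wt_measurable by measurable
    show "\<bar>pot_family \<delta> s r\<bar> \<le> max 1 B" if r: "r > 0" for r
    proof -
      have a: "- ((1 + (1 - s) * \<delta>) / 2) \<le> 0" using s \<delta> by simp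
      have "pot_power V (s / 2) r * wt (- ((1 + (1 - s) * \<delta>) / 2)) r \<le> max 1 B * 1"
        by (intro mult_mono pot_power_bounded wt_le_1 a) (use s r in auto)
      then show ?thesis unfolding pot_family_def using pot_power_bounded(1)[OF r, of "s / 2"] s by (simp add: abs_mult)
    qed
  next
    fix s t s' t' r :: real assume s: "s \<in> {0..1}" "t \<in> {0..1}" "s' \<in> {0..1}" "t' \<in> {0..1}" and e: "s + t = s' + t'"
    \<comment> \<open>The sum vanishes only if both parameters do; then the convention for the
      zeroth power gives 1 even where \<open>V\<close> is 0.\<close>
    have p: "pot_power V (s / 2) r * pot_power V (t / 2) r = (if s + t = 0 then 1 else V r powr ((s + t) / 2))"
      if "s \<in> {0..1}" "t \<in> {0..1}" for s t
      using that unfolding pot_power_def by (auto simp: powr_add[symmetric] add_divide_distrib)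
    have w: "wt (- ((1 + (1 - s) * \<delta>) / 2)) r * wt (- ((1 + (1 - t) * \<delta>) / 2)) r = (1 + r) powr (- 1 - \<delta> + (s + t) * \<delta> / 2)" for s t
      unfolding wt_def powr_add[symmetric] by (rule arg_cong[of _ _ "\<lambda>x. (1 + r) powr x"]) (simp add: field_simps)
    have *: "pot_family \<delta> s r * pot_family \<delta> t r
       = (if s + t = 0 then 1 else V r powr ((s + t) / 2)) * (1 + r) powr (- 1 - \<delta> + (s + t) * \<delta> / 2)"
      if "s \<in> {0..1}" "t \<in> {0..1}" for s t
      unfolding pot_family_def p[OF that, symmetric] w[symmetric] by (simp only: ac_simps)
    show "pot_family \<delta> s r * pot_family \<delta> t r = pot_family \<delta> s' r * pot_family \<delta> t' r"
      unfolding *[OF s(1,2)] *[OF s(3,4)] e ..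
  qed
qed

text \<open>The estimates for the continuous solution \<open>u\<close> pass to the chosen
  representative \<open>R\<close>, because weighted norms ignore null sets.\<close>

lemma resolvent_bounds:
  assumes k: "Im k > 0" and \<delta>: "\<delta> > 0" and f: "f \<in> L2"
  defines "R \<equiv> resolvent V (k\<^sup>2) (\<lambda>r. of_real (wt (- ((1 + \<delta>) / 2)) r) * f r)"
  shows "nrm (\<lambda>r. of_real (wt (- ((1 + \<delta>) / 2)) r) * R r) \<le> (1 + sqrt 2) / cmod k * (1 / \<delta> + 1 / c) * nrm f"
    and "nrm (\<lambda>r. of_real (wt (- ((1 + \<delta>) / 2) - 1) r) * R r) \<le> (1 + sqrt 2) * (1 / \<delta> + 1 / c) * nrm f"
    and "nrm (\<lambda>r. of_real (pot_family \<delta> 1 r) * R r) \<le> 2 * sqrt 2 / c * sqrt (1 + c / \<delta>) * nrm f"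
proof -
  have a: "- ((1 + \<delta>) / 2) \<le> 0" using \<delta> by simp
  obtain u p where u: "solves V (k\<^sup>2) (\<lambda>r. of_real (wt (- ((1 + \<delta>) / 2)) r) * f r) u p" "AE r in halfline. R r = u r"
    using resolvent_solves[OF k L2_wt[OF a f]] unfolding R_def by blast
  note b = weighted_bounds[OF u(1) f \<delta> k]
  have uL: "u \<in> L2" by (rule solvesD(1)[OF u(1)])
  have n: "nrm (\<lambda>r. of_real (w r) * R r) = nrm (\<lambda>r. of_real (w' r) * u r)"
    if "(\<lambda>r. of_real (w' r) * u r) \<in> L2" "\<And>r. r > 0 \<Longrightarrow> w r = w' r" for w w' :: "real \<Rightarrow> real"
  proof (rule L2_AE_cong(2)[OF that(1)])
    have "AE r in halfline. r > 0" by (rule AE_I2) simp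
    with u(2) show "AE r in halfline. complex_of_real (w r) * R r = of_real (w' r) * u r"
      by eventually_elim (simp add: that(2))
  qed
  show "nrm (\<lambda>r. of_real (wt (- ((1 + \<delta>) / 2)) r) * R r) \<le> (1 + sqrt 2) / cmod k * (1 / \<delta> + 1 / c) * nrm f"
    using b(1) n[OF L2_wt[OF a uL] refl] by simp
  show "nrm (\<lambda>r. of_real (wt (- ((1 + \<delta>) / 2) - 1) r) * R r) \<le> (1 + sqrt 2) * (1 / \<delta> + 1 / c) * nrm f"
    using b(2) n[OF L2_wt[OF _ uL, of "- ((1 + \<delta>) / 2) - 1"] refl] a by simp
  have "nrm (\<lambda>r. of_real (pot_family \<delta> 1 r) * R r) = nrm (\<lambda>r. of_real (sqrt (V r) * wt (- (1 / 2)) r) * u r)"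
  proof (rule n[OF sqrt_weight_L2(1)[OF uL]])
    fix r :: real assume "r > 0"
    then show "pot_family \<delta> 1 r = sqrt (V r) * wt (- (1 / 2)) r"
      using V_nonneg[of r] unfolding pot_family_def pot_power_def by (simp add: powr_half_sqrt)
  qed
  then show "nrm (\<lambda>r. of_real (pot_family \<delta> 1 r) * R r) \<le> 2 * sqrt 2 / c * sqrt (1 + c / \<delta>) * nrm f"
    using b(3) by simp
qed

end

theorem theorem1p3:
  fixes V\<^sub>D :: "real \<Rightarrow> real" and \<delta>\<^sub>V \<delta> \<theta> :: real and z :: complex
  assumes "\<delta>\<^sub>V > 0" and "admissible_potential \<delta>\<^sub>V V\<^sub>D"
    and "\<delta> > 0" and "\<theta> \<in> {0..1}" and "z \<notin> complex_of_real ` {0..}"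
  shows
    "op_norm (mult_op (wt (- ((1 + \<delta>) / 2))) \<circ> resolvent V\<^sub>D z \<circ> mult_op (wt (- ((1 + \<delta>) / 2))))
       \<le> ennreal ((1 + sqrt 2) / sqrt (cmod z) * (1 / \<delta> + 1 / \<delta>\<^sub>V)) \<and>
     op_norm (mult_op (wt (- ((1 + \<delta>) / 2) - \<theta>)) \<circ> resolvent V\<^sub>D z
              \<circ> mult_op (wt (- ((1 + \<delta>) / 2) - (1 - \<theta>))))
       \<le> ennreal ((1 + sqrt 2) * (1 / \<delta> + 1 / \<delta>\<^sub>V)) \<and>
     op_norm (mult_op (\<lambda>r. pot_power V\<^sub>D (\<theta> / 2) r * wt (- ((1 + (1 - \<theta>) * \<delta>) / 2)) r)
              \<circ> resolvent V\<^sub>D z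
              \<circ> mult_op (\<lambda>r. pot_power V\<^sub>D ((1 - \<theta>) / 2) r * wt (- ((1 + \<theta> * \<delta>) / 2)) r))
       \<le> ennreal (2 * sqrt 2 / \<delta>\<^sub>V * sqrt (1 + \<delta>\<^sub>V / \<delta>))"
proof -
  obtain B where "decaying_potential V\<^sub>D B \<delta>\<^sub>V"
    using admissible_decaying_potential[OF assms(2,1)] by blast
  then interpret decaying_potential V\<^sub>D B \<delta>\<^sub>V .
  obtain k where k: "k\<^sup>2 = z" "Im k > 0" using exists_sqrt_upper_half_plane[OF assms(5)] by blast
  have kz: "sqrt (cmod z) = cmod k" unfolding k(1)[symmetric] by (simp add: norm_power)
  interpret w: weight_family "resolvent V\<^sub>D z" "1 / (Im k * cmod k)" "wt_family \<delta>" 1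
    using wt_family_interpolation[OF k(2) assms(3)] unfolding k(1) .
  interpret p: weight_family "resolvent V\<^sub>D z" "1 / (Im k * cmod k)" "pot_family \<delta>" "max 1 B"
    using pot_family_interpolation[OF k(2) assms(3)] unfolding k(1) .
  note bounds = resolvent_bounds[OF k(2) assms(3), unfolded k(1)]
  have \<theta>: "\<theta> \<in> {0..1}" "1 - \<theta> \<in> {0..1}" using assms(4) by auto
  have sum: "1 / \<delta> + 1 / \<delta>\<^sub>V \<ge> 0" using assms by (intro add_nonneg_nonneg) auto
  have nonneg: "(1 + sqrt 2) / cmod k * (1 / \<delta> + 1 / \<delta>\<^sub>V) \<ge> 0" "(1 + sqrt 2) * (1 / \<delta> + 1 / \<delta>\<^sub>V) \<ge> 0"
    "2 * sqrt 2 / \<delta>\<^sub>V * sqrt (1 + \<delta>\<^sub>V / \<delta>) \<ge> 0"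
    using sum assms by (auto intro!: mult_nonneg_nonneg divide_nonneg_nonneg add_nonneg_nonneg)
  have mult_op_comp: "mult_op a \<circ> resolvent V\<^sub>D z \<circ> mult_op b = w.sandwich a b" for a b
    unfolding mult_op_def w.sandwich_def by (rule ext) simp
  \<comment> \<open>The endpoint \<theta> = 1 is the direct estimate through the Hardy inequality;
    interpolation keeps its constant for all \<theta>.\<close>
  have wle: "w.sandwich_le (wt_family \<delta> \<theta>) (wt_family \<delta> (1 - \<theta>)) ((1 + sqrt 2) * (1 / \<delta> + 1 / \<delta>\<^sub>V))"
  proof (rule w.sandwich_interpolation[OF _ nonneg(2) \<theta>(1)])
    show "w.sandwich_le (wt_family \<delta> 1) (wt_family \<delta> 0) ((1 + sqrt 2) * (1 / \<delta> + 1 / \<delta>\<^sub>V))"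
      unfolding w.sandwich_le_def w.sandwich_def wt_family_def using bounds(2) by simp
  qed
  \<comment> \<open>\<open>sandwich\<close> and \<open>sandwich_le\<close> depend on the operator
    alone, so the versions from \<open>w\<close> also serve for the weights of
    \<open>p\<close>.\<close>
  have ple: "w.sandwich_le (pot_family \<delta> \<theta>) (pot_family \<delta> (1 - \<theta>)) (2 * sqrt 2 / \<delta>\<^sub>V * sqrt (1 + \<delta>\<^sub>V / \<delta>))"
  proof (rule p.sandwich_interpolation[OF _ nonneg(3) \<theta>(1)])
    have "pot_family \<delta> 0 = wt (- ((1 + \<delta>) / 2))" unfolding pot_family_def pot_power_def by simp
    then show "w.sandwich_le (pot_family \<delta> 1) (pot_family \<delta> 0) (2 * sqrt 2 / \<delta>\<^sub>V * sqrt (1 + \<delta>\<^sub>V / \<delta>))"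
      unfolding w.sandwich_le_def w.sandwich_def using bounds(3) by simp
  qed
  have 0: "wt (- ((1 + \<delta>) / 2)) = wt_family \<delta> 0" unfolding wt_family_def by simp
  \<comment> \<open>Both weights have parameter 0, so the direct estimate applies without
    interpolation.\<close>
  have "op_norm (w.sandwich (wt_family \<delta> 0) (wt_family \<delta> 0)) \<le> ennreal ((1 + sqrt 2) / cmod k * (1 / \<delta> + 1 / \<delta>\<^sub>V))"
    by (rule op_norm_le[OF w.sandwich_L2(1) _ nonneg(1)]) (use bounds(1) in \<open>auto simp: w.sandwich_def 0\<close>)
  moreover have "op_norm (w.sandwich (wt_family \<delta> \<theta>) (wt_family \<delta> (1 - \<theta>))) \<le> ennreal ((1 + sqrt 2) * (1 / \<delta> + 1 / \<delta>\<^sub>V))"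
    by (rule op_norm_le[OF w.sandwich_L2(1)[OF \<theta>] _ nonneg(2)]) (use wle in \<open>auto simp: w.sandwich_le_def\<close>)
  moreover have "op_norm (w.sandwich (pot_family \<delta> \<theta>) (pot_family \<delta> (1 - \<theta>))) \<le> ennreal (2 * sqrt 2 / \<delta>\<^sub>V * sqrt (1 + \<delta>\<^sub>V / \<delta>))"
    by (rule op_norm_le[OF p.sandwich_L2(1)[OF \<theta>] _ nonneg(3)]) (use ple in \<open>auto simp: w.sandwich_le_def\<close>)
  ultimately show ?thesis
    unfolding mult_op_comp kz 0 by (simp add: wt_family_def pot_family_def)
qed

end
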